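(* Suppose $\mathcal V$ is a rigid monoidal category and $\mathcal C$ is a tensored $\mathcal V$-category. Then the $\mathcal V$-functor $\mathcal I:\mathcal C\to\overline{\mathcal C}$ is tensored, and $\mathcal C$ is $\mathcal V$-equivalent to $\overline{\mathcal C}$.
   Context: Conventions: composition is written left to right; tensor products in $\mathcal V$ are juxtaposition; associators and unitors are suppressed; "mate" means the morphism corresponding under the indicated adjunction. Rigid: every object $v$ has a dual $v^*$ with $\mathrm{ev}_v:vv^*\to1_{\mathcal V}$ and $\mathrm{coev}_v:1_{\mathcal V}\to v^*v$ satisfying the zig-zag relations (and is itself such a dual); then $\mathcal V$ is closed with $\widehat{\mathcal V}(u\to v)=u^*v$, where $\mathcal V(uw\to v)\cong\mathcal V(w\to\widehat{\mathcal V}(u\to v))$; $\varepsilon^{\widehat{\mathcal V}}_{u\to v}:u\widehat{\mathcal V}(u\to v)\to v$ is the mate of the identity and $\widehat{\mathcal V}$ is the self-enriched $\mathcal V$-category. A $\mathcal V$-category $\mathcal C$ has hom objects $\mathcal C(a\to b)\in\mathcal V$, identities $j_a:1_{\mathcal V}\to\mathcal C(a\to a)$ and composition $-\circ_{\mathcal C}-:\mathcal C(a\to b)\mathcal C(b\to c)\to\mathcal C(a\to c)$, associative and unital. A $\mathcal V$-functor $F$ has morphisms $F_{a\to b}:\mathcal C(a\to b)\to\mathcal D(F(a)\to F(b))$ compatible with composition and identities. The underlying category $\mathcal C^{\mathcal V}$ has $\mathcal C^{\mathcal V}(a\to b)=\mathcal V(1_{\mathcal V}\to\mathcal C(a\to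 b))$. $\mathcal R^a:\mathcal C\to\widehat{\mathcal V}$ is $b\mapsto\mathcal C(a\to b)$, with action the mate of $-\circ_{\mathcal C}-$. $\mathcal C$ is tensored if each $\mathcal R^a$ has a left $\mathcal V$-adjoint $v\mapsto a\vartriangleleft v$, i.e. a $\mathcal V$-functor $\widehat{\mathcal V}\to\mathcal C$ with $\mathcal V$-natural isomorphisms $\mathcal C(a\vartriangleleft v\to b)\cong\widehat{\mathcal V}(v\to\mathcal C(a\to b))$. Then $\mathcal C^{\mathcal V}(a\vartriangleleft v\to b)\cong\mathcal V(v\to\mathcal C(a\to b))$, with unit $\eta^{\mathcal C}_{a,v}:v\to\mathcal C(a\to a\vartriangleleft v)$. A $\mathcal V$-functor $F:\mathcal C\to\mathcal D$ of tensored $\mathcal V$-categories is tensored if for all $c,v$ the morphism $\mu^F_{c,v}\in\mathcal D^{\mathcal V}(F(c)\vartriangleleft v\to F(c\vartriangleleft v))$, the mate of $\eta^{\mathcal C}_{c,v}\circ F_{c\to c\vartriangleleft v}\in\mathcal V(v\to\mathcal D(F(c)\to F(c\vartriangleleft v)))$, is an isomorphism. $\mathcal V$-equivalent means there are mutually inverse $\mathcal V$-functors up to $\mathcal V$-natural isomorphism. Completion: $\overline{\mathcal C}$ has objects formal symbols $a\blacktriangleleft u$ ($a\in\mathcal C$, $u\in\mathcal V$), hom objects $\overline{\mathcal C}(a\blacktriangleleft u\to b\blacktriangleleft v)=\widehat{\mathcal V}(u\to\mathcal C(a\to b)v)$, identity $j_{a\blacktriangleleft u}$ the mate of $j_a\mathrm{id}_u$,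 and composition the mate of $(\varepsilon^{\widehat{\mathcal V}}_{u\to\mathcal C(a\to b)v}\mathrm{id})\circ(\mathrm{id}_{\mathcal C(a\to b)}\varepsilon^{\widehat{\mathcal V}}_{v\to\mathcal C(b\to c)w})\circ((-\circ_{\mathcal C}-)\mathrm{id}_w)$. It is tensored with $(a\blacktriangleleft u)\vartriangleleft v=a\blacktriangleleft uv$. $\mathcal I$ is $a\mapsto a\blacktriangleleft1_{\mathcal V}$ with $\mathcal I_{a\to b}:\mathcal C(a\to b)\to\widehat{\mathcal V}(1_{\mathcal V}\to\mathcal C(a\to b))$ the mate of $\mathrm{id}_{\mathcal C(a\to b)}$. *)

theory Defs
  imports Main
begin

section \<open>Monoidal and rigid categories\<close>

text \<open>All compositions are in diagrammatic order: \<open>f \<cdot> g\<close> is first \<open>f\<close>, then \<open>g\<close>.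
  The locales named \<open>..._data\<close> carry no assumptions; they only fix notation, so the constants
  defined in them are unconditional functions of the structure \<open>V\<close>.\<close>

record ('o, 'm) cat =
  Obj :: "'o set"
  Arr :: "'m set"
  Dom :: "'m \<Rightarrow> 'o"
  Cod :: "'m \<Rightarrow> 'o"
  Ide :: "'o \<Rightarrow> 'm"
  Cmp :: "'m \<Rightarrow> 'm \<Rightarrow> 'm"

locale cat_data =
  fixes V :: "('o, 'm, 'z) cat_scheme"
begin

abbreviation ide :: "'o \<Rightarrow> 'm" where "ide \<equiv> Ide V"

abbreviation cmp :: "'m \<Rightarrow> 'm \<Rightarrow> 'm" (infixl "\<cdot>" 55) where "f \<cdot> g \<equiv> Cmp V f g"

definition hom :: "'o \<Rightarrow> 'o \<Rightarrow> 'm set" where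
  "hom a b = {f \<in> Arr V. Dom V f = a \<and> Cod V f = b}"

definition inverses :: "'o \<Rightarrow> 'o \<Rightarrow> 'm \<Rightarrow> 'm \<Rightarrow> bool" where
  "inverses a b f g \<longleftrightarrow> f \<in> hom a b \<and> g \<in> hom b a \<and> f \<cdot> g = ide a \<and> g \<cdot> f = ide b"

definition iso :: "'o \<Rightarrow> 'o \<Rightarrow> 'm set" where
  "iso a b = {f. \<exists>g. inverses a b f g}"

definition inv :: "'m \<Rightarrow> 'm" where
  "inv f = (THE g. inverses (Dom V f) (Cod V f) f g)"

end

locale category = cat_data V for V :: "('o, 'm, 'z) cat_scheme" +
  assumes Dom_Obj: "f \<in> Arr V \<Longrightarrow> Dom V f \<in> Obj V"
    and Cod_Obj: "f \<in> Arr V \<Longrightarrow> Cod V f \<in> Obj V"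
    and ide_hom: "a \<in> Obj V \<Longrightarrow> ide a \<in> hom a a"
    and cmp_hom: "f \<in> hom a b \<Longrightarrow> g \<in> hom b c \<Longrightarrow> f \<cdot> g \<in> hom a c"
    and ide_cmp: "f \<in> hom a b \<Longrightarrow> ide a \<cdot> f = f"
    and cmp_ide: "f \<in> hom a b \<Longrightarrow> f \<cdot> ide b = f"
    and cmp_assoc: "f \<in> hom a b \<Longrightarrow> g \<in> hom b c \<Longrightarrow> h \<in> hom c d \<Longrightarrow> f \<cdot> g \<cdot> h = f \<cdot> (g \<cdot> h)"

record ('o, 'm) monoidal = "('o, 'm) cat" +
  TObj :: "'o \<Rightarrow> 'o \<Rightarrow> 'o"
  TArr :: "'m \<Rightarrow> 'm \<Rightarrow> 'm"
  Unt :: "'o"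
  Asc :: "'o \<Rightarrow> 'o \<Rightarrow> 'o \<Rightarrow> 'm"
  Lun :: "'o \<Rightarrow> 'm"
  Run :: "'o \<Rightarrow> 'm"

locale monoidal_data = cat_data V for V :: "('o, 'm, 'z) monoidal_scheme"
begin

abbreviation tobj :: "'o \<Rightarrow> 'o \<Rightarrow> 'o" (infixr "\<otimes>" 70) where "a \<otimes> b \<equiv> TObj V a b"
abbreviation tarr :: "'m \<Rightarrow> 'm \<Rightarrow> 'm" (infixr "\<odot>" 70) where "f \<odot> g \<equiv> TArr V f g"
abbreviation unt :: "'o" ("\<one>") where "\<one> \<equiv> Unt V"
abbreviation asc :: "'o \<Rightarrow> 'o \<Rightarrow> 'o \<Rightarrow> 'm" where "asc \<equiv> Asc V"
abbreviation lun :: "'o \<Rightarrow> 'm" where "lun \<equiv> Lun V"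
abbreviation run :: "'o \<Rightarrow> 'm" where "run \<equiv> Run V"

end

locale monoidal_category = monoidal_data V + category V
  for V :: "('o, 'm, 'z) monoidal_scheme" +
  assumes unt_Obj: "\<one> \<in> Obj V"
    and tobj_Obj: "a \<in> Obj V \<Longrightarrow> b \<in> Obj V \<Longrightarrow> a \<otimes> b \<in> Obj V"
    and tarr_hom: "f \<in> hom a b \<Longrightarrow> g \<in> hom c d \<Longrightarrow> f \<odot> g \<in> hom (a \<otimes> c) (b \<otimes> d)"
    and tarr_ide: "a \<in> Obj V \<Longrightarrow> b \<in> Obj V \<Longrightarrow> ide a \<odot> ide b = ide (a \<otimes> b)"
    and tarr_cmp: "f \<in> hom a b \<Longrightarrow> g \<in> hom b c \<Longrightarrow> f' \<in> hom a' b' \<Longrightarrow> g' \<in> hom b' c'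
      \<Longrightarrow> (f \<cdot> g) \<odot> (f' \<cdot> g') = (f \<odot> f') \<cdot> (g \<odot> g')"
    and asc_iso: "a \<in> Obj V \<Longrightarrow> b \<in> Obj V \<Longrightarrow> c \<in> Obj V
      \<Longrightarrow> asc a b c \<in> iso ((a \<otimes> b) \<otimes> c) (a \<otimes> (b \<otimes> c))"
    and asc_nat: "f \<in> hom a a' \<Longrightarrow> g \<in> hom b b' \<Longrightarrow> h \<in> hom c c'
      \<Longrightarrow> ((f \<odot> g) \<odot> h) \<cdot> asc a' b' c' = asc a b c \<cdot> (f \<odot> (g \<odot> h))"
    and lun_iso: "a \<in> Obj V \<Longrightarrow> lun a \<in> iso (\<one> \<otimes> a) a"
    and lun_nat: "f \<in> hom a b \<Longrightarrow> (ide \<one> \<odot> f) \<cdot> lun b = lun a \<cdot> f"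
    and run_iso: "a \<in> Obj V \<Longrightarrow> run a \<in> iso (a \<otimes> \<one>) a"
    and run_nat: "f \<in> hom a b \<Longrightarrow> (f \<odot> ide \<one>) \<cdot> run b = run a \<cdot> f"
    and pentagon: "a \<in> Obj V \<Longrightarrow> b \<in> Obj V \<Longrightarrow> c \<in> Obj V \<Longrightarrow> d \<in> Obj V
      \<Longrightarrow> asc (a \<otimes> b) c d \<cdot> asc a b (c \<otimes> d)
        = (asc a b c \<odot> ide d) \<cdot> asc a (b \<otimes> c) d \<cdot> (ide a \<odot> asc b c d)"
    and triangle: "a \<in> Obj V \<Longrightarrow> b \<in> Obj V
      \<Longrightarrow> asc a \<one> b \<cdot> (ide a \<odot> lun b) = run a \<odot> ide b"

context monoidal_data
begin

text \<open>\<open>w\<close> is a dual of \<open>v\<close> via \<open>e : v w \<rightarrow> 1\<close> and \<open>c : 1 \<rightarrow> w v\<close>.\<close>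

definition is_dual :: "'o \<Rightarrow> 'o \<Rightarrow> 'm \<Rightarrow> 'm \<Rightarrow> bool" where
  "is_dual v w e c \<longleftrightarrow>
     v \<in> Obj V \<and> w \<in> Obj V \<and> e \<in> hom (v \<otimes> w) \<one> \<and> c \<in> hom \<one> (w \<otimes> v) \<and>
     inv (run v) \<cdot> (ide v \<odot> c) \<cdot> inv (asc v w v) \<cdot> (e \<odot> ide v) \<cdot> lun v = ide v \<and>
     inv (lun w) \<cdot> (c \<odot> ide w) \<cdot> asc w v w \<cdot> (ide w \<odot> e) \<cdot> run w = ide w"

end

record ('o, 'm) rigid = "('o, 'm) monoidal" +
  Dual :: "'o \<Rightarrow> 'o"
  Ev :: "'o \<Rightarrow> 'm"
  Coev :: "'o \<Rightarrow> 'm"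

locale rigid_data = monoidal_data V for V :: "('o, 'm, 'z) rigid_scheme"

text \<open>The duals \<open>Dual V v\<close> are chosen data; that \<open>v\<close> is in turn a dual of some object is
  a mere existence requirement.\<close>

locale rigid_monoidal_category = rigid_data V + monoidal_category V
  for V :: "('o, 'm, 'z) rigid_scheme" +
  assumes dual: "v \<in> Obj V \<Longrightarrow> is_dual v (Dual V v) (Ev V v) (Coev V v)"
    and predual: "v \<in> Obj V \<Longrightarrow> \<exists>w e c. is_dual w v e c"


section \<open>Enriched categories and functors\<close>

record ('c, 'o, 'm) vcat =
  VObj :: "'c set"
  VHom :: "'c \<Rightarrow> 'c \<Rightarrow> 'o"
  VIde :: "'c \<Rightarrow> 'm"
  VCmp :: "'c \<Rightarrow> 'c \<Rightarrow> 'c \<Rightarrow> 'm"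

record ('c, 'd, 'm) vfun =
  FObj :: "'c \<Rightarrow> 'd"
  FHom :: "'c \<Rightarrow> 'c \<Rightarrow> 'm"

context monoidal_data
begin

definition vcategory :: "('c, 'o, 'm) vcat \<Rightarrow> bool" where
  "vcategory C \<longleftrightarrow>
     (\<forall>a\<in>VObj C. \<forall>b\<in>VObj C. VHom C a b \<in> Obj V) \<and>
     (\<forall>a\<in>VObj C. VIde C a \<in> hom \<one> (VHom C a a)) \<and>
     (\<forall>a\<in>VObj C. \<forall>b\<in>VObj C. \<forall>c\<in>VObj C.
        VCmp C a b c \<in> hom (VHom C a b \<otimes> VHom C b c) (VHom C a c)) \<and>
     (\<forall>a\<in>VObj C. \<forall>b\<in>VObj C. \<forall>c\<in>VObj C. \<forall>d\<in>VObj C.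
        (VCmp C a b c \<odot> ide (VHom C c d)) \<cdot> VCmp C a c d
        = asc (VHom C a b) (VHom C b c) (VHom C c d)
            \<cdot> (ide (VHom C a b) \<odot> VCmp C b c d) \<cdot> VCmp C a b d) \<and>
     (\<forall>a\<in>VObj C. \<forall>b\<in>VObj C.
        (VIde C a \<odot> ide (VHom C a b)) \<cdot> VCmp C a a b = lun (VHom C a b) \<and>
        (ide (VHom C a b) \<odot> VIde C b) \<cdot> VCmp C a b b = run (VHom C a b))"

definition vfunctor ::
  "('c, 'o, 'm) vcat \<Rightarrow> ('d, 'o, 'm) vcat \<Rightarrow> ('c, 'd, 'm) vfun \<Rightarrow> bool" where
  "vfunctor C D F \<longleftrightarrow>
     vcategory C \<and> vcategory D \<and>
     (\<forall>a\<in>VObj C. FObj F a \<in> VObj D) \<and>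
     (\<forall>a\<in>VObj C. \<forall>b\<in>VObj C.
        FHom F a b \<in> hom (VHom C a b) (VHom D (FObj F a) (FObj F b))) \<and>
     (\<forall>a\<in>VObj C. VIde C a \<cdot> FHom F a a = VIde D (FObj F a)) \<and>
     (\<forall>a\<in>VObj C. \<forall>b\<in>VObj C. \<forall>c\<in>VObj C.
        VCmp C a b c \<cdot> FHom F a c
        = (FHom F a b \<odot> FHom F b c) \<cdot> VCmp D (FObj F a) (FObj F b) (FObj F c))"

definition vfun_id :: "('c, 'o, 'm) vcat \<Rightarrow> ('c, 'c, 'm) vfun" where
  "vfun_id C = \<lparr> FObj = (\<lambda>a. a), FHom = (\<lambda>a b. ide (VHom C a b)) \<rparr>"

definition vfun_cmp :: "('c, 'd, 'm) vfun \<Rightarrow> ('d, 'e, 'm) vfun \<Rightarrow> ('c, 'e, 'm) vfun" where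
  "vfun_cmp F G = \<lparr> FObj = (\<lambda>a. FObj G (FObj F a)),
                    FHom = (\<lambda>a b. FHom F a b \<cdot> FHom G (FObj F a) (FObj F b)) \<rparr>"

text \<open>Hom sets, composition and isomorphisms of the underlying ordinary category of \<open>C\<close>.\<close>

definition uhom :: "('c, 'o, 'm) vcat \<Rightarrow> 'c \<Rightarrow> 'c \<Rightarrow> 'm set" where
  "uhom C a b = hom \<one> (VHom C a b)"

definition ucmp :: "('c, 'o, 'm) vcat \<Rightarrow> 'c \<Rightarrow> 'c \<Rightarrow> 'c \<Rightarrow> 'm \<Rightarrow> 'm \<Rightarrow> 'm" where
  "ucmp C a b c f g = inv (lun \<one>) \<cdot> (f \<odot> g) \<cdot> VCmp C a b c"

definition uiso :: "('c, 'o, 'm) vcat \<Rightarrow> 'c \<Rightarrow> 'c \<Rightarrow> 'm set" where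
  "uiso C a b = {f \<in> uhom C a b. \<exists>g \<in> uhom C b a.
     ucmp C a b a f g = VIde C a \<and> ucmp C b a b g f = VIde C b}"

definition vnat_iso ::
  "('c, 'o, 'm) vcat \<Rightarrow> ('d, 'o, 'm) vcat \<Rightarrow> ('c, 'd, 'm) vfun \<Rightarrow> ('c, 'd, 'm) vfun
    \<Rightarrow> ('c \<Rightarrow> 'm) \<Rightarrow> bool" where
  "vnat_iso C D F G \<theta> \<longleftrightarrow>
     vfunctor C D F \<and> vfunctor C D G \<and>
     (\<forall>a\<in>VObj C. \<theta> a \<in> uiso D (FObj F a) (FObj G a)) \<and>
     (\<forall>a\<in>VObj C. \<forall>b\<in>VObj C.
        inv (lun (VHom C a b)) \<cdot> (\<theta> a \<odot> FHom G a b) \<cdot> VCmp D (FObj F a) (FObj G a) (FObj G b)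
        = inv (run (VHom C a b)) \<cdot> (FHom F a b \<odot> \<theta> b) \<cdot> VCmp D (FObj F a) (FObj F b) (FObj G b))"

definition vequivalent :: "('c, 'o, 'm) vcat \<Rightarrow> ('d, 'o, 'm) vcat \<Rightarrow> bool" where
  "vequivalent C D \<longleftrightarrow>
     (\<exists>F G \<theta> \<psi>. vfunctor C D F \<and> vfunctor D C G \<and>
        vnat_iso C C (vfun_cmp F G) (vfun_id C) \<theta> \<and>
        vnat_iso D D (vfun_cmp G F) (vfun_id D) \<psi>)"

text \<open>\<open>L : C \<rightarrow> D\<close> is left adjoint to \<open>R : D \<rightarrow> C\<close> via isomorphisms
  \<open>\<phi> a d : D(L a \<rightarrow> d) \<rightarrow> C(a \<rightarrow> R d)\<close>. The last two clauses are enriched naturality of \<open>\<phi>\<close>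
  in \<open>a\<close> and in \<open>d\<close>, written in a form that makes sense without a braiding on \<open>V\<close>.\<close>

definition vadjunction ::
  "('c, 'o, 'm) vcat \<Rightarrow> ('d, 'o, 'm) vcat \<Rightarrow> ('c, 'd, 'm) vfun \<Rightarrow> ('d, 'c, 'm) vfun
    \<Rightarrow> ('c \<Rightarrow> 'd \<Rightarrow> 'm) \<Rightarrow> bool" where
  "vadjunction C D L R \<phi> \<longleftrightarrow>
     vfunctor C D L \<and> vfunctor D C R \<and>
     (\<forall>a\<in>VObj C. \<forall>d\<in>VObj D. \<phi> a d \<in> iso (VHom D (FObj L a) d) (VHom C a (FObj R d))) \<and>
     (\<forall>a\<in>VObj C. \<forall>b\<in>VObj C. \<forall>d\<in>VObj D.
        (FHom L a b \<odot> ide (VHom D (FObj L b) d)) \<cdot> VCmp D (FObj L a) (FObj L b) d \<cdot> \<phi> a d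
        = (ide (VHom C a b) \<odot> \<phi> b d) \<cdot> VCmp C a b (FObj R d)) \<and>
     (\<forall>a\<in>VObj C. \<forall>d\<in>VObj D. \<forall>e\<in>VObj D.
        VCmp D (FObj L a) d e \<cdot> \<phi> a e
        = (\<phi> a d \<odot> FHom R d e) \<cdot> VCmp C a (FObj R d) (FObj R e))"

end


section \<open>Self-enrichment and tensored categories\<close>

text \<open>\<open>LTens T a\<close> is the left adjoint \<open>v \<mapsto> a \<lhd> v\<close>, and
  \<open>TIso T a v b : C(a \<lhd> v \<rightarrow> b) \<rightarrow> [v \<rightarrow> C(a \<rightarrow> b)]\<close> is the adjunction isomorphism.\<close>

record ('c, 'o, 'm) tensoring =
  LTens :: "'c \<Rightarrow> ('o, 'c, 'm) vfun"
  TIso :: "'c \<Rightarrow> 'o \<Rightarrow> 'c \<Rightarrow> 'm"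

context rigid_data
begin

abbreviation dual :: "'o \<Rightarrow> 'o" where "dual \<equiv> Dual V"
abbreviation ev :: "'o \<Rightarrow> 'm" where "ev \<equiv> Ev V"
abbreviation coev :: "'o \<Rightarrow> 'm" where "coev \<equiv> Coev V"

definition ihom :: "'o \<Rightarrow> 'o \<Rightarrow> 'o" where
  "ihom u v = dual u \<otimes> v"

text \<open>The mate \<open>w \<rightarrow> [u \<rightarrow> v]\<close> of \<open>f : u w \<rightarrow> v\<close>, and the mate \<open>u [u \<rightarrow> v] \<rightarrow> v\<close> of the identity.
  The mate of \<open>g : w \<rightarrow> [u \<rightarrow> v]\<close> in the other direction is \<open>(ide u \<odot> g) \<cdot> eps u v\<close>.\<close>

definition mate :: "'o \<Rightarrow> 'o \<Rightarrow> 'm \<Rightarrow> 'm" where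
  "mate u w f = inv (lun w) \<cdot> (coev u \<odot> ide w) \<cdot> asc (dual u) u w \<cdot> (ide (dual u) \<odot> f)"

definition eps :: "'o \<Rightarrow> 'o \<Rightarrow> 'm" where
  "eps u v = inv (asc u (dual u) v) \<cdot> (ev u \<odot> ide v) \<cdot> lun v"

definition self_enriched :: "('o, 'o, 'm) vcat" where
  "self_enriched = \<lparr>
     VObj = Obj V,
     VHom = ihom,
     VIde = (\<lambda>u. mate u \<one> (run u)),
     VCmp = (\<lambda>u v w. mate u (ihom u v \<otimes> ihom v w)
        (inv (asc u (ihom u v) (ihom v w)) \<cdot> (eps u v \<odot> ide (ihom v w)) \<cdot> eps v w)) \<rparr>"

definition representable :: "('c, 'o, 'm) vcat \<Rightarrow> 'c \<Rightarrow> ('c, 'o, 'm) vfun" where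
  "representable C a = \<lparr>
     FObj = (\<lambda>b. VHom C a b),
     FHom = (\<lambda>b c. mate (VHom C a b) (VHom C b c) (VCmp C a b c)) \<rparr>"

definition tensored :: "('c, 'o, 'm) vcat \<Rightarrow> ('c, 'o, 'm) tensoring \<Rightarrow> bool" where
  "tensored C T \<longleftrightarrow>
     vcategory C \<and>
     (\<forall>a\<in>VObj C. vadjunction self_enriched C (LTens T a) (representable C a) (TIso T a))"

abbreviation tens :: "('c, 'o, 'm) tensoring \<Rightarrow> 'c \<Rightarrow> 'o \<Rightarrow> 'c" where
  "tens T a v \<equiv> FObj (LTens T a) v"

text \<open>The bijection \<open>hom \<one> (C(a \<lhd> v \<rightarrow> b)) \<cong> hom v (C(a \<rightarrow> b))\<close> induced by a tensoring, in both
  directions.\<close>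

definition tens_unmate ::
  "('c, 'o, 'm) vcat \<Rightarrow> ('c, 'o, 'm) tensoring \<Rightarrow> 'c \<Rightarrow> 'o \<Rightarrow> 'c \<Rightarrow> 'm \<Rightarrow> 'm" where
  "tens_unmate C T a v b g = inv (run v) \<cdot> (ide v \<odot> (g \<cdot> TIso T a v b)) \<cdot> eps v (VHom C a b)"

definition tens_mate ::
  "('c, 'o, 'm) tensoring \<Rightarrow> 'c \<Rightarrow> 'o \<Rightarrow> 'c \<Rightarrow> 'm \<Rightarrow> 'm" where
  "tens_mate T a v b f = mate v \<one> (run v \<cdot> f) \<cdot> inv (TIso T a v b)"

definition tens_unit ::
  "('c, 'o, 'm) vcat \<Rightarrow> ('c, 'o, 'm) tensoring \<Rightarrow> 'c \<Rightarrow> 'o \<Rightarrow> 'm" where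
  "tens_unit C T a v = tens_unmate C T a v (tens T a v) (VIde C (tens T a v))"

text \<open>\<open>tens_comparison C T S F c v\<close> is the canonical \<open>\<mu> : F c \<lhd> v \<rightarrow> F (c \<lhd> v)\<close>, where \<open>T\<close> and \<open>S\<close>
  are the tensorings of the source \<open>C\<close> and of the target of \<open>F\<close>.\<close>

definition tens_comparison ::
  "('c, 'o, 'm) vcat \<Rightarrow> ('c, 'o, 'm) tensoring \<Rightarrow> ('d, 'o, 'm) tensoring
    \<Rightarrow> ('c, 'd, 'm) vfun \<Rightarrow> 'c \<Rightarrow> 'o \<Rightarrow> 'm" where
  "tens_comparison C T S F c v =
     tens_mate S (FObj F c) v (FObj F (tens T c v)) (tens_unit C T c v \<cdot> FHom F c (tens T c v))"

definition tensored_vfunctor ::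
  "('c, 'o, 'm) vcat \<Rightarrow> ('c, 'o, 'm) tensoring \<Rightarrow> ('d, 'o, 'm) vcat \<Rightarrow> ('d, 'o, 'm) tensoring
    \<Rightarrow> ('c, 'd, 'm) vfun \<Rightarrow> bool" where
  "tensored_vfunctor C T D S F \<longleftrightarrow>
     tensored C T \<and> tensored D S \<and> vfunctor C D F \<and>
     (\<forall>c\<in>VObj C. \<forall>v\<in>Obj V.
        tens_comparison C T S F c v \<in> uiso D (tens S (FObj F c) v) (FObj F (tens T c v)))"


section \<open>The completion\<close>

text \<open>The pair \<open>(a, u)\<close> stands for the formal tensor of \<open>a\<close> by \<open>u\<close>.\<close>

definition completion :: "('c, 'o, 'm) vcat \<Rightarrow> ('c \<times> 'o, 'o, 'm) vcat" where
  "completion C = \<lparr>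
     VObj = VObj C \<times> Obj V,
     VHom = (\<lambda>(a, u) (b, v). ihom u (VHom C a b \<otimes> v)),
     VIde = (\<lambda>(a, u). mate u \<one> (run u \<cdot> inv (lun u) \<cdot> (VIde C a \<odot> ide u))),
     VCmp = (\<lambda>(a, u) (b, v) (c, w).
       let X = ihom u (VHom C a b \<otimes> v); Y = ihom v (VHom C b c \<otimes> w) in
       mate u (X \<otimes> Y)
        (inv (asc u X Y)
         \<cdot> (eps u (VHom C a b \<otimes> v) \<odot> ide Y)
         \<cdot> asc (VHom C a b) v Y
         \<cdot> (ide (VHom C a b) \<odot> eps v (VHom C b c \<otimes> w))
         \<cdot> inv (asc (VHom C a b) (VHom C b c) w)
         \<cdot> (VCmp C a b c \<odot> ide w))) \<rparr>"

text \<open>The tensoring of the completion, with object part \<open>(a, u) \<lhd> v = (a, u \<otimes> v)\<close>. The action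
  of \<open>v \<mapsto> (a, u \<otimes> v)\<close> is the mate of
  \<open>(u v) [v \<rightarrow> w] \<rightarrow> u w \<rightarrow> C(a \<rightarrow> a) (u w)\<close>, and the adjunction isomorphism is the currying
  isomorphism \<open>[u v \<rightarrow> x] \<rightarrow> [v \<rightarrow> [u \<rightarrow> x]]\<close> with \<open>x = C(a \<rightarrow> b) w\<close>.\<close>

definition completion_tensoring ::
  "('c, 'o, 'm) vcat \<Rightarrow> ('c \<times> 'o, 'o, 'm) tensoring" where
  "completion_tensoring C = \<lparr>
     LTens = (\<lambda>(a, u). \<lparr>
       FObj = (\<lambda>v. (a, u \<otimes> v)),
       FHom = (\<lambda>v w. mate (u \<otimes> v) (ihom v w)
         (asc u v (ihom v w) \<cdot> (ide u \<odot> eps v w)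
          \<cdot> inv (lun (u \<otimes> w)) \<cdot> (VIde C a \<odot> ide (u \<otimes> w)))) \<rparr>),
     TIso = (\<lambda>(a, u) v (b, w).
       let x = VHom C a b \<otimes> w in
       mate v (ihom (u \<otimes> v) x)
        (mate u (v \<otimes> ihom (u \<otimes> v) x) (inv (asc u v (ihom (u \<otimes> v) x)) \<cdot> eps (u \<otimes> v) x))) \<rparr>"

definition completion_embedding :: "('c, 'o, 'm) vcat \<Rightarrow> ('c, 'c \<times> 'o, 'm) vfun" where
  "completion_embedding C = \<lparr>
     FObj = (\<lambda>a. (a, \<one>)),
     FHom = (\<lambda>a b. mate \<one> (VHom C a b) (lun (VHom C a b) \<cdot> inv (run (VHom C a b)))) \<rparr>"

end

end

(* Coherence is avoided by a Cayley-style strictification: an arrow f : a -> b of V is replaced by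
   the family f z : a z -> b z, where z ranges over words of objects. Whiskering on the right is
   reindexing, so that the axioms of V-categories, V-functors and adjunctions become equations in a
   strict calculus; the members at the empty word determine the arrows.

   A hom object of the completion classifies cells u p -> C(a -> b) v z, with universal cell E. All
   structure of the completion is determined by composition with E, and the embedding is fully
   faithful since C(a -> b) 1 = C(a -> b).

   Let eta : v -> C(c -> c <| v) be the unit of a tensor. The isomorphism
   C(c <| v -> c) = [v -> C(c -> c)], which by rigidity remains universal after tensoring with v on
   the right, yields t : 1 -> C(c <| v -> c) v from j_c. It is inverse to eta, so that (c, v) and
   (c <| v, 1) are isomorphic in the completion. Hence the embedding is essentially surjective, and
   its comparison morphism, the isomorphism above precomposed with 1 v = v, is invertible. *)

theory Submission
  imports Defs
begin

section \<open>Categories\<close>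

text \<open>Two asymmetries shape the calculus. Without a braiding there are no opposite or product
  V-categories, so naturality is always an equation between two explicit composites, and the order
  of the letters in a word has to be respected throughout. And right whiskering is reindexing only
  for families that come from arrows of V; a constructed cell has one fixed tail. Hence the laws
  that feed a calculation are recorded for every tail \<open>z\<close>, while the laws that
  establish a structure are only demanded at the empty word. The tail is also where rigidity pays.
  Since [u -> x] is u* x, evaluation has a unique lifting property for cells u p -> x z with any z,
  whereas in a closed category [u -> x] z and [u -> x z] differ in general. So an equation between
  cells ending in an internal hom is proved by evaluating both sides, and inverses landing in one
  are produced as lifts. The last part is independent of the completion: it turns a fully faithful
  and essentially surjective V-functor into an equivalence by conjugating hom objects with chosen
  isomorphisms.\<close>

context category
begin

lemma hom_Obj: "f \<in> hom a b \<Longrightarrow> a \<in> Obj V \<and> b \<in> Obj V"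
  using Dom_Obj Cod_Obj by (auto simp: hom_def)

lemma inverses_unique:
  assumes "inverses a b f g" "inverses a b f h"
  shows "g = h"
  using cmp_assoc[of h b a f b g a] cmp_ide[of h b a] ide_cmp[of g b a] assms
  by (simp add: inverses_def)

lemma inverses_inv:
  assumes "f \<in> iso a b"
  shows "inverses a b f (inv f)"
proof -
  obtain g where g: "inverses a b f g" using assms by (auto simp: iso_def)
  then have "Dom V f = a" "Cod V f = b" by (auto simp: inverses_def hom_def)
  then have "inv f = g" unfolding inv_def using g inverses_unique by (auto intro!: the_equality)
  then show ?thesis using g by simp
qed

lemma iso_hom: "f \<in> iso a b \<Longrightarrow> f \<in> hom a b"
  by (auto simp: iso_def inverses_def)

lemma inv_hom: "f \<in> iso a b \<Longrightarrow> inv f \<in> hom b a"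
  using inverses_inv by (auto simp: inverses_def)

lemma cmp_inv: "f \<in> iso a b \<Longrightarrow> f \<cdot> inv f = ide a"
  using inverses_inv by (auto simp: inverses_def)

lemma inv_cmp: "f \<in> iso a b \<Longrightarrow> inv f \<cdot> f = ide b"
  using inverses_inv by (auto simp: inverses_def)

lemma ide_iso: "a \<in> Obj V \<Longrightarrow> ide a \<in> iso a a"
  using ide_hom[of a] ide_cmp[of "ide a" a a] unfolding inverses_def iso_def by blast

lemma iso_cancel_right:
  assumes h: "h \<in> iso b c" and f: "f \<in> hom a b" and g: "g \<in> hom a b" and eq: "f \<cdot> h = g \<cdot> h"
  shows "f = g"
proof -
  have "f = f \<cdot> h \<cdot> inv h"
    by (simp only: cmp_assoc[OF f iso_hom[OF h] inv_hom[OF h]] cmp_inv[OF h] cmp_ide[OF f])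
  also have "\<dots> = g"
    by (simp only: eq cmp_assoc[OF g iso_hom[OF h] inv_hom[OF h]] cmp_inv[OF h] cmp_ide[OF g])
  finally show ?thesis .
qed

lemma iso_cancel_left:
  assumes h: "h \<in> iso a b" and f: "f \<in> hom b c" and g: "g \<in> hom b c" and eq: "h \<cdot> f = h \<cdot> g"
  shows "f = g"
proof -
  have "f = inv h \<cdot> (h \<cdot> f)"
    by (simp only: cmp_assoc[OF inv_hom[OF h] iso_hom[OF h] f, symmetric] inv_cmp[OF h] ide_cmp[OF f])
  also have "\<dots> = g"
    by (simp only: eq cmp_assoc[OF inv_hom[OF h] iso_hom[OF h] g, symmetric] inv_cmp[OF h] ide_cmp[OF g])
  finally show ?thesis .
qed

end

section \<open>Cells between words\<close>

text \<open>A word of objects denotes its right-nested tensor product, closed off by the unit. A cell is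
  an arrow together with words for its source and target, or \<open>None\<close> for an ill-typed composite.
  Since words are free, composition is associative and left whiskering is functorial without any
  typing side conditions; right whiskering is a change of the tail of the words.\<close>

type_synonym ('o, 'm) cell = "('o list \<times> 'm \<times> 'o list) option"

context monoidal_category
begin

definition ob :: "'o list \<Rightarrow> 'o" where
  "ob w = foldr (TObj V) w \<one>"

lemma ob_simps: "ob [] = \<one>" "ob (a # w) = a \<otimes> ob w"
  by (simp_all add: ob_def)

definition word :: "'o list \<Rightarrow> bool" where
  "word w \<longleftrightarrow> set w \<subseteq> Obj V"

lemma word_simps [simp]: "word []" "word (a # w) \<longleftrightarrow> a \<in> Obj V \<and> word w"
  by (auto simp: word_def)

lemma ob_Obj: "word w \<Longrightarrow> ob w \<in> Obj V"
  by (induction w) (auto simp: ob_simps unt_Obj tobj_Obj)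

definition Hom :: "'o list \<Rightarrow> 'o list \<Rightarrow> ('o, 'm) cell set" where
  "Hom w w' = {Some (w, x, w') |x. word w \<and> word w' \<and> x \<in> hom (ob w) (ob w')}"

text \<open>The test concerns the arrows as well as the words, so a triple whose arrow does not fit
  its words is absorbed into \<open>None\<close> too. This is what lets \<open>pcmp_assoc\<close>
  hold for all cells.\<close>

definition pcmp :: "('o, 'm) cell \<Rightarrow> ('o, 'm) cell \<Rightarrow> ('o, 'm) cell" (infixr "\<bullet>" 55) where
  "f \<bullet> g = (case (f, g) of
     (Some (a, x, b), Some (c, y, d)) \<Rightarrow>
       if f \<in> Hom a b \<and> g \<in> Hom b d \<and> c = b then Some (a, x \<cdot> y, d) else None
   | _ \<Rightarrow> None)"

definition Id :: "'o list \<Rightarrow> ('o, 'm) cell" where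
  "Id w = (if word w then Some (w, ide (ob w), w) else None)"

text \<open>Ill-typed input, or an \<open>a\<close> that is not an object, gives
  \<open>None\<close>, which makes \<open>L_pcmp\<close> unconditional as well.\<close>

definition L :: "'o \<Rightarrow> ('o, 'm) cell \<Rightarrow> ('o, 'm) cell" where
  "L a f = (case f of None \<Rightarrow> None | Some (w, x, w') \<Rightarrow>
     if a \<in> Obj V \<and> f \<in> Hom w w' then Some (a # w, ide a \<odot> x, a # w') else None)"

definition R :: "'m \<Rightarrow> 'o list \<Rightarrow> ('o, 'm) cell" where
  "R f z = (if f \<in> Arr V \<and> word z then Some (Dom V f # z, f \<odot> ide (ob z), Cod V f # z) else None)"

lemma HomE:
  assumes "f \<in> Hom a b"
  obtains x where "f = Some (a, x, b)" "x \<in> hom (ob a) (ob b)" "word a" "word b"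
  using assms by (auto simp: Hom_def)

lemma Hom_Some [simp]: "Some (a, x, b) \<in> Hom c d \<longleftrightarrow> a = c \<and> b = d \<and> word a \<and> word b \<and> x \<in> hom (ob a) (ob b)"
  by (auto simp: Hom_def)

lemma pcmp_Some:
  "x \<in> hom (ob a) (ob b) \<Longrightarrow> y \<in> hom (ob b) (ob c) \<Longrightarrow> word a \<Longrightarrow> word b \<Longrightarrow> word c
    \<Longrightarrow> Some (a, x, b) \<bullet> Some (b, y, c) = Some (a, x \<cdot> y, c)"
  by (simp add: pcmp_def)

lemma pcmp_Hom: "f \<in> Hom a b \<Longrightarrow> g \<in> Hom b c \<Longrightarrow> f \<bullet> g \<in> Hom a c"
  by (elim HomE) (simp add: pcmp_Some cmp_hom)

lemma pcmp_None [simp]: "None \<bullet> f = None" "f \<bullet> None = None"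
  by (auto simp: pcmp_def split: option.splits prod.splits)

lemma pcmp_eq_None: "f \<bullet> g = None \<longleftrightarrow> (\<nexists>a b c. f \<in> Hom a b \<and> g \<in> Hom b c)"
  by (auto simp: pcmp_def split: option.splits prod.splits elim!: HomE)

lemma pcmp_SomeD: "f \<bullet> g = Some k \<Longrightarrow> \<exists>a b c. f \<in> Hom a b \<and> g \<in> Hom b c"
  by (metis pcmp_eq_None option.distinct(1))

lemma Hom_unique: "f \<in> Hom a b \<Longrightarrow> f \<in> Hom c d \<Longrightarrow> a = c \<and> b = d"
  by (auto elim!: HomE)

lemma pcmp_assoc: "(f \<bullet> g) \<bullet> h = f \<bullet> g \<bullet> h"
proof (cases "\<exists>a b c d. f \<in> Hom a b \<and> g \<in> Hom b c \<and> h \<in> Hom c d")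
  case True
  then show ?thesis by (auto elim!: HomE simp: pcmp_Some cmp_hom cmp_assoc)
next
  case False
  have "(f \<bullet> g) \<bullet> h = None"
  proof (rule ccontr)
    assume "(f \<bullet> g) \<bullet> h \<noteq> None"
    then obtain a b c where fg: "f \<bullet> g \<in> Hom a b" "h \<in> Hom b c" by (auto simp: pcmp_eq_None)
    then obtain a' b' c' where "f \<in> Hom a' b'" "g \<in> Hom b' c'" using pcmp_SomeD by (metis HomE)
    with fg False show False using Hom_unique pcmp_Hom by blast
  qed
  moreover have "f \<bullet> g \<bullet> h = None"
  proof (rule ccontr)
    assume "f \<bullet> g \<bullet> h \<noteq> None"
    then obtain a b c where gh: "f \<in> Hom a b" "g \<bullet> h \<in> Hom b c" by (auto simp: pcmp_eq_None)
    then obtain a' b' c' where "g \<in> Hom a' b'" "h \<in> Hom b' c'" using pcmp_SomeD by (metis HomE)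
    with gh False show False using Hom_unique pcmp_Hom by blast
  qed
  ultimately show ?thesis by simp
qed

text \<open>Composites are kept right-nested, where two or three adjacent factors need not form a
  subterm; the remainder \<open>k\<close> makes a law about them applicable in the middle of a
  composite.\<close>

lemma chain: "f \<bullet> g = h \<Longrightarrow> f \<bullet> g \<bullet> k = h \<bullet> k"
  and chain3: "f \<bullet> g \<bullet> g' = h \<Longrightarrow> f \<bullet> g \<bullet> g' \<bullet> k = h \<bullet> k"
  by (metis pcmp_assoc)+

lemma Id_Hom [simp]: "Id w \<in> Hom w w \<longleftrightarrow> word w"
  by (auto simp: Id_def ide_hom ob_Obj) (auto simp: Hom_def)

lemma Id_pcmp: "f \<in> Hom a b \<Longrightarrow> Id a \<bullet> f = f"
  by (auto elim!: HomE simp: Id_def pcmp_Some ide_hom ob_Obj ide_cmp)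

lemma pcmp_Id: "f \<in> Hom a b \<Longrightarrow> f \<bullet> Id b = f"
  by (auto elim!: HomE simp: Id_def pcmp_Some ide_hom ob_Obj cmp_ide)

lemma L_Hom: "f \<in> Hom w w' \<Longrightarrow> a \<in> Obj V \<Longrightarrow> L a f \<in> Hom (a # w) (a # w')"
  by (auto elim!: HomE simp: L_def ob_simps intro!: tarr_hom ide_hom)

lemma L_Id: "a \<in> Obj V \<Longrightarrow> L a (Id w) = Id (a # w)"
  by (auto simp: L_def Id_def ide_hom ob_Obj ob_simps tarr_ide)

lemma L_pcmp: "L a (f \<bullet> g) = L a f \<bullet> L a g"
proof (cases "a \<in> Obj V \<and> (\<exists>p q r. f \<in> Hom p q \<and> g \<in> Hom q r)")
  case True
  then obtain p q r where a: "a \<in> Obj V" and fg: "f \<in> Hom p q" "g \<in> Hom q r" by blast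
  then obtain x y where "f = Some (p, x, q)" "g = Some (q, y, r)"
    and h: "x \<in> hom (ob p) (ob q)" "y \<in> hom (ob q) (ob r)" "word p" "word q" "word r"
    by (meson HomE)
  moreover have "ide a \<odot> (x \<cdot> y) = (ide a \<odot> x) \<cdot> (ide a \<odot> y)"
    using tarr_cmp[OF ide_hom[OF a] ide_hom[OF a] h(1,2)] ide_cmp[OF ide_hom[OF a]] by simp
  ultimately show ?thesis using a
    by (simp add: L_def pcmp_Some cmp_hom ob_simps tarr_hom ide_hom)
next
  case False
  then have "L a (f \<bullet> g) = None"
    by (auto simp: L_def pcmp_eq_None split: option.split dest!: pcmp_SomeD)
  moreover have "L a f \<bullet> L a g = None"
  proof (rule ccontr)
    assume "L a f \<bullet> L a g \<noteq> None"
    then obtain p q r where "L a f \<in> Hom p q" "L a g \<in> Hom q r" by (auto simp: pcmp_eq_None)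
    then show False using False
      by (auto simp: L_def split: option.splits if_splits elim!: HomE)
  qed
  ultimately show ?thesis by simp
qed

lemma R_Hom: "f \<in> hom a b \<Longrightarrow> word z \<Longrightarrow> R f z \<in> Hom (a # z) (b # z)"
  using hom_Obj[of f a b]
  by (auto simp: R_def hom_def[of a b] ob_simps intro!: tarr_hom ide_hom ob_Obj) (auto simp: hom_def)

lemma R_ide: "a \<in> Obj V \<Longrightarrow> word z \<Longrightarrow> R (ide a) z = Id (a # z)"
  using ide_hom[of a] by (auto simp: R_def Id_def hom_def ob_simps tarr_ide ob_Obj)

lemma R_eq: "f \<in> hom a b \<Longrightarrow> word z \<Longrightarrow> R f z = Some (a # z, f \<odot> ide (ob z), b # z)"
  by (auto simp: R_def hom_def)

lemma R_cmp: "f \<in> hom a b \<Longrightarrow> g \<in> hom b c \<Longrightarrow> word z \<Longrightarrow> R (f \<cdot> g) z = R f z \<bullet> R g z"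
  using hom_Obj[of f a b] hom_Obj[of g b c] tarr_cmp[OF _ _ ide_hom ide_hom, of f a b g c "ob z"]
    ide_cmp[OF ide_hom, of "ob z"]
  by (simp add: R_eq[of _ a c] R_eq[of _ a b] R_eq[of _ b c] cmp_hom pcmp_Some ob_simps tarr_hom
      ide_hom ob_Obj)

text \<open>Interchange: \<open>f\<close> acts on the first letter and \<open>g\<close> on the tail,
  so both orders equal the tensor product of the two arrows.\<close>

lemma R_nat:
  assumes "f \<in> hom a b" "g \<in> Hom z w"
  shows "L a g \<bullet> R f w = R f z \<bullet> L b g"
proof -
  obtain y where g: "g = Some (z, y, w)" and y: "y \<in> hom (ob z) (ob w)" and w: "word z" "word w"
    using assms(2) by (elim HomE)
  have ab: "a \<in> Obj V" "b \<in> Obj V" using assms(1) hom_Obj by auto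
  note i = ide_hom[OF ab(1)] ide_hom[OF ab(2)] ide_hom[OF ob_Obj[OF w(1)]] ide_hom[OF ob_Obj[OF w(2)]]
  have "(ide a \<odot> y) \<cdot> (f \<odot> ide (ob w)) = (f \<odot> ide (ob z)) \<cdot> (ide b \<odot> y)"
    using tarr_cmp[OF i(1) assms(1) y i(4)] tarr_cmp[OF assms(1) i(2) i(3) y]
      ide_cmp[OF assms(1)] cmp_ide[OF assms(1)] ide_cmp[OF y] cmp_ide[OF y] by simp
  then show ?thesis using ab y w i assms(1)
    by (simp add: g L_def R_eq pcmp_Some ob_simps tarr_hom)
qed

text \<open>Associator and left unitor as operations on the head of a word: splitting and joining
  letters, and, with \<open>Dl\<close> and \<open>In\<close>, deleting and inserting a unit letter.
  As words are right-nested, these four and their whiskerings express all structural isomorphisms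
  that occur.\<close>

definition Sp :: "'o \<Rightarrow> 'o \<Rightarrow> 'o list \<Rightarrow> ('o, 'm) cell" where
  "Sp a b z = Some ((a \<otimes> b) # z, asc a b (ob z), a # b # z)"

definition Jn :: "'o \<Rightarrow> 'o \<Rightarrow> 'o list \<Rightarrow> ('o, 'm) cell" where
  "Jn a b z = Some (a # b # z, inv (asc a b (ob z)), (a \<otimes> b) # z)"

definition Dl :: "'o list \<Rightarrow> ('o, 'm) cell" where
  "Dl z = Some (\<one> # z, lun (ob z), z)"

definition In :: "'o list \<Rightarrow> ('o, 'm) cell" where
  "In z = Some (z, inv (lun (ob z)), \<one> # z)"

lemma
  assumes "a \<in> Obj V" "b \<in> Obj V" "word z"
  shows Sp_Hom: "Sp a b z \<in> Hom ((a \<otimes> b) # z) (a # b # z)"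
    and Jn_Hom: "Jn a b z \<in> Hom (a # b # z) ((a \<otimes> b) # z)"
    and Sp_Jn: "Sp a b z \<bullet> Jn a b z = Id ((a \<otimes> b) # z)"
    and Jn_Sp: "Jn a b z \<bullet> Sp a b z = Id (a # b # z)"
proof -
  note i = asc_iso[OF assms(1,2) ob_Obj[OF assms(3)]]
  show "Sp a b z \<in> Hom ((a \<otimes> b) # z) (a # b # z)" "Jn a b z \<in> Hom (a # b # z) ((a \<otimes> b) # z)"
    "Sp a b z \<bullet> Jn a b z = Id ((a \<otimes> b) # z)" "Jn a b z \<bullet> Sp a b z = Id (a # b # z)"
    using assms iso_hom[OF i] inv_hom[OF i] cmp_inv[OF i] inv_cmp[OF i]
    by (simp_all add: Sp_def Jn_def Id_def pcmp_Some ob_simps tobj_Obj)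
qed

lemma
  assumes "word z"
  shows Dl_Hom: "Dl z \<in> Hom (\<one> # z) z"
    and In_Hom: "In z \<in> Hom z (\<one> # z)"
    and Dl_In: "Dl z \<bullet> In z = Id (\<one> # z)"
    and In_Dl: "In z \<bullet> Dl z = Id z"
proof -
  note i = lun_iso[OF ob_Obj[OF assms]]
  show "Dl z \<in> Hom (\<one> # z) z" "In z \<in> Hom z (\<one> # z)"
    "Dl z \<bullet> In z = Id (\<one> # z)" "In z \<bullet> Dl z = Id z"
    using assms iso_hom[OF i] inv_hom[OF i] cmp_inv[OF i] inv_cmp[OF i]
    by (simp_all add: Dl_def In_def Id_def pcmp_Some ob_simps unt_Obj)
qed

lemma Sp_nat:
  assumes "a \<in> Obj V" "b \<in> Obj V" "g \<in> Hom z w"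
  shows "L (a \<otimes> b) g \<bullet> Sp a b w = Sp a b z \<bullet> L a (L b g)"
proof -
  obtain y where g: "g = Some (z, y, w)" and y: "y \<in> hom (ob z) (ob w)" and w: "word z" "word w"
    using assms(3) by (elim HomE)
  show ?thesis
    using asc_nat[OF ide_hom[OF assms(1)] ide_hom[OF assms(2)] y] assms(1,2) y w
      Sp_Hom[OF assms(1,2) w(1)] Sp_Hom[OF assms(1,2) w(2)]
    by (simp add: g L_def Sp_def pcmp_Some ob_simps tarr_hom ide_hom tobj_Obj tarr_ide)
qed

lemma Dl_nat:
  assumes "g \<in> Hom z w"
  shows "L \<one> g \<bullet> Dl w = Dl z \<bullet> g"
proof -
  obtain y where g: "g = Some (z, y, w)" and y: "y \<in> hom (ob z) (ob w)" and w: "word z" "word w"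
    using assms by (elim HomE)
  show ?thesis
    using lun_nat[OF y] y w unt_Obj Dl_Hom[OF w(1)] Dl_Hom[OF w(2)]
    by (simp add: g L_def Dl_def pcmp_Some ob_simps tarr_hom ide_hom)
qed

text \<open>Source and target become functions of the cell, so that the simplifier can compute
  whether factors compose; with \<open>Hom a b\<close> alone the middle words would have to be
  guessed.\<close>

definition ok :: "('o, 'm) cell \<Rightarrow> bool" where
  "ok f \<longleftrightarrow> (\<exists>a b. f \<in> Hom a b)"

definition dm :: "('o, 'm) cell \<Rightarrow> 'o list" where
  "dm f = fst (the f)"

definition cd :: "('o, 'm) cell \<Rightarrow> 'o list" where
  "cd f = snd (snd (the f))"

lemma Hom_iff: "f \<in> Hom a b \<longleftrightarrow> ok f \<and> dm f = a \<and> cd f = b"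
  by (auto simp: ok_def dm_def cd_def elim!: HomE)

lemma ok_word [simp]: "ok f \<Longrightarrow> word (dm f)" "ok f \<Longrightarrow> word (cd f)"
  by (auto simp: ok_def dm_def cd_def elim!: HomE)

lemma ok_pcmp [simp]: "ok (f \<bullet> g) \<longleftrightarrow> ok f \<and> ok g \<and> cd f = dm g"
proof
  assume "ok (f \<bullet> g)"
  then show "ok f \<and> ok g \<and> cd f = dm g"
    by (metis Hom_iff HomE ok_def pcmp_SomeD)
next
  assume "ok f \<and> ok g \<and> cd f = dm g"
  then show "ok (f \<bullet> g)"
    by (metis Hom_iff pcmp_Hom)
qed

lemma dm_pcmp [simp]: "ok (f \<bullet> g) \<Longrightarrow> dm (f \<bullet> g) = dm f"
  and cd_pcmp [simp]: "ok (f \<bullet> g) \<Longrightarrow> cd (f \<bullet> g) = cd g"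
  by (metis Hom_iff ok_pcmp pcmp_Hom)+

lemma ok_L [simp]: "ok (L a f) \<longleftrightarrow> a \<in> Obj V \<and> ok f"
  by (auto simp: ok_def L_def split: option.splits elim!: HomE
      intro!: tarr_hom ide_hom simp: ob_simps)

lemma dm_L [simp]: "a \<in> Obj V \<Longrightarrow> ok f \<Longrightarrow> dm (L a f) = a # dm f"
  and cd_L [simp]: "a \<in> Obj V \<Longrightarrow> ok f \<Longrightarrow> cd (L a f) = a # cd f"
  by (metis Hom_iff L_Hom)+

lemma ok_Id [simp]: "ok (Id w) \<longleftrightarrow> word w" "word w \<Longrightarrow> dm (Id w) = w" "word w \<Longrightarrow> cd (Id w) = w"
  using Id_Hom[of w] ok_word by (auto simp: Hom_iff) (auto simp: Id_def ok_def elim: HomE)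

lemma ok_R [simp]:
  assumes "f \<in> hom a b" "word z"
  shows "ok (R f z)" "dm (R f z) = a # z" "cd (R f z) = b # z"
  using R_Hom[OF assms] by (auto simp: Hom_iff)

lemma ok_Sp [simp]:
  assumes "a \<in> Obj V" "b \<in> Obj V" "word z"
  shows "ok (Sp a b z)" "dm (Sp a b z) = (a \<otimes> b) # z" "cd (Sp a b z) = a # b # z"
    "ok (Jn a b z)" "cd (Jn a b z) = (a \<otimes> b) # z" "dm (Jn a b z) = a # b # z"
  using Sp_Hom[OF assms] Jn_Hom[OF assms] by (auto simp: Hom_iff)

lemma ok_Dl [simp]:
  assumes "word z"
  shows "ok (Dl z)" "dm (Dl z) = \<one> # z" "cd (Dl z) = z"
    "ok (In z)" "cd (In z) = \<one> # z" "dm (In z) = z"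
  using Dl_Hom[OF assms] In_Hom[OF assms] by (auto simp: Hom_iff)

lemmas [simp] = unt_Obj tobj_Obj

lemma Id_L [simp]:
  "ok f \<Longrightarrow> dm f = w \<Longrightarrow> Id w \<bullet> f = f" "ok f \<Longrightarrow> cd f = w \<Longrightarrow> f \<bullet> Id w = f"
  by (metis Hom_iff Id_pcmp pcmp_Id)+

lemma Id_chain [simp]:
  "ok f \<Longrightarrow> dm f = w \<Longrightarrow> Id w \<bullet> f \<bullet> k = f \<bullet> k" "ok f \<Longrightarrow> cd f = w \<Longrightarrow> f \<bullet> Id w \<bullet> k = f \<bullet> k"
  by (metis Id_L pcmp_assoc)+

lemma Jn_nat:
  assumes "a \<in> Obj V" "b \<in> Obj V" "g \<in> Hom z w"
  shows "L a (L b g) \<bullet> Jn a b w = Jn a b z \<bullet> L (a \<otimes> b) g"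
proof -
  have g: "ok g" "dm g = z" "cd g = w" "word z" "word w" using assms(3) by (auto simp: Hom_iff)
  have "L a (L b g) \<bullet> Jn a b w = Jn a b z \<bullet> (Sp a b z \<bullet> L a (L b g)) \<bullet> Jn a b w"
    using assms(1,2) g by (simp add: chain[OF Jn_Sp] pcmp_assoc)
  also have "\<dots> = Jn a b z \<bullet> L (a \<otimes> b) g"
    using assms(1,2) g by (simp add: Sp_nat[OF assms, symmetric] pcmp_assoc Sp_Jn)
  finally show ?thesis .
qed

lemma In_nat:
  assumes "g \<in> Hom z w"
  shows "g \<bullet> In w = In z \<bullet> L \<one> g"
proof -
  have g: "ok g" "dm g = z" "cd g = w" "word z" "word w" using assms by (auto simp: Hom_iff)
  have "g \<bullet> In w = In z \<bullet> (Dl z \<bullet> g) \<bullet> In w"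
    using g by (simp add: chain[OF In_Dl] pcmp_assoc)
  also have "\<dots> = In z \<bullet> L \<one> g"
    using g by (simp add: Dl_nat[OF assms, symmetric] pcmp_assoc Dl_In)
  finally show ?thesis .
qed

lemmas Sp_Jn_chain = chain[OF Sp_Jn] and Jn_Sp_chain = chain[OF Jn_Sp]
  and Dl_In_chain = chain[OF Dl_In] and In_Dl_chain = chain[OF In_Dl]

lemmas cancel [simp] = Sp_Jn Jn_Sp Dl_In In_Dl Sp_Jn_chain Jn_Sp_chain Dl_In_chain In_Dl_chain

lemma L_cancel [simp]:
  assumes "f \<bullet> g = Id w" "a \<in> Obj V"
  shows "L a f \<bullet> L a g = Id (a # w)" "L a f \<bullet> L a g \<bullet> k = Id (a # w) \<bullet> k"
proof -
  have "ok (f \<bullet> g) \<or> \<not> word w" using assms(1) ok_Id(1)[of w] by metis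
  moreover have "\<not> word w \<Longrightarrow> Id w = None" by (simp add: Id_def)
  moreover have "\<not> word w \<Longrightarrow> Id (a # w) = None" by (simp add: Id_def)
  moreover have "L a None = None" by (simp add: L_def)
  ultimately show *: "L a f \<bullet> L a g = Id (a # w)" using assms by (metis L_Id L_pcmp ok_Id(1))
  then show "L a f \<bullet> L a g \<bullet> k = Id (a # w) \<bullet> k" by (rule chain)
qed

lemma left_cancel:
  assumes "g \<bullet> f = Id w" "f \<bullet> x = f \<bullet> y" "ok x" "ok y" "dm x = w" "dm y = w"
  shows "x = y"
  using assms by (metis Id_L(1) pcmp_assoc)

lemma right_cancel:
  assumes "f \<bullet> g = Id w" "x \<bullet> f = y \<bullet> f" "ok x" "ok y" "cd x = w" "cd y = w"
  shows "x = y"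
  using assms by (metis Id_L(2) pcmp_assoc)

section \<open>Arrows of V as cells: tensor products, associators and unitors\<close>

lemma R_tarr:
  assumes f: "f \<in> hom a b" and g: "g \<in> hom c d" and z: "word z"
  shows "R (f \<odot> g) z = Sp a c z \<bullet> L a (R g z) \<bullet> R f (d # z) \<bullet> Jn b d z"
proof -
  have ob: "a \<in> Obj V" "b \<in> Obj V" "c \<in> Obj V" "d \<in> Obj V" using f g hom_Obj by auto
  note i = ide_hom[OF ob_Obj[OF z]]
  have gz: "g \<odot> ide (ob z) \<in> hom (c \<otimes> ob z) (d \<otimes> ob z)" using tarr_hom[OF g i] .
  \<comment> \<open>\<open>g\<close> acts first, beneath the letter \<open>a\<close>, so that
    \<open>f\<close> then meets the tail \<open>d # z\<close>. By interchange this order computes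
    the tensor product, and \<open>asc_nat\<close> supplies the splitting.\<close>
  have "f \<odot> (g \<odot> ide (ob z)) = (ide a \<odot> (g \<odot> ide (ob z))) \<cdot> (f \<odot> ide (d \<otimes> ob z))"
    using tarr_cmp[OF ide_hom[OF ob(1)] f gz ide_hom] ide_cmp[OF f] cmp_ide[OF gz]
      tobj_Obj[OF ob(4) ob_Obj[OF z]] by simp
  then have "((f \<odot> g) \<odot> ide (ob z)) \<cdot> asc b d (ob z)
      = asc a c (ob z) \<cdot> ((ide a \<odot> (g \<odot> ide (ob z))) \<cdot> (f \<odot> ide (d \<otimes> ob z)))"
    using asc_nat[OF f g i] by simp
  moreover have "Sp b d z \<in> Hom ((b \<otimes> d) # z) (b # d # z)" "Sp a c z \<in> Hom ((a \<otimes> c) # z) (a # c # z)"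
    using ob z by (auto intro: Sp_Hom)
  moreover have "(ide a \<odot> (g \<odot> ide (ob z))) \<cdot> (f \<odot> ide (d \<otimes> ob z)) \<in> hom (a \<otimes> c \<otimes> ob z) (b \<otimes> d \<otimes> ob z)"
    using ob z by (intro cmp_hom[OF tarr_hom[OF ide_hom gz] tarr_hom[OF f ide_hom]]) (auto intro: tobj_Obj ob_Obj)
  ultimately have "R (f \<odot> g) z \<bullet> Sp b d z = Sp a c z \<bullet> L a (R g z) \<bullet> R f (d # z)"
    using ob z gz tarr_hom[OF f g] f g
    by (simp add: R_eq[OF tarr_hom[OF f g]] R_eq[OF f] R_eq[OF g] Sp_def L_def pcmp_Some cmp_hom
        tarr_hom ide_hom ob_simps ob_Obj)
  then have "(R (f \<odot> g) z \<bullet> Sp b d z) \<bullet> Jn b d z = Sp a c z \<bullet> L a (R g z) \<bullet> R f (d # z) \<bullet> Jn b d z"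
    by (simp add: pcmp_assoc)
  then show ?thesis using ob z tarr_hom[OF f g] by (simp add: pcmp_assoc)
qed

lemma R_tarr_ide_left:
  "f \<in> hom b c \<Longrightarrow> a \<in> Obj V \<Longrightarrow> word z \<Longrightarrow> R (ide a \<odot> f) z = Sp a b z \<bullet> L a (R f z) \<bullet> Jn a c z"
  using hom_Obj[of f b c] by (simp add: R_tarr[OF ide_hom] R_ide)

lemma R_tarr_ide_right:
  "f \<in> hom b c \<Longrightarrow> a \<in> Obj V \<Longrightarrow> word z \<Longrightarrow> R (f \<odot> ide a) z = Sp b a z \<bullet> R f (a # z) \<bullet> Jn c a z"
  using hom_Obj[of f b c] by (simp add: R_tarr[OF _ ide_hom] R_ide L_Id)

text \<open>This is the pentagon with \<open>ob z\<close> as its fourth object: a change of brackets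
  in the head letter is a change in how it is split and joined.\<close>

lemma R_asc:
  assumes "a \<in> Obj V" "b \<in> Obj V" "c \<in> Obj V" "word z"
  shows "R (asc a b c) z = Sp (a \<otimes> b) c z \<bullet> Sp a b (c # z) \<bullet> L a (Jn b c z) \<bullet> Jn a (b \<otimes> c) z"
proof -
  note i = iso_hom[OF asc_iso[OF assms(1-3)]]
  have h: "Sp (a \<otimes> b) c z \<in> Hom (((a \<otimes> b) \<otimes> c) # z) ((a \<otimes> b) # c # z)"
    "Sp a b (c # z) \<in> Hom ((a \<otimes> b) # c # z) (a # b # c # z)"
    "Sp a (b \<otimes> c) z \<in> Hom ((a \<otimes> b \<otimes> c) # z) (a # (b \<otimes> c) # z)"
    "Sp b c z \<in> Hom ((b \<otimes> c) # z) (b # c # z)"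
    using assms by (auto intro: Sp_Hom)
  moreover have "(asc a b c \<odot> ide (ob z)) \<cdot> asc a (b \<otimes> c) (ob z) \<in> hom (((a \<otimes> b) \<otimes> c) \<otimes> ob z) (a \<otimes> (b \<otimes> c) \<otimes> ob z)"
    using assms by (intro cmp_hom[OF tarr_hom[OF i ide_hom] iso_hom[OF asc_iso]]) (auto intro: ob_Obj)
  ultimately have "Sp (a \<otimes> b) c z \<bullet> Sp a b (c # z) = (R (asc a b c) z \<bullet> Sp a (b \<otimes> c) z) \<bullet> L a (Sp b c z)"
    using pentagon[OF assms(1-3) ob_Obj[OF assms(4)]] assms i
    by (simp add: R_eq[OF i] Sp_def L_def pcmp_Some cmp_hom tarr_hom ide_hom ob_simps ob_Obj)
  then have "(Sp (a \<otimes> b) c z \<bullet> Sp a b (c # z)) \<bullet> L a (Jn b c z) \<bullet> Jn a (b \<otimes> c) z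
    = ((R (asc a b c) z \<bullet> Sp a (b \<otimes> c) z) \<bullet> L a (Sp b c z)) \<bullet> L a (Jn b c z) \<bullet> Jn a (b \<otimes> c) z"
    by simp
  then show ?thesis using assms i by (simp add: pcmp_assoc)
qed

text \<open>This is the triangle with \<open>ob z\<close> as its second object: the unit on the
  right of \<open>a\<close> is the unit on the left of the tail.\<close>

lemma R_run:
  assumes "a \<in> Obj V" "word z"
  shows "R (run a) z = Sp a \<one> z \<bullet> L a (Dl z)"
proof -
  note i = iso_hom[OF run_iso[OF assms(1)]]
  show ?thesis
    using triangle[OF assms(1) ob_Obj[OF assms(2)]] assms i Sp_Hom[of a \<one> z] Dl_Hom[of z]
    by (simp add: R_eq[OF i] Sp_def Dl_def L_def pcmp_Some cmp_hom tarr_hom ide_hom ob_simps ob_Obj)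
qed

text \<open>By naturality of \<open>Dl\<close>, whiskering with the unit is conjugation by
  isomorphisms.\<close>

lemma L_unt_faithful:
  assumes "L \<one> f = L \<one> g" "f \<in> Hom z w" "g \<in> Hom z w"
  shows "f = g"
proof (rule left_cancel)
  show "In z \<bullet> Dl z = Id z" using assms(2) by (auto simp: Hom_iff)
  show "Dl z \<bullet> f = Dl z \<bullet> g" using assms by (simp add: Dl_nat[symmetric])
qed (use assms in \<open>auto simp: Hom_iff\<close>)

text \<open>Kelly's redundancy of the left unit coherence, obtained after tensoring with the unit.\<close>

lemma R_lun:
  assumes a: "a \<in> Obj V" and z: "word z"
  shows "R (lun a) z = Sp \<one> a z \<bullet> Dl (a # z)"
proof -
  note l = iso_hom[OF lun_iso[OF a]] and r = iso_hom[OF run_iso[OF unt_Obj]]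
    and s = iso_hom[OF asc_iso[OF unt_Obj unt_Obj a]]
  \<comment> \<open>In the triangle for the unit and \<open>a\<close>, the left unitor of
    \<open>a\<close> occurs beneath a unit letter, and everything else is already computed:
    \<open>R_asc\<close> from the pentagon, \<open>R_run\<close> from the triangle.\<close>
  have "R (asc \<one> \<one> a \<cdot> (ide \<one> \<odot> lun a)) z = R (run \<one> \<odot> ide a) z"
    by (simp add: triangle a)
  then have "Sp (\<one> \<otimes> \<one>) a z \<bullet> Sp \<one> \<one> (a # z) \<bullet> L \<one> (Jn \<one> a z) \<bullet> L \<one> (R (lun a) z) \<bullet> Jn \<one> a z
    = Sp (\<one> \<otimes> \<one>) a z \<bullet> Sp \<one> \<one> (a # z) \<bullet> L \<one> (Dl (a # z)) \<bullet> Jn \<one> a z"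
    using a z l r s
    by (simp add: R_cmp[OF s tarr_hom[OF ide_hom l]] R_asc R_tarr_ide_left[OF l] R_tarr_ide_right[OF r]
        R_run pcmp_assoc)
  then have "Jn \<one> \<one> (a # z) \<bullet> (Jn (\<one> \<otimes> \<one>) a z \<bullet> Sp (\<one> \<otimes> \<one>) a z \<bullet> Sp \<one> \<one> (a # z) \<bullet> L \<one> (Jn \<one> a z) \<bullet> L \<one> (R (lun a) z) \<bullet> Jn \<one> a z) \<bullet> Sp \<one> a z
    = Jn \<one> \<one> (a # z) \<bullet> (Jn (\<one> \<otimes> \<one>) a z \<bullet> Sp (\<one> \<otimes> \<one>) a z \<bullet> Sp \<one> \<one> (a # z) \<bullet> L \<one> (Dl (a # z)) \<bullet> Jn \<one> a z) \<bullet> Sp \<one> a z"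
    by simp
  then have "L \<one> (Jn \<one> a z \<bullet> R (lun a) z) = L \<one> (Dl (a # z))"
    using a z l by (simp add: pcmp_assoc L_pcmp)
  then have "Jn \<one> a z \<bullet> R (lun a) z = Dl (a # z)"
    by (rule L_unt_faithful) (use a z l in \<open>auto simp: Hom_iff\<close>)
  then have "Sp \<one> a z \<bullet> Jn \<one> a z \<bullet> R (lun a) z = Sp \<one> a z \<bullet> Dl (a # z)" by simp
  then show ?thesis using a z l by simp
qed

text \<open>At the empty word \<open>R f []\<close> is \<open>f\<close> tensored with the unit, and
  naturality of the right unitor recovers \<open>f\<close>.\<close>

lemma R_faithful:
  assumes f: "f \<in> hom a b" and g: "g \<in> hom a b" and eq: "R f [] = R g []"
  shows "f = g"
proof -
  have "a \<in> Obj V" using f hom_Obj by auto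
  moreover have "run a \<cdot> f = run a \<cdot> g"
    using run_nat[OF f] run_nat[OF g] eq by (simp add: R_eq[OF f] R_eq[OF g] ob_simps)
  ultimately show ?thesis using iso_cancel_left[OF run_iso f g] by simp
qed

text \<open>A one-letter word denotes its letter tensored with the unit, so conjugation by right
  unitors turns the cell into an arrow. This brings inverses and points found in the calculus back
  into V.\<close>

lemma R_full:
  assumes "x \<in> Hom [a] [b]"
  shows "\<exists>f \<in> hom a b. R f [] = x"
proof -
  obtain y where x: "x = Some ([a], y, [b])" and y: "y \<in> hom (a \<otimes> \<one>) (b \<otimes> \<one>)"
    and ab: "a \<in> Obj V" "b \<in> Obj V"
    using assms by (auto elim!: HomE simp: ob_simps)
  note r = run_iso[OF ab(1)] run_iso[OF ab(2)]
  define f where "f = inv (run a) \<cdot> y \<cdot> run b"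
  have f: "f \<in> hom a b" unfolding f_def by (rule cmp_hom[OF cmp_hom[OF inv_hom[OF r(1)] y] iso_hom[OF r(2)]])
  have yr: "y \<cdot> run b \<in> hom (a \<otimes> \<one>) b" by (rule cmp_hom[OF y iso_hom[OF r(2)]])
  have "(f \<odot> ide \<one>) \<cdot> run b = run a \<cdot> f" by (rule run_nat[OF f])
  also have "\<dots> = run a \<cdot> inv (run a) \<cdot> (y \<cdot> run b)"
    unfolding f_def
    using cmp_assoc[OF inv_hom[OF r(1)] y iso_hom[OF r(2)]]
      cmp_assoc[OF iso_hom[OF r(1)] inv_hom[OF r(1)] yr] by simp
  also have "\<dots> = y \<cdot> run b" by (simp only: cmp_inv[OF r(1)] ide_cmp[OF yr])
  finally have "f \<odot> ide \<one> = y"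
    using iso_cancel_right[OF r(2) _ y] tarr_hom[OF f ide_hom[OF unt_Obj]] by simp
  then show ?thesis using f x by (intro bexI[of _ f]) (simp_all add: R_eq[OF f] ob_simps)
qed

lemma R_inv [simp]:
  assumes "f \<in> iso a b" "word z"
  shows "R f z \<bullet> R (inv f) z = Id (a # z)" "R (inv f) z \<bullet> R f z = Id (b # z)"
    "R f z \<bullet> R (inv f) z \<bullet> k = Id (a # z) \<bullet> k" "R (inv f) z \<bullet> R f z \<bullet> k = Id (b # z) \<bullet> k"
proof -
  have "a \<in> Obj V" "b \<in> Obj V" using hom_Obj[OF iso_hom[OF assms(1)]] by auto
  then show "R f z \<bullet> R (inv f) z = Id (a # z)" "R (inv f) z \<bullet> R f z = Id (b # z)"
    using R_cmp[OF iso_hom[OF assms(1)] inv_hom[OF assms(1)] assms(2)]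
      R_cmp[OF inv_hom[OF assms(1)] iso_hom[OF assms(1)] assms(2)] assms
    by (simp_all add: cmp_inv inv_cmp R_ide)
  then show "R f z \<bullet> R (inv f) z \<bullet> k = Id (a # z) \<bullet> k" "R (inv f) z \<bullet> R f z \<bullet> k = Id (b # z) \<bullet> k"
    by (metis pcmp_assoc)+
qed

text \<open>A one-sided inverse suffices because \<open>R f z\<close> is invertible; the cells of
  inverse associators and unitors are read off in this way.\<close>

lemma R_inv_eq:
  assumes "f \<in> iso a b" "word z" "y \<bullet> R f z = Id (b # z)"
  shows "R (inv f) z = y"
proof (rule right_cancel[OF R_inv(1)[OF assms(1,2)]])
  have b: "b \<in> Obj V" using hom_Obj[OF iso_hom[OF assms(1)]] by auto
  show "R (inv f) z \<bullet> R f z = y \<bullet> R f z" using assms by simp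
  have "ok (y \<bullet> R f z)" using assms b by simp
  then show "ok y" "cd y = a # z" using iso_hom[OF assms(1)] assms(2) by auto
  show "ok (R (inv f) z)" "cd (R (inv f) z) = a # z" using inv_hom[OF assms(1)] assms(2) by auto
qed

lemma isoI_R:
  assumes f: "f \<in> hom a b" and y: "y \<in> Hom [b] [a]"
    and eq: "R f [] \<bullet> y = Id [a]" "y \<bullet> R f [] = Id [b]"
  shows "f \<in> iso a b"
proof -
  have ab: "a \<in> Obj V" "b \<in> Obj V" using f hom_Obj by auto
  obtain g where g: "g \<in> hom b a" "R g [] = y" using R_full[OF y] by auto
  have "f \<cdot> g = ide a" "g \<cdot> f = ide b"
    using f g ab eq cmp_hom[OF f g(1)] cmp_hom[OF g(1) f]
      R_faithful[OF cmp_hom[OF f g(1)] ide_hom[OF ab(1)]] R_faithful[OF cmp_hom[OF g(1) f] ide_hom[OF ab(2)]]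
    by (simp_all add: R_cmp[OF f g(1)] R_cmp[OF g(1) f] R_ide)
  then show ?thesis using f g by (auto simp: iso_def inverses_def)
qed

lemma R_inv_asc:
  "a \<in> Obj V \<Longrightarrow> b \<in> Obj V \<Longrightarrow> c \<in> Obj V \<Longrightarrow> word z \<Longrightarrow>
    R (inv (asc a b c)) z = Sp a (b \<otimes> c) z \<bullet> L a (Sp b c z) \<bullet> Jn a b (c # z) \<bullet> Jn (a \<otimes> b) c z"
  by (rule R_inv_eq[OF asc_iso]) (simp_all add: R_asc pcmp_assoc)

lemma R_inv_lun: "a \<in> Obj V \<Longrightarrow> word z \<Longrightarrow> R (inv (lun a)) z = In (a # z) \<bullet> Jn \<one> a z"
  by (rule R_inv_eq[OF lun_iso]) (simp_all add: R_lun pcmp_assoc)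

lemma R_inv_run: "a \<in> Obj V \<Longrightarrow> word z \<Longrightarrow> R (inv (run a)) z = L a (In z) \<bullet> Jn a \<one> z"
  by (rule R_inv_eq[OF run_iso]) (simp_all add: R_run pcmp_assoc)

lemma
  assumes "f \<in> hom a b" "g \<in> hom b c" "h \<in> hom c d"
  shows cmp3_hom: "f \<cdot> g \<cdot> h \<in> hom a d"
    and R_cmp3: "word z \<Longrightarrow> R (f \<cdot> g \<cdot> h) z = R f z \<bullet> R g z \<bullet> R h z"
  using assms cmp_hom[OF cmp_hom[OF assms(1,2)] assms(3)]
  by (simp_all add: R_cmp[OF cmp_hom[OF assms(1,2)] assms(3)] R_cmp[OF assms(1,2)] pcmp_assoc)

lemma
  assumes "f \<in> hom a b" "g \<in> hom b c" "h \<in> hom c d" "k \<in> hom d e"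
  shows cmp4_hom: "f \<cdot> g \<cdot> h \<cdot> k \<in> hom a e"
    and R_cmp4: "word z \<Longrightarrow> R (f \<cdot> g \<cdot> h \<cdot> k) z = R f z \<bullet> R g z \<bullet> R h z \<bullet> R k z"
  using assms cmp_hom[OF cmp3_hom[OF assms(1-3)] assms(4)]
  by (simp_all add: R_cmp[OF cmp3_hom[OF assms(1-3)] assms(4)] R_cmp3[OF assms(1-3)] pcmp_assoc)

text \<open>Arrows \<open>p q \<rightarrow> r\<close> and \<open>1 \<rightarrow> r\<close> as cells \<open>p # q # z \<rightarrow> r # z\<close> and \<open>z \<rightarrow> r # z\<close>. In terms of these the
  structural isomorphisms disappear from all axioms of enriched category theory.\<close>

definition Bi :: "'o \<Rightarrow> 'o \<Rightarrow> 'm \<Rightarrow> 'o list \<Rightarrow> ('o, 'm) cell" where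
  "Bi p q f z = Jn p q z \<bullet> R f z"

definition Pt :: "'m \<Rightarrow> 'o list \<Rightarrow> ('o, 'm) cell" where
  "Pt f z = In z \<bullet> R f z"

lemma ok_Bi [simp]:
  assumes "f \<in> hom (p \<otimes> q) r" "p \<in> Obj V" "q \<in> Obj V" "word z"
  shows "ok (Bi p q f z)" "dm (Bi p q f z) = p # q # z" "cd (Bi p q f z) = r # z"
  using assms by (simp_all add: Bi_def)

lemma ok_Pt [simp]:
  assumes "f \<in> hom \<one> r" "word z"
  shows "ok (Pt f z)" "dm (Pt f z) = z" "cd (Pt f z) = r # z"
  using assms by (simp_all add: Pt_def)

text \<open>The \<open>_move\<close> lemmas orient naturality and interchange as rewrite rules: a
  cell acting on the tail passes to the right of one acting in front of it. The second equation of
  each pair is for use inside a longer composite.\<close>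

lemma R_move:
  assumes "f \<in> hom a b" "ok g" "cd g = w"
  shows "L a g \<bullet> R f w = R f (dm g) \<bullet> L b g" "L a g \<bullet> R f w \<bullet> k = R f (dm g) \<bullet> L b g \<bullet> k"
  using R_nat[OF assms(1), of g "dm g" w] assms by (auto simp: Hom_iff intro: chain simp flip: pcmp_assoc)

lemma Jn_move:
  assumes "a \<in> Obj V" "b \<in> Obj V" "ok g" "cd g = w"
  shows "L a (L b g) \<bullet> Jn a b w = Jn a b (dm g) \<bullet> L (a \<otimes> b) g"
    "L a (L b g) \<bullet> Jn a b w \<bullet> k = Jn a b (dm g) \<bullet> L (a \<otimes> b) g \<bullet> k"
  using Jn_nat[OF assms(1,2), of g "dm g" w] assms by (auto simp: Hom_iff simp flip: pcmp_assoc)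

lemma Sp_move:
  assumes "a \<in> Obj V" "b \<in> Obj V" "ok g" "cd g = w"
  shows "L (a \<otimes> b) g \<bullet> Sp a b w = Sp a b (dm g) \<bullet> L a (L b g)"
    "L (a \<otimes> b) g \<bullet> Sp a b w \<bullet> k = Sp a b (dm g) \<bullet> L a (L b g) \<bullet> k"
  using Sp_nat[OF assms(1,2), of g "dm g" w] assms by (auto simp: Hom_iff simp flip: pcmp_assoc)

lemma Dl_move:
  assumes "ok g" "cd g = w"
  shows "L \<one> g \<bullet> Dl w = Dl (dm g) \<bullet> g" "L \<one> g \<bullet> Dl w \<bullet> k = Dl (dm g) \<bullet> g \<bullet> k"
  using Dl_nat[of g "dm g" w] assms by (auto simp: Hom_iff simp flip: pcmp_assoc)

lemma In_move:
  assumes "ok g" "cd g = w"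
  shows "g \<bullet> In w = In (dm g) \<bullet> L \<one> g" "g \<bullet> In w \<bullet> k = In (dm g) \<bullet> L \<one> g \<bullet> k"
  using In_nat[of g "dm g" w] assms by (auto simp: Hom_iff simp flip: pcmp_assoc)

lemma Bi_move:
  assumes "f \<in> hom (p \<otimes> q) r" "p \<in> Obj V" "q \<in> Obj V" "ok g" "cd g = w"
  shows "L p (L q g) \<bullet> Bi p q f w = Bi p q f (dm g) \<bullet> L r g"
    "L p (L q g) \<bullet> Bi p q f w \<bullet> k = Bi p q f (dm g) \<bullet> L r g \<bullet> k"
  using assms by (simp_all add: Bi_def pcmp_assoc Jn_move R_move)

lemma Pt_move:
  assumes "f \<in> hom \<one> r" "ok g" "cd g = w"
  shows "g \<bullet> Pt f w = Pt f (dm g) \<bullet> L r g" "g \<bullet> Pt f w \<bullet> k = Pt f (dm g) \<bullet> L r g \<bullet> k"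
  using assms by (simp_all add: Pt_def pcmp_assoc In_move R_move)

lemma L_move:
  assumes "f \<bullet> g = h"
  shows "L a f \<bullet> L a g = L a h" "L a f \<bullet> L a g \<bullet> k = L a h \<bullet> k"
  using assms by (metis L_pcmp pcmp_assoc)+

lemma L_move3:
  assumes "f \<bullet> g \<bullet> h = k"
  shows "L a f \<bullet> L a g \<bullet> L a h = L a k" "L a f \<bullet> L a g \<bullet> L a h \<bullet> l = L a k \<bullet> l"
  using assms by (metis L_pcmp pcmp_assoc)+

lemma Bi_cmp:
  assumes "f \<in> hom (p \<otimes> q) r" "h \<in> hom r s" "word z"
  shows "Bi p q (f \<cdot> h) z = Bi p q f z \<bullet> R h z"
  using assms by (simp add: Bi_def R_cmp[OF assms(1,2)] pcmp_assoc)

lemma Pt_cmp: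
  assumes "f \<in> hom \<one> r" "h \<in> hom r s" "word z"
  shows "Pt (f \<cdot> h) z = Pt f z \<bullet> R h z"
  using assms by (simp add: Pt_def R_cmp[OF assms(1,2)] pcmp_assoc)

lemma R_Bi: "f \<in> hom (p \<otimes> q) r \<Longrightarrow> p \<in> Obj V \<Longrightarrow> q \<in> Obj V \<Longrightarrow> word z \<Longrightarrow> R f z = Sp p q z \<bullet> Bi p q f z"
  by (simp add: Bi_def)

lemma R_Pt: "f \<in> hom \<one> r \<Longrightarrow> word z \<Longrightarrow> R f z = Dl z \<bullet> Pt f z"
  by (simp add: Pt_def)

lemma Bi_faithful:
  assumes "f \<in> hom (p \<otimes> q) r" "g \<in> hom (p \<otimes> q) r" "p \<in> Obj V" "q \<in> Obj V" "Bi p q f [] = Bi p q g []"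
  shows "f = g"
  using R_faithful[OF assms(1,2)] assms by (simp add: R_Bi)

lemma Pt_faithful:
  assumes "f \<in> hom \<one> r" "g \<in> hom \<one> r" "Pt f [] = Pt g []"
  shows "f = g"
  using R_faithful[OF assms(1,2)] assms by (simp add: R_Pt[of _ r])

lemma Pt_full:
  assumes "x \<in> Hom [] [r]"
  shows "\<exists>f \<in> hom \<one> r. Pt f [] = x"
proof -
  have x: "ok x" "dm x = []" "cd x = [r]" using assms by (auto simp: Hom_iff)
  then have "Dl [] \<bullet> x \<in> Hom [\<one>] [r]" by (simp add: Hom_iff)
  then obtain f where "f \<in> hom \<one> r" "R f [] = Dl [] \<bullet> x" using R_full by blast
  then show ?thesis using x by (intro bexI[of _ f]) (simp_all add: Pt_def)
qed

text \<open>The arrow composes with a point in front; the lemma after it treats composition with a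
  point behind. They are the two sides of the square in \<open>vnat_iso\<close>, and this one also
  computes \<open>ucmp\<close>.\<close>

lemma
  assumes f: "f \<in> hom \<one> p" and g: "g \<in> hom q q'" and c: "c \<in> hom (p \<otimes> q') r"
  shows R_pre: "word z \<Longrightarrow> R (inv (lun q) \<cdot> (f \<odot> g) \<cdot> c) z = R g z \<bullet> Pt f (q' # z) \<bullet> Bi p q' c z"
    and pre_hom: "inv (lun q) \<cdot> (f \<odot> g) \<cdot> c \<in> hom q r"
proof -
  have ob: "p \<in> Obj V" "q \<in> Obj V" "q' \<in> Obj V" using f g hom_Obj by auto
  show "word z \<Longrightarrow> R (inv (lun q) \<cdot> (f \<odot> g) \<cdot> c) z = R g z \<bullet> Pt f (q' # z) \<bullet> Bi p q' c z"
    using ob assms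
    by (simp add: R_cmp3[OF inv_hom[OF lun_iso] tarr_hom[OF f g] c] R_inv_lun R_tarr[OF f g] pcmp_assoc
        Pt_def Bi_def In_move)
  show "inv (lun q) \<cdot> (f \<odot> g) \<cdot> c \<in> hom q r"
    by (rule cmp3_hom[OF inv_hom[OF lun_iso[OF ob(2)]] tarr_hom[OF f g] c])
qed

lemma
  assumes f: "f \<in> hom \<one> p" and g: "g \<in> hom q q'" and c: "c \<in> hom (q' \<otimes> p) r"
  shows R_post: "word z \<Longrightarrow> R (inv (run q) \<cdot> (g \<odot> f) \<cdot> c) z = L q (Pt f z) \<bullet> R g (p # z) \<bullet> Bi q' p c z"
    and post_hom: "inv (run q) \<cdot> (g \<odot> f) \<cdot> c \<in> hom q r"
proof -
  have ob: "p \<in> Obj V" "q \<in> Obj V" "q' \<in> Obj V" using f g hom_Obj by auto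
  show "word z \<Longrightarrow> R (inv (run q) \<cdot> (g \<odot> f) \<cdot> c) z = L q (Pt f z) \<bullet> R g (p # z) \<bullet> Bi q' p c z"
    using ob assms
    by (simp add: R_cmp3[OF inv_hom[OF run_iso] tarr_hom[OF g f] c] R_inv_run R_tarr[OF g f] pcmp_assoc
        Pt_def Bi_def L_pcmp)
  show "inv (run q) \<cdot> (g \<odot> f) \<cdot> c \<in> hom q r"
    by (rule cmp3_hom[OF inv_hom[OF run_iso[OF ob(2)]] tarr_hom[OF g f] c])
qed

lemma Bi_tarr_cmp:
  assumes f: "f \<in> hom p p'" and g: "g \<in> hom q q'" and c: "c \<in> hom (p' \<otimes> q') r" and z: "word z"
  shows "Bi p q ((f \<odot> g) \<cdot> c) z = L p (R g z) \<bullet> R f (q' # z) \<bullet> Bi p' q' c z"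
proof -
  have ob: "p \<in> Obj V" "p' \<in> Obj V" "q \<in> Obj V" "q' \<in> Obj V" using f g hom_Obj by auto
  then show ?thesis using assms
    by (simp add: Bi_def R_cmp[OF tarr_hom[OF f g] c] R_tarr[OF f g] pcmp_assoc)
qed

text \<open>An associativity law in V yields its cell form at every tail, but already follows from
  the form at the empty tail. Hence the first direction is for using laws and the second for proving
  them.\<close>

lemma
  assumes f: "f \<in> hom (p \<otimes> q) p'" and g: "g \<in> hom (p' \<otimes> s) t" and f': "f' \<in> hom (q \<otimes> s) q'"
    and g': "g' \<in> hom (p \<otimes> q') t" and ob: "p \<in> Obj V" "q \<in> Obj V" "s \<in> Obj V" and z: "word z"
  shows assoc_lawD: "(f \<odot> ide s) \<cdot> g = asc p q s \<cdot> (ide p \<odot> f') \<cdot> g' \<Longrightarrow>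
      Bi p q f (s # z) \<bullet> Bi p' s g z = L p (Bi q s f' z) \<bullet> Bi p q' g' z"
    and assoc_lawI: "Bi p q f [s] \<bullet> Bi p' s g [] = L p (Bi q s f' []) \<bullet> Bi p q' g' [] \<Longrightarrow>
      (f \<odot> ide s) \<cdot> g = asc p q s \<cdot> (ide p \<odot> f') \<cdot> g'"
proof -
  have ob': "p' \<in> Obj V" "q' \<in> Obj V" using f f' hom_Obj by auto
  note i = iso_hom[OF asc_iso[OF ob]] tarr_hom[OF ide_hom[OF ob(1)] f'] tarr_hom[OF f ide_hom[OF ob(3)]]
  have l: "R ((f \<odot> ide s) \<cdot> g) z = Sp (p \<otimes> q) s z \<bullet> Sp p q (s # z) \<bullet> Bi p q f (s # z) \<bullet> Bi p' s g z"
    and r: "R (asc p q s \<cdot> (ide p \<odot> f') \<cdot> g') z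
      = Sp (p \<otimes> q) s z \<bullet> Sp p q (s # z) \<bullet> L p (Bi q s f' z) \<bullet> Bi p q' g' z" if z: "word z" for z
    using ob ob' f g f' g' z
    by (simp_all add: R_cmp[OF i(3) g] R_cmp3[OF i(1,2) g'] R_tarr_ide_left[OF f'] R_tarr_ide_right[OF f]
        R_asc Bi_def L_pcmp pcmp_assoc)
  have h: "ok x \<Longrightarrow> dm x = p # q # s # z \<Longrightarrow> Jn p q (s # z) \<bullet> Jn (p \<otimes> q) s z \<bullet> Sp (p \<otimes> q) s z \<bullet> Sp p q (s # z) \<bullet> x = x"
    for x using ob z by simp
  show "Bi p q f (s # z) \<bullet> Bi p' s g z = L p (Bi q s f' z) \<bullet> Bi p q' g' z"
    if "(f \<odot> ide s) \<cdot> g = asc p q s \<cdot> (ide p \<odot> f') \<cdot> g'"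
    using l[OF z, unfolded that, unfolded r[OF z]] f g f' g' ob ob' z
    by (subst (1 2) h[symmetric]) simp_all
  show "(f \<odot> ide s) \<cdot> g = asc p q s \<cdot> (ide p \<odot> f') \<cdot> g'"
    if "Bi p q f [s] \<bullet> Bi p' s g [] = L p (Bi q s f' []) \<bullet> Bi p q' g' []"
    using cmp_hom[OF i(3) g] cmp3_hom[OF i(1,2) g'] l[of "[]"] r[of "[]"] that z
    by (intro R_faithful) auto
qed

lemma
  assumes f: "f \<in> hom \<one> p" and ob: "q \<in> Obj V" and z: "word z"
  shows unit_law_leftD: "c \<in> hom (p \<otimes> q) q \<Longrightarrow> (f \<odot> ide q) \<cdot> c = lun q \<Longrightarrow>
      Pt f (q # z) \<bullet> Bi p q c z = Id (q # z)"
    and unit_law_leftI: "c \<in> hom (p \<otimes> q) q \<Longrightarrow> Pt f [q] \<bullet> Bi p q c [] = Id [q] \<Longrightarrow>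
      (f \<odot> ide q) \<cdot> c = lun q"
    and unit_law_rightD: "c \<in> hom (q \<otimes> p) q \<Longrightarrow> (ide q \<odot> f) \<cdot> c = run q \<Longrightarrow>
      L q (Pt f z) \<bullet> Bi q p c z = Id (q # z)"
    and unit_law_rightI: "c \<in> hom (q \<otimes> p) q \<Longrightarrow> L q (Pt f []) \<bullet> Bi q p c [] = Id [q] \<Longrightarrow>
      (ide q \<odot> f) \<cdot> c = run q"
proof -
  have p: "p \<in> Obj V" using f hom_Obj by auto
  note i = tarr_hom[OF f ide_hom[OF ob]] tarr_hom[OF ide_hom[OF ob] f]
  have l: "R ((f \<odot> ide q) \<cdot> c) z = Sp \<one> q z \<bullet> Dl (q # z) \<bullet> Pt f (q # z) \<bullet> Bi p q c z"
    if "c \<in> hom (p \<otimes> q) q" "word z" for z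
    using that p ob f by (simp add: R_cmp[OF i(1)] R_tarr_ide_right[OF f] Bi_def Pt_def pcmp_assoc)
  have r: "R ((ide q \<odot> f) \<cdot> c) z = Sp q \<one> z \<bullet> L q (Dl z) \<bullet> L q (Pt f z) \<bullet> Bi q p c z"
    if "c \<in> hom (q \<otimes> p) q" "word z" for z
    using that p ob f by (simp add: R_cmp[OF i(2)] R_tarr_ide_left[OF f] Bi_def Pt_def pcmp_assoc L_pcmp)
  show "Pt f (q # z) \<bullet> Bi p q c z = Id (q # z)" if "c \<in> hom (p \<otimes> q) q" "(f \<odot> ide q) \<cdot> c = lun q"
  proof (rule left_cancel)
    show "(In (q # z) \<bullet> Jn \<one> q z) \<bullet> (Sp \<one> q z \<bullet> Dl (q # z)) = Id (q # z)" using ob z by (simp add: pcmp_assoc)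
    show "(Sp \<one> q z \<bullet> Dl (q # z)) \<bullet> Pt f (q # z) \<bullet> Bi p q c z = (Sp \<one> q z \<bullet> Dl (q # z)) \<bullet> Id (q # z)"
      using l[OF that(1) z, unfolded that(2), symmetric] ob z by (simp add: pcmp_assoc R_lun)
  qed (use ob f p z that(1) in simp_all)
  show "L q (Pt f z) \<bullet> Bi q p c z = Id (q # z)" if "c \<in> hom (q \<otimes> p) q" "(ide q \<odot> f) \<cdot> c = run q"
  proof (rule left_cancel)
    show "(L q (In z) \<bullet> Jn q \<one> z) \<bullet> (Sp q \<one> z \<bullet> L q (Dl z)) = Id (q # z)" using ob z by (simp add: pcmp_assoc)
    show "(Sp q \<one> z \<bullet> L q (Dl z)) \<bullet> L q (Pt f z) \<bullet> Bi q p c z = (Sp q \<one> z \<bullet> L q (Dl z)) \<bullet> Id (q # z)"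
      using r[OF that(1) z, unfolded that(2), symmetric] ob z by (simp add: pcmp_assoc R_run)
  qed (use ob f p z that(1) in simp_all)
  show "(f \<odot> ide q) \<cdot> c = lun q" if "c \<in> hom (p \<otimes> q) q" "Pt f [q] \<bullet> Bi p q c [] = Id [q]"
    using that l[of "[]"] ob R_lun[of q "[]"]
    by (intro R_faithful[of _ "\<one> \<otimes> q" q] cmp_hom[OF i(1)] iso_hom[OF lun_iso]) auto
  show "(ide q \<odot> f) \<cdot> c = run q" if "c \<in> hom (q \<otimes> p) q" "L q (Pt f []) \<bullet> Bi q p c [] = Id [q]"
    using that r[of "[]"] ob R_run[of q "[]"]
    by (intro R_faithful[of _ "q \<otimes> \<one>" q] cmp_hom[OF i(2)] iso_hom[OF run_iso]) auto
qed

end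

section \<open>Enriched categories in terms of cells\<close>

context monoidal_category
begin

definition M :: "('c, 'o, 'm) vcat \<Rightarrow> 'c \<Rightarrow> 'c \<Rightarrow> 'c \<Rightarrow> 'o list \<Rightarrow> ('o, 'm) cell" where
  "M C a b c z = Bi (VHom C a b) (VHom C b c) (VCmp C a b c) z"

definition J :: "('c, 'o, 'm) vcat \<Rightarrow> 'c \<Rightarrow> 'o list \<Rightarrow> ('o, 'm) cell" where
  "J C a z = Pt (VIde C a) z"

lemma
  assumes "vcategory C"
  shows VHom_Obj [simp]: "a \<in> VObj C \<Longrightarrow> b \<in> VObj C \<Longrightarrow> VHom C a b \<in> Obj V"
    and VIde_hom [simp]: "a \<in> VObj C \<Longrightarrow> VIde C a \<in> hom \<one> (VHom C a a)"
    and VCmp_hom [simp]: "a \<in> VObj C \<Longrightarrow> b \<in> VObj C \<Longrightarrow> c \<in> VObj C \<Longrightarrow>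
      VCmp C a b c \<in> hom (VHom C a b \<otimes> VHom C b c) (VHom C a c)"
    and vcategory_assoc: "a \<in> VObj C \<Longrightarrow> b \<in> VObj C \<Longrightarrow> c \<in> VObj C \<Longrightarrow> d \<in> VObj C \<Longrightarrow>
      (VCmp C a b c \<odot> ide (VHom C c d)) \<cdot> VCmp C a c d
        = asc (VHom C a b) (VHom C b c) (VHom C c d) \<cdot> (ide (VHom C a b) \<odot> VCmp C b c d) \<cdot> VCmp C a b d"
    and vcategory_unit_left: "a \<in> VObj C \<Longrightarrow> b \<in> VObj C \<Longrightarrow>
      (VIde C a \<odot> ide (VHom C a b)) \<cdot> VCmp C a a b = lun (VHom C a b)"
    and vcategory_unit_right: "a \<in> VObj C \<Longrightarrow> b \<in> VObj C \<Longrightarrow>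
      (ide (VHom C a b) \<odot> VIde C b) \<cdot> VCmp C a b b = run (VHom C a b)"
  using assms unfolding vcategory_def by blast+

lemma ok_M [simp]:
  assumes "vcategory C" "a \<in> VObj C" "b \<in> VObj C" "c \<in> VObj C" "word z"
  shows "ok (M C a b c z)" "dm (M C a b c z) = VHom C a b # VHom C b c # z"
    "cd (M C a b c z) = VHom C a c # z"
  using ok_Bi[OF VCmp_hom[OF assms(1-4)]] assms by (simp_all add: M_def)

lemma ok_J [simp]:
  assumes "vcategory C" "a \<in> VObj C" "word z"
  shows "ok (J C a z)" "dm (J C a z) = z" "cd (J C a z) = VHom C a a # z"
  using ok_Pt[OF VIde_hom[OF assms(1,2)]] assms by (simp_all add: J_def)

lemma M_move:
  assumes "vcategory C" "a \<in> VObj C" "b \<in> VObj C" "c \<in> VObj C" "ok g" "cd g = w"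
  shows "L (VHom C a b) (L (VHom C b c) g) \<bullet> M C a b c w = M C a b c (dm g) \<bullet> L (VHom C a c) g"
    "L (VHom C a b) (L (VHom C b c) g) \<bullet> M C a b c w \<bullet> k = M C a b c (dm g) \<bullet> L (VHom C a c) g \<bullet> k"
  unfolding M_def using Bi_move[OF VCmp_hom[OF assms(1-4)]] assms by simp_all

lemma J_move:
  assumes "vcategory C" "a \<in> VObj C" "ok g" "cd g = w"
  shows "g \<bullet> J C a w = J C a (dm g) \<bullet> L (VHom C a a) g"
    "g \<bullet> J C a w \<bullet> k = J C a (dm g) \<bullet> L (VHom C a a) g \<bullet> k"
  unfolding J_def using Pt_move[OF VIde_hom[OF assms(1,2)]] assms by simp_all

lemma M_assoc:
  assumes "vcategory C" "a \<in> VObj C" "b \<in> VObj C" "c \<in> VObj C" "d \<in> VObj C" "word z"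
  shows "M C a b c (VHom C c d # z) \<bullet> M C a c d z = L (VHom C a b) (M C b c d z) \<bullet> M C a b d z"
  unfolding M_def using assms
  by (intro assoc_lawD[where t = "VHom C a d"]) (simp_all add: vcategory_assoc)

lemma J_M:
  assumes "vcategory C" "a \<in> VObj C" "b \<in> VObj C" "word z"
  shows "J C a (VHom C a b # z) \<bullet> M C a a b z = Id (VHom C a b # z)"
  unfolding M_def J_def using assms by (intro unit_law_leftD) (simp_all add: vcategory_unit_left)

lemma L_J_M:
  assumes "vcategory C" "a \<in> VObj C" "b \<in> VObj C" "word z"
  shows "L (VHom C a b) (J C b z) \<bullet> M C a b b z = Id (VHom C a b # z)"
  unfolding M_def J_def using assms by (intro unit_law_rightD) (simp_all add: vcategory_unit_right)

lemma vcategoryI: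
  assumes "\<And>a b. a \<in> VObj C \<Longrightarrow> b \<in> VObj C \<Longrightarrow> VHom C a b \<in> Obj V"
    and "\<And>a. a \<in> VObj C \<Longrightarrow> VIde C a \<in> hom \<one> (VHom C a a)"
    and "\<And>a b c. a \<in> VObj C \<Longrightarrow> b \<in> VObj C \<Longrightarrow> c \<in> VObj C \<Longrightarrow>
      VCmp C a b c \<in> hom (VHom C a b \<otimes> VHom C b c) (VHom C a c)"
    and "\<And>a b c d. a \<in> VObj C \<Longrightarrow> b \<in> VObj C \<Longrightarrow> c \<in> VObj C \<Longrightarrow> d \<in> VObj C \<Longrightarrow>
      M C a b c [VHom C c d] \<bullet> M C a c d [] = L (VHom C a b) (M C b c d []) \<bullet> M C a b d []"
    and "\<And>a b. a \<in> VObj C \<Longrightarrow> b \<in> VObj C \<Longrightarrow> J C a [VHom C a b] \<bullet> M C a a b [] = Id [VHom C a b]"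
    and "\<And>a b. a \<in> VObj C \<Longrightarrow> b \<in> VObj C \<Longrightarrow>
      L (VHom C a b) (J C b []) \<bullet> M C a b b [] = Id [VHom C a b]"
  shows "vcategory C"
  unfolding vcategory_def
proof (intro conjI ballI)
  fix a b c d assume o: "a \<in> VObj C" "b \<in> VObj C" "c \<in> VObj C" "d \<in> VObj C"
  show "(VCmp C a b c \<odot> ide (VHom C c d)) \<cdot> VCmp C a c d
    = asc (VHom C a b) (VHom C b c) (VHom C c d) \<cdot> (ide (VHom C a b) \<odot> VCmp C b c d) \<cdot> VCmp C a b d"
    using o assms(4)[OF o] by (intro assoc_lawI[where t = "VHom C a d" and z = "[]"]) (simp_all add: assms M_def)
next
  fix a b assume o: "a \<in> VObj C" "b \<in> VObj C"
  show "(VIde C a \<odot> ide (VHom C a b)) \<cdot> VCmp C a a b = lun (VHom C a b)"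
    using o assms(5)[OF o] by (intro unit_law_leftI[where z = "[]"]) (simp_all add: assms M_def J_def)
  show "(ide (VHom C a b) \<odot> VIde C b) \<cdot> VCmp C a b b = run (VHom C a b)"
    using o assms(6)[OF o] by (intro unit_law_rightI[where z = "[]"]) (simp_all add: assms M_def J_def)
qed (simp_all add: assms)

lemma
  assumes "vfunctor C D F"
  shows vfunctor_source: "vcategory C" and vfunctor_target: "vcategory D"
    and FObj_VObj: "a \<in> VObj C \<Longrightarrow> FObj F a \<in> VObj D"
    and FHom_hom: "a \<in> VObj C \<Longrightarrow> b \<in> VObj C \<Longrightarrow>
      FHom F a b \<in> hom (VHom C a b) (VHom D (FObj F a) (FObj F b))"
  using assms unfolding vfunctor_def by blast+

lemma R_FHom_J:
  assumes "vfunctor C D F" "a \<in> VObj C" "word z"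
  shows "J C a z \<bullet> R (FHom F a a) z = J D (FObj F a) z"
proof -
  have "VIde C a \<cdot> FHom F a a = VIde D (FObj F a)" using assms unfolding vfunctor_def by blast
  then show ?thesis
    using Pt_cmp[OF VIde_hom[OF vfunctor_source[OF assms(1)] assms(2)] FHom_hom[OF assms(1,2,2)] assms(3)]
    by (simp add: J_def)
qed

lemma R_FHom_M:
  assumes "vfunctor C D F" "a \<in> VObj C" "b \<in> VObj C" "c \<in> VObj C" "word z"
  shows "M C a b c z \<bullet> R (FHom F a c) z = L (VHom C a b) (R (FHom F b c) z)
    \<bullet> R (FHom F a b) (VHom D (FObj F b) (FObj F c) # z) \<bullet> M D (FObj F a) (FObj F b) (FObj F c) z"
proof -
  have "VCmp C a b c \<cdot> FHom F a c = (FHom F a b \<odot> FHom F b c) \<cdot> VCmp D (FObj F a) (FObj F b) (FObj F c)"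
    using assms unfolding vfunctor_def by blast
  moreover note o = FObj_VObj[OF assms(1,2)] FObj_VObj[OF assms(1,3)] FObj_VObj[OF assms(1,4)]
  ultimately show ?thesis
    using Bi_cmp[OF VCmp_hom[OF vfunctor_source[OF assms(1)] assms(2-4)] FHom_hom[OF assms(1,2,4)] assms(5)]
      Bi_tarr_cmp[OF FHom_hom[OF assms(1-3)] FHom_hom[OF assms(1,3,4)]
        VCmp_hom[OF vfunctor_target[OF assms(1)] o] assms(5)]
    by (simp add: M_def)
qed

lemma vfunctorI:
  assumes "vcategory C" "vcategory D"
    and "\<And>a. a \<in> VObj C \<Longrightarrow> FObj F a \<in> VObj D"
    and "\<And>a b. a \<in> VObj C \<Longrightarrow> b \<in> VObj C \<Longrightarrow> FHom F a b \<in> hom (VHom C a b) (VHom D (FObj F a) (FObj F b))"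
    and "\<And>a. a \<in> VObj C \<Longrightarrow> J C a [] \<bullet> R (FHom F a a) [] = J D (FObj F a) []"
    and "\<And>a b c. a \<in> VObj C \<Longrightarrow> b \<in> VObj C \<Longrightarrow> c \<in> VObj C \<Longrightarrow>
      M C a b c [] \<bullet> R (FHom F a c) [] = L (VHom C a b) (R (FHom F b c) [])
        \<bullet> R (FHom F a b) [VHom D (FObj F b) (FObj F c)] \<bullet> M D (FObj F a) (FObj F b) (FObj F c) []"
  shows "vfunctor C D F"
proof -
  have "VIde C a \<cdot> FHom F a a = VIde D (FObj F a)" if a: "a \<in> VObj C" for a
  proof (rule Pt_faithful)
    show "Pt (VIde C a \<cdot> FHom F a a) [] = Pt (VIde D (FObj F a)) []"
      using assms(5)[OF a] Pt_cmp[OF VIde_hom[OF assms(1) a] assms(4)[OF a a], of "[]"] by (simp add: J_def)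
    show "VIde C a \<cdot> FHom F a a \<in> hom \<one> (VHom D (FObj F a) (FObj F a))"
      using cmp_hom[OF VIde_hom[OF assms(1) a] assms(4)[OF a a]] .
  qed (use assms a in simp)
  moreover have "VCmp C a b c \<cdot> FHom F a c = (FHom F a b \<odot> FHom F b c) \<cdot> VCmp D (FObj F a) (FObj F b) (FObj F c)"
    if o: "a \<in> VObj C" "b \<in> VObj C" "c \<in> VObj C" for a b c
  proof (rule Bi_faithful)
    note o' = assms(3)[OF o(1)] assms(3)[OF o(2)] assms(3)[OF o(3)]
    note h = VCmp_hom[OF assms(1) o] assms(4)[OF o(1,3)] assms(4)[OF o(1,2)] assms(4)[OF o(2,3)]
      VCmp_hom[OF assms(2) o']
    show "VCmp C a b c \<cdot> FHom F a c \<in> hom (VHom C a b \<otimes> VHom C b c) (VHom D (FObj F a) (FObj F c))"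
      using cmp_hom[OF h(1,2)] .
    show "(FHom F a b \<odot> FHom F b c) \<cdot> VCmp D (FObj F a) (FObj F b) (FObj F c)
      \<in> hom (VHom C a b \<otimes> VHom C b c) (VHom D (FObj F a) (FObj F c))"
      using cmp_hom[OF tarr_hom[OF h(3,4)] h(5)] .
    show "Bi (VHom C a b) (VHom C b c) (VCmp C a b c \<cdot> FHom F a c) []
      = Bi (VHom C a b) (VHom C b c) ((FHom F a b \<odot> FHom F b c) \<cdot> VCmp D (FObj F a) (FObj F b) (FObj F c)) []"
      using Bi_cmp[OF h(1,2), of "[]"] Bi_tarr_cmp[OF h(3-5), of "[]"] assms(6)[OF o] by (simp add: M_def)
  qed (use assms o in simp_all)
  ultimately show ?thesis using assms unfolding vfunctor_def by blast
qed

lemma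
  assumes "vcategory C" "f \<in> uhom C a b" "g \<in> uhom C b c" "a \<in> VObj C" "b \<in> VObj C" "c \<in> VObj C"
  shows ucmp_uhom: "ucmp C a b c f g \<in> uhom C a c"
    and Pt_ucmp: "word z \<Longrightarrow> Pt (ucmp C a b c f g) z = Pt g z \<bullet> Pt f (VHom C b c # z) \<bullet> M C a b c z"
proof -
  have fg: "f \<in> hom \<one> (VHom C a b)" "g \<in> hom \<one> (VHom C b c)" using assms by (simp_all add: uhom_def)
  show "ucmp C a b c f g \<in> uhom C a c"
    using pre_hom[OF fg VCmp_hom[OF assms(1,4-6)]] by (simp add: uhom_def ucmp_def)
  show "word z \<Longrightarrow> Pt (ucmp C a b c f g) z = Pt g z \<bullet> Pt f (VHom C b c # z) \<bullet> M C a b c z"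
    using R_pre[OF fg VCmp_hom[OF assms(1,4-6)]] by (simp add: ucmp_def Pt_def[of _ z] M_def pcmp_assoc)
qed

text \<open>The inverse may be given as a bare cell on the empty word, which \<open>Pt_full\<close>
  turns into a point. In both equations \<open>t\<close> stands first; inserting \<open>f\<close>
  before or behind its letter gives the two composites.\<close>

lemma uisoI:
  assumes C: "vcategory C" and ab: "a \<in> VObj C" "b \<in> VObj C" and f: "f \<in> uhom C a b"
    and t: "t \<in> Hom [] [VHom C b a]"
    and ft: "t \<bullet> Pt f [VHom C b a] \<bullet> M C a b a [] = J C a []"
    and tf: "t \<bullet> L (VHom C b a) (Pt f []) \<bullet> M C b a b [] = J C b []"
  shows "f \<in> uiso C a b"
proof -
  obtain g where g: "g \<in> uhom C b a" "Pt g [] = t" using Pt_full[OF t] by (auto simp: uhom_def)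
  have h: "f \<in> hom \<one> (VHom C a b)" "g \<in> hom \<one> (VHom C b a)" using f g by (simp_all add: uhom_def)
  have "ucmp C a b a f g = VIde C a"
    using ucmp_uhom[OF C f g(1) ab ab(1)] C ab ft g(2) Pt_ucmp[OF C f g(1) ab ab(1), of "[]"]
    by (intro Pt_faithful[of _ "VHom C a a"]) (simp_all add: uhom_def J_def)
  moreover have "ucmp C b a b g f = VIde C b"
    using ucmp_uhom[OF C g(1) f ab(2,1,2)] C ab tf g(2) Pt_ucmp[OF C g(1) f ab(2,1,2), of "[]"]
      Pt_move(2)[OF h(2), of "Pt f []" "[VHom C a b]"] h
    by (intro Pt_faithful[of _ "VHom C b b"]) (simp_all add: uhom_def J_def)
  ultimately show ?thesis using f g by (auto simp: uiso_def)
qed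

lemma uisoE:
  assumes "f \<in> uiso C a b" "vcategory C" "a \<in> VObj C" "b \<in> VObj C"
  obtains g where "g \<in> uhom C b a" "g \<in> uiso C b a"
    "\<And>z. word z \<Longrightarrow> Pt g z \<bullet> Pt f (VHom C b a # z) \<bullet> M C a b a z = J C a z"
    "\<And>z. word z \<Longrightarrow> Pt f z \<bullet> Pt g (VHom C a b # z) \<bullet> M C b a b z = J C b z"
proof -
  obtain g where "g \<in> uhom C b a" "ucmp C a b a f g = VIde C a" "ucmp C b a b g f = VIde C b" "f \<in> uhom C a b"
    using assms(1) by (auto simp: uiso_def)
  then show thesis
    using that[of g] Pt_ucmp[of C f a b g a] Pt_ucmp[of C g b a f b] assms(2-4) by (auto simp: uiso_def J_def)
qed

lemma vnat_isoI:
  assumes F: "vfunctor C D F" and G: "vfunctor C D G"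
    and t: "\<And>a. a \<in> VObj C \<Longrightarrow> \<theta> a \<in> uiso D (FObj F a) (FObj G a)"
    and eq: "\<And>a b. a \<in> VObj C \<Longrightarrow> b \<in> VObj C \<Longrightarrow>
      R (FHom G a b) [] \<bullet> Pt (\<theta> a) [VHom D (FObj G a) (FObj G b)] \<bullet> M D (FObj F a) (FObj G a) (FObj G b) []
      = L (VHom C a b) (Pt (\<theta> b) []) \<bullet> R (FHom F a b) [VHom D (FObj F b) (FObj G b)]
        \<bullet> M D (FObj F a) (FObj F b) (FObj G b) []"
  shows "vnat_iso C D F G \<theta>"
proof -
  have "inv (lun (VHom C a b)) \<cdot> (\<theta> a \<odot> FHom G a b) \<cdot> VCmp D (FObj F a) (FObj G a) (FObj G b)
    = inv (run (VHom C a b)) \<cdot> (FHom F a b \<odot> \<theta> b) \<cdot> VCmp D (FObj F a) (FObj F b) (FObj G b)"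
    if ab: "a \<in> VObj C" "b \<in> VObj C" for a b
  proof -
    note o = FObj_VObj[OF F ab(1)] FObj_VObj[OF F ab(2)] FObj_VObj[OF G ab(1)] FObj_VObj[OF G ab(2)]
    have h: "\<theta> a \<in> hom \<one> (VHom D (FObj F a) (FObj G a))" "\<theta> b \<in> hom \<one> (VHom D (FObj F b) (FObj G b))"
      using t[OF ab(1)] t[OF ab(2)] by (simp_all add: uiso_def uhom_def)
    note c = VCmp_hom[OF vfunctor_target[OF F] o(1,3,4)] VCmp_hom[OF vfunctor_target[OF F] o(1,2,4)]
    show ?thesis
      using R_faithful[OF pre_hom[OF h(1) FHom_hom[OF G ab] c(1)] post_hom[OF h(2) FHom_hom[OF F ab] c(2)]]
        R_pre[OF h(1) FHom_hom[OF G ab] c(1), of "[]"] R_post[OF h(2) FHom_hom[OF F ab] c(2), of "[]"] eq[OF ab]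
      by (simp add: M_def)
  qed
  then show ?thesis using assms unfolding vnat_iso_def by blast
qed

lemma
  assumes adj: "vadjunction C D F G \<phi>"
  shows vadjunction_left: "vfunctor C D F"
    and vadjunction_iso: "a \<in> VObj C \<Longrightarrow> d \<in> VObj D \<Longrightarrow> \<phi> a d \<in> iso (VHom D (FObj F a) d) (VHom C a (FObj G d))"
    and vadjunction_nat_right: "a \<in> VObj C \<Longrightarrow> d \<in> VObj D \<Longrightarrow> e \<in> VObj D \<Longrightarrow> word z \<Longrightarrow>
      M D (FObj F a) d e z \<bullet> R (\<phi> a e) z = L (VHom D (FObj F a) d) (R (FHom G d e) z)
        \<bullet> R (\<phi> a d) (VHom C (FObj G d) (FObj G e) # z) \<bullet> M C a (FObj G d) (FObj G e) z"
proof -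
  have G: "vfunctor D C G" using adj unfolding vadjunction_def by blast
  show F: "vfunctor C D F"
    and i: "\<And>a d. a \<in> VObj C \<Longrightarrow> d \<in> VObj D \<Longrightarrow> \<phi> a d \<in> iso (VHom D (FObj F a) d) (VHom C a (FObj G d))"
    using adj unfolding vadjunction_def by blast+
  assume o: "a \<in> VObj C" "d \<in> VObj D" "e \<in> VObj D" and z: "word z"
  note o' = FObj_VObj[OF F o(1)] FObj_VObj[OF G o(2)] FObj_VObj[OF G o(3)]
  note c = VCmp_hom[OF vfunctor_target[OF F] o'(1) o(2,3)] VCmp_hom[OF vfunctor_source[OF F] o(1) o'(2,3)]
  have "VCmp D (FObj F a) d e \<cdot> \<phi> a e = (\<phi> a d \<odot> FHom G d e) \<cdot> VCmp C a (FObj G d) (FObj G e)"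
    using adj o unfolding vadjunction_def by blast
  then show "M D (FObj F a) d e z \<bullet> R (\<phi> a e) z = L (VHom D (FObj F a) d) (R (FHom G d e) z)
        \<bullet> R (\<phi> a d) (VHom C (FObj G d) (FObj G e) # z) \<bullet> M C a (FObj G d) (FObj G e) z"
    using Bi_cmp[OF c(1) iso_hom[OF i[OF o(1,3)]] z]
      Bi_tarr_cmp[OF iso_hom[OF i[OF o(1,2)]] FHom_hom[OF G o(2,3)] c(2) z] by (simp add: M_def)
qed

lemma vadjunctionI:
  assumes F: "vfunctor C D F" and G: "vfunctor D C G"
    and i: "\<And>a d. a \<in> VObj C \<Longrightarrow> d \<in> VObj D \<Longrightarrow> \<phi> a d \<in> iso (VHom D (FObj F a) d) (VHom C a (FObj G d))"
    and l: "\<And>a b d. a \<in> VObj C \<Longrightarrow> b \<in> VObj C \<Longrightarrow> d \<in> VObj D \<Longrightarrow>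
      R (FHom F a b) [VHom D (FObj F b) d] \<bullet> M D (FObj F a) (FObj F b) d [] \<bullet> R (\<phi> a d) []
      = L (VHom C a b) (R (\<phi> b d) []) \<bullet> M C a b (FObj G d) []"
    and r: "\<And>a d e. a \<in> VObj C \<Longrightarrow> d \<in> VObj D \<Longrightarrow> e \<in> VObj D \<Longrightarrow>
      M D (FObj F a) d e [] \<bullet> R (\<phi> a e) [] = L (VHom D (FObj F a) d) (R (FHom G d e) [])
        \<bullet> R (\<phi> a d) [VHom C (FObj G d) (FObj G e)] \<bullet> M C a (FObj G d) (FObj G e) []"
  shows "vadjunction C D F G \<phi>"
proof -
  note C = vfunctor_source[OF F] and D = vfunctor_target[OF F]
  have "(FHom F a b \<odot> ide (VHom D (FObj F b) d)) \<cdot> VCmp D (FObj F a) (FObj F b) d \<cdot> \<phi> a d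
    = (ide (VHom C a b) \<odot> \<phi> b d) \<cdot> VCmp C a b (FObj G d)"
    if o: "a \<in> VObj C" "b \<in> VObj C" "d \<in> VObj D" for a b d
  proof -
    note o' = FObj_VObj[OF F o(1)] FObj_VObj[OF F o(2)] FObj_VObj[OF G o(3)]
    note h = FHom_hom[OF F o(1,2)] ide_hom[OF VHom_Obj[OF D o'(2) o(3)]] VCmp_hom[OF D o'(1,2) o(3)]
      iso_hom[OF i[OF o(1,3)]] ide_hom[OF VHom_Obj[OF C o(1,2)]] iso_hom[OF i[OF o(2,3)]]
      VCmp_hom[OF C o(1,2) o'(3)]
    note t = cmp_hom[OF tarr_hom[OF h(1,2)] h(3)]
    show ?thesis
    proof (rule Bi_faithful[OF cmp_hom[OF t h(4)] cmp_hom[OF tarr_hom[OF h(5,6)] h(7)]])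
      show "Bi (VHom C a b) (VHom D (FObj F b) d)
          ((FHom F a b \<odot> ide (VHom D (FObj F b) d)) \<cdot> VCmp D (FObj F a) (FObj F b) d \<cdot> \<phi> a d) []
        = Bi (VHom C a b) (VHom D (FObj F b) d) ((ide (VHom C a b) \<odot> \<phi> b d) \<cdot> VCmp C a b (FObj G d)) []"
        using l[OF o] o o' C D h
        by (simp add: Bi_cmp[OF t h(4)] Bi_tarr_cmp[OF h(1-3)] Bi_tarr_cmp[OF h(5-7)] R_ide L_Id M_def pcmp_assoc)
    qed (use o o' C D in simp_all)
  qed
  moreover have "VCmp D (FObj F a) d e \<cdot> \<phi> a e = (\<phi> a d \<odot> FHom G d e) \<cdot> VCmp C a (FObj G d) (FObj G e)"
    if o: "a \<in> VObj C" "d \<in> VObj D" "e \<in> VObj D" for a d e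
  proof -
    note o' = FObj_VObj[OF F o(1)] FObj_VObj[OF G o(2)] FObj_VObj[OF G o(3)]
    note h = VCmp_hom[OF D o'(1) o(2,3)] iso_hom[OF i[OF o(1,3)]] iso_hom[OF i[OF o(1,2)]]
      FHom_hom[OF G o(2,3)] VCmp_hom[OF C o(1) o'(2,3)]
    show ?thesis
    proof (rule Bi_faithful[OF cmp_hom[OF h(1,2)] cmp_hom[OF tarr_hom[OF h(3,4)] h(5)]])
      show "Bi (VHom D (FObj F a) d) (VHom D d e) (VCmp D (FObj F a) d e \<cdot> \<phi> a e) []
        = Bi (VHom D (FObj F a) d) (VHom D d e) ((\<phi> a d \<odot> FHom G d e) \<cdot> VCmp C a (FObj G d) (FObj G e)) []"
        using r[OF o] by (simp add: Bi_cmp[OF h(1,2)] Bi_tarr_cmp[OF h(3-5)] M_def)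
    qed (use o o' C D in simp_all)
  qed
  ultimately show ?thesis using F G i unfolding vadjunction_def by blast
qed

end

section \<open>Internal homs in terms of cells\<close>

lemma (in monoidal_category) Bi_inv_asc:
  assumes h: "h \<in> hom ((p \<otimes> q) \<otimes> s) t" and ob: "p \<in> Obj V" "q \<in> Obj V" "s \<in> Obj V"
  shows "word z \<Longrightarrow> L p (Jn q s z) \<bullet> Bi p (q \<otimes> s) (inv (asc p q s) \<cdot> h) z = Jn p q (s # z) \<bullet> Jn (p \<otimes> q) s z \<bullet> R h z"
    "inv (asc p q s) \<cdot> h \<in> hom (p \<otimes> q \<otimes> s) t"
  using ob h cmp_hom[OF inv_hom[OF asc_iso[OF ob]] h]
  by (simp_all add: Bi_def R_cmp[OF inv_hom[OF asc_iso[OF ob]] h] R_inv_asc pcmp_assoc)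

context rigid_monoidal_category
begin

lemma
  assumes "v \<in> Obj V"
  shows dual_Obj [simp]: "dual v \<in> Obj V"
    and ev_hom: "ev v \<in> hom (v \<otimes> dual v) \<one>"
    and coev_hom: "coev v \<in> hom \<one> (dual v \<otimes> v)"
  using dual[OF assms] by (simp_all add: is_dual_def)

definition EV :: "'o \<Rightarrow> 'o list \<Rightarrow> ('o, 'm) cell" where
  "EV v z = Bi v (dual v) (ev v) z \<bullet> Dl z"

definition CO :: "'o \<Rightarrow> 'o list \<Rightarrow> ('o, 'm) cell" where
  "CO v z = Pt (coev v) z \<bullet> Sp (dual v) v z"

lemma ok_EV [simp]:
  assumes "v \<in> Obj V" "word z"
  shows "ok (EV v z)" "dm (EV v z) = v # dual v # z" "cd (EV v z) = z"
    "ok (CO v z)" "dm (CO v z) = z" "cd (CO v z) = dual v # v # z"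
  using ev_hom[OF assms(1)] coev_hom[OF assms(1)] assms by (simp_all add: EV_def CO_def)

lemma EV_move:
  assumes "v \<in> Obj V" "ok g" "cd g = w"
  shows "L v (L (dual v) g) \<bullet> EV v w = EV v (dm g) \<bullet> g"
    "L v (L (dual v) g) \<bullet> EV v w \<bullet> k = EV v (dm g) \<bullet> g \<bullet> k"
  using assms by (simp_all add: EV_def pcmp_assoc Bi_move[OF ev_hom] Dl_move)

lemma CO_move:
  assumes "v \<in> Obj V" "ok g" "cd g = w"
  shows "g \<bullet> CO v w = CO v (dm g) \<bullet> L (dual v) (L v g)"
    "g \<bullet> CO v w \<bullet> k = CO v (dm g) \<bullet> L (dual v) (L v g) \<bullet> k"
  using assms by (simp_all add: CO_def pcmp_assoc Pt_move[OF coev_hom] Sp_move)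

text \<open>These are the two duality equations tensored with \<open>z\<close>; the unitors and
  associators written out in \<open>is_dual\<close> are absorbed by inserting, deleting, splitting
  and joining letters.\<close>

lemma zigzag:
  assumes v: "v \<in> Obj V" and z: "word z"
  shows "L v (CO v z) \<bullet> EV v (v # z) = Id (v # z)"
    and "CO v (dual v # z) \<bullet> L (dual v) (EV v z) = Id (dual v # z)"
proof -
  define w where "w = dual v"
  have w: "w \<in> Obj V" using v by (simp add: w_def)
  have e: "ev v \<in> hom (v \<otimes> w) \<one>" and c: "coev v \<in> hom \<one> (w \<otimes> v)"
    using v by (simp_all add: w_def ev_hom coev_hom)
  have d: "inv (run v) \<cdot> (ide v \<odot> coev v) \<cdot> inv (asc v w v) \<cdot> (ev v \<odot> ide v) \<cdot> lun v = ide v"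
    "inv (lun w) \<cdot> (coev v \<odot> ide w) \<cdot> asc w v w \<cdot> (ide w \<odot> ev v) \<cdot> run w = ide w"
    using dual[OF v] by (simp_all add: is_dual_def w_def)
  note h = inv_hom[OF run_iso[OF v]] tarr_hom[OF ide_hom[OF v] c] inv_hom[OF asc_iso[OF v w v]]
    tarr_hom[OF e ide_hom[OF v]] iso_hom[OF lun_iso[OF v]]
  note h' = inv_hom[OF lun_iso[OF w]] tarr_hom[OF c ide_hom[OF w]] iso_hom[OF asc_iso[OF w v w]]
    tarr_hom[OF ide_hom[OF w] e] iso_hom[OF run_iso[OF w]]
  have "Id (v # z) = R (inv (run v) \<cdot> (ide v \<odot> coev v) \<cdot> inv (asc v w v) \<cdot> (ev v \<odot> ide v) \<cdot> lun v) z"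
    using v z by (simp add: d R_ide)
  also have "\<dots> = L v (CO v z) \<bullet> EV v (v # z)"
    using v w z e c
    by (simp add: R_cmp[OF cmp4_hom[OF h(1-4)] h(5)] R_cmp4[OF h(1-4)] R_inv_run R_tarr_ide_left[OF c]
        R_inv_asc R_tarr_ide_right[OF e] R_lun pcmp_assoc L_pcmp CO_def EV_def Pt_def Bi_def flip: w_def)
  finally show "L v (CO v z) \<bullet> EV v (v # z) = Id (v # z)" by simp
  have "Id (w # z) = R (inv (lun w) \<cdot> (coev v \<odot> ide w) \<cdot> asc w v w \<cdot> (ide w \<odot> ev v) \<cdot> run w) z"
    using w z by (simp add: d R_ide)
  also have "\<dots> = CO v (w # z) \<bullet> L w (EV v z)"
    using v w z e c
    by (simp add: R_cmp[OF cmp4_hom[OF h'(1-4)] h'(5)] R_cmp4[OF h'(1-4)] R_inv_lun R_tarr_ide_left[OF e]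
        R_asc R_tarr_ide_right[OF c] R_run pcmp_assoc L_pcmp CO_def EV_def Pt_def Bi_def flip: w_def)
  finally show "CO v (dual v # z) \<bullet> L (dual v) (EV v z) = Id (dual v # z)" by (simp add: w_def)
qed

lemma zigzag_chain:
  assumes v: "v \<in> Obj V" and z: "word z"
  shows "L v (CO v z) \<bullet> EV v (v # z) \<bullet> k = Id (v # z) \<bullet> k"
    and "CO v (dual v # z) \<bullet> L (dual v) (EV v z) \<bullet> k = Id (dual v # z) \<bullet> k"
  using zigzag[OF assms] by (simp_all flip: pcmp_assoc)

lemma ihom_Obj [simp]: "u \<in> Obj V \<Longrightarrow> v \<in> Obj V \<Longrightarrow> ihom u v \<in> Obj V"
  by (simp add: ihom_def)

definition Ep :: "'o \<Rightarrow> 'o \<Rightarrow> 'o list \<Rightarrow> ('o, 'm) cell" where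
  "Ep u v z = L u (Sp (dual u) v z) \<bullet> EV u (v # z)"

text \<open>Transposition for a source \<open>u # p\<close> and a target \<open>v # z\<close> with
  arbitrary tails; \<open>tl (dm h)\<close> recovers \<open>p\<close>. A nonempty \<open>z\<close>
  is possible because the internal hom is a dual tensored with \<open>v\<close>.\<close>

definition Mt :: "'o \<Rightarrow> 'o \<Rightarrow> 'o list \<Rightarrow> ('o, 'm) cell \<Rightarrow> ('o, 'm) cell" where
  "Mt u v z h = CO u (tl (dm h)) \<bullet> L (dual u) h \<bullet> Jn (dual u) v z"

lemma ok_Ep [simp]:
  assumes "u \<in> Obj V" "v \<in> Obj V" "word z"
  shows "ok (Ep u v z)" "dm (Ep u v z) = u # ihom u v # z" "cd (Ep u v z) = v # z"
  using assms by (simp_all add: Ep_def ihom_def)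

lemma ok_Mt [simp]:
  assumes "u \<in> Obj V" "v \<in> Obj V" "ok h" "dm h = u # p" "cd h = v # z"
  shows "ok (Mt u v z h)" "dm (Mt u v z h) = p" "cd (Mt u v z h) = ihom u v # z"
proof -
  have "word p" "word z" using ok_word[OF assms(3)] assms(4,5) by auto
  then show "ok (Mt u v z h)" "dm (Mt u v z h) = p" "cd (Mt u v z h) = ihom u v # z"
    using assms by (simp_all add: Mt_def ihom_def)
qed

lemma Ep_move:
  assumes "u \<in> Obj V" "v \<in> Obj V" "ok g" "cd g = w"
  shows "L u (L (ihom u v) g) \<bullet> Ep u v w = Ep u v (dm g) \<bullet> L v g"
    "L u (L (ihom u v) g) \<bullet> Ep u v w \<bullet> k = Ep u v (dm g) \<bullet> L v g \<bullet> k"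
proof -
  have "word (dm g)" "word w" using ok_word[OF assms(3)] assms(4) by auto
  then show "L u (L (ihom u v) g) \<bullet> Ep u v w = Ep u v (dm g) \<bullet> L v g"
    using assms by (simp add: Ep_def ihom_def pcmp_assoc L_move[OF Sp_move(1)] L_pcmp EV_move)
  then show "L u (L (ihom u v) g) \<bullet> Ep u v w \<bullet> k = Ep u v (dm g) \<bullet> L v g \<bullet> k"
    by (simp flip: pcmp_assoc)
qed

lemma L_Mt_Ep:
  assumes "u \<in> Obj V" "v \<in> Obj V" "ok h" "dm h = u # p" "cd h = v # z"
  shows "L u (Mt u v z h) \<bullet> Ep u v z = h"
proof -
  have "word p" "word z" using ok_word[OF assms(3)] assms(4,5) by auto
  then show ?thesis
    using assms by (simp add: Mt_def Ep_def pcmp_assoc L_pcmp EV_move zigzag_chain)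
qed

text \<open>Sliding \<open>f\<close> past the coevaluation leaves the second zigzag equation, up to
  splitting and joining the letter of the internal hom.\<close>

lemma Mt_L_Ep:
  assumes "u \<in> Obj V" "v \<in> Obj V" "ok f" "cd f = ihom u v # z"
  shows "Mt u v z (L u f \<bullet> Ep u v z) = f"
proof -
  have "word (dm f)" "word z" using ok_word[OF assms(3)] assms(4) by auto
  then show ?thesis using assms
    CO_move(2)[OF assms(1,3,4), of "L (dual u) (Ep u v z) \<bullet> Jn (dual u) v z"]
    CO_move(2)[OF assms(1), of "Sp (dual u) v z" "dual u # v # z"
        "L (dual u) (EV u (v # z)) \<bullet> Jn (dual u) v z", symmetric]
    by (simp add: Mt_def pcmp_assoc L_pcmp Ep_def ihom_def zigzag_chain)
qed

text \<open>Evaluation is injective on cells since transposition undoes it. All equations between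
  cells into an internal hom are reduced by this rule.\<close>

lemma Ep_cancel:
  assumes "L u f \<bullet> Ep u v z = L u g \<bullet> Ep u v z" "u \<in> Obj V" "v \<in> Obj V"
    "ok f" "cd f = ihom u v # z" "ok g" "cd g = ihom u v # z"
  shows "f = g"
  using assms Mt_L_Ep by metis

lemma eps_hom: "u \<in> Obj V \<Longrightarrow> v \<in> Obj V \<Longrightarrow> eps u v \<in> hom (u \<otimes> ihom u v) v"
  unfolding eps_def ihom_def
  by (rule cmp3_hom[OF inv_hom[OF asc_iso] tarr_hom[OF ev_hom ide_hom] iso_hom[OF lun_iso]]) simp_all

lemma Bi_eps:
  assumes "u \<in> Obj V" "v \<in> Obj V" "word z"
  shows "Bi u (ihom u v) (eps u v) z = Ep u v z"
proof -
  note h = inv_hom[OF asc_iso[OF assms(1) dual_Obj[OF assms(1)] assms(2)]]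
    tarr_hom[OF ev_hom[OF assms(1)] ide_hom[OF assms(2)]] iso_hom[OF lun_iso[OF assms(2)]]
  show ?thesis using assms ev_hom[OF assms(1)] unfolding eps_def
    by (simp add: Bi_def[of u "ihom u v"] R_cmp3[OF h] R_inv_asc R_tarr_ide_right[OF ev_hom] R_lun ihom_def
      Ep_def EV_def Bi_def pcmp_assoc)
qed

text \<open>The explicit formula for \<open>mate\<close> is opened only here; afterwards a mate
  enters through its equation with the universal cell \<open>Ep\<close>.\<close>

lemma
  assumes f: "f \<in> hom (u \<otimes> w) v" and ob: "u \<in> Obj V" "w \<in> Obj V" "v \<in> Obj V"
  shows mate_hom: "mate u w f \<in> hom w (ihom u v)"
    and L_mate_Ep: "word z \<Longrightarrow> L u (R (mate u w f) z) \<bullet> Ep u v z = Bi u w f z"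
proof -
  note d = dual_Obj[OF ob(1)]
  note h = inv_hom[OF lun_iso[OF ob(2)]] tarr_hom[OF coev_hom[OF ob(1)] ide_hom[OF ob(2)]]
    iso_hom[OF asc_iso[OF d ob(1,2)]] tarr_hom[OF ide_hom[OF d] f]
  show "mate u w f \<in> hom w (ihom u v)"
    unfolding mate_def ihom_def by (rule cmp4_hom[OF h])
  assume z: "word z"
  have "R (mate u w f) z = Mt u v z (Bi u w f z)"
    using ob d z f coev_hom[OF ob(1)] unfolding mate_def
    by (simp add: R_cmp4[OF h] R_inv_lun R_tarr_ide_right[OF coev_hom] R_asc R_tarr_ide_left[OF f]
      Mt_def CO_def Pt_def Bi_def pcmp_assoc L_pcmp)
  then show "L u (R (mate u w f) z) \<bullet> Ep u v z = Bi u w f z"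
    using ob z f by (simp add: L_Mt_Ep[where p = "w # z"])
qed

end

context rigid_monoidal_category
begin

lemma R_eps: "u \<in> Obj V \<Longrightarrow> v \<in> Obj V \<Longrightarrow> word z \<Longrightarrow> R (eps u v) z = Sp u (ihom u v) z \<bullet> Ep u v z"
  using R_Bi[OF eps_hom] by (simp add: Bi_eps)

lemma L_mate_Ep_chain:
  assumes "f \<in> hom (u \<otimes> w) v" "u \<in> Obj V" "w \<in> Obj V" "v \<in> Obj V" "word z"
  shows "L u (R (mate u w f) z) \<bullet> Ep u v z \<bullet> k = Bi u w f z \<bullet> k"
  using L_mate_Ep[OF assms] by (rule chain)

section \<open>The self-enrichment and the representable functors\<close>

lemma self_enriched_simps [simp]:
  "VObj self_enriched = Obj V" "VHom self_enriched = ihom"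
  by (simp_all add: self_enriched_def)

lemma
  assumes "u \<in> Obj V" "v \<in> Obj V" "w \<in> Obj V"
  shows self_VCmp_hom: "VCmp self_enriched u v w \<in> hom (ihom u v \<otimes> ihom v w) (ihom u w)"
    and L_self_M_Ep: "word z \<Longrightarrow> L u (M self_enriched u v w z) \<bullet> Ep u w z = Ep u v (ihom v w # z) \<bullet> Ep v w z"
proof -
  note h = tarr_hom[OF eps_hom[OF assms(1,2)] ide_hom[OF ihom_Obj[OF assms(2,3)]]] eps_hom[OF assms(2,3)]
  \<comment> \<open>Composition in V associates to the left, whereas \<open>Bi_inv_asc\<close>
    expects the inverse associator as a separate first factor.\<close>
  have e: "inv (asc u (ihom u v) (ihom v w)) \<cdot> (eps u v \<odot> ide (ihom v w)) \<cdot> eps v w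
    = inv (asc u (ihom u v) (ihom v w)) \<cdot> ((eps u v \<odot> ide (ihom v w)) \<cdot> eps v w)"
    using assms by (intro cmp_assoc[OF inv_hom[OF asc_iso] h]) simp_all
  have t: "(inv (asc u (ihom u v) (ihom v w)) \<cdot> ((eps u v \<odot> ide (ihom v w)) \<cdot> eps v w))
      \<in> hom (u \<otimes> ihom u v \<otimes> ihom v w) w"
    using Bi_inv_asc(2)[OF cmp_hom[OF h]] assms by simp
  show "VCmp self_enriched u v w \<in> hom (ihom u v \<otimes> ihom v w) (ihom u w)"
    using mate_hom[OF t] assms by (simp add: self_enriched_def e)
  show "word z \<Longrightarrow> L u (M self_enriched u v w z) \<bullet> Ep u w z = Ep u v (ihom v w # z) \<bullet> Ep v w z"
    using assms
    by (simp add: M_def Bi_def[of "ihom u v"] L_pcmp pcmp_assoc)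
      (simp add: self_enriched_def e L_mate_Ep[OF t] Bi_inv_asc(1)[OF cmp_hom[OF h]]
        R_cmp[OF h] R_tarr_ide_right[OF eps_hom] R_eps pcmp_assoc)
qed

lemma
  assumes "u \<in> Obj V"
  shows self_VIde_hom: "VIde self_enriched u \<in> hom \<one> (ihom u u)"
    and L_self_J_Ep: "word z \<Longrightarrow> L u (J self_enriched u z) \<bullet> Ep u u z = Id (u # z)"
proof -
  note r = iso_hom[OF run_iso[OF assms]]
  show "VIde self_enriched u \<in> hom \<one> (ihom u u)"
    using mate_hom[OF r] assms by (simp add: self_enriched_def)
  show "word z \<Longrightarrow> L u (J self_enriched u z) \<bullet> Ep u u z = Id (u # z)"
    using assms by (simp add: J_def Pt_def L_pcmp pcmp_assoc self_enriched_def L_mate_Ep[OF r] Bi_def R_run)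
qed

lemma L_self_chain:
  assumes "u \<in> Obj V" "v \<in> Obj V" "w \<in> Obj V" "word z"
  shows "L u (M self_enriched u v w z) \<bullet> Ep u w z \<bullet> k = Ep u v (ihom v w # z) \<bullet> Ep v w z \<bullet> k"
  using L_self_M_Ep[OF assms] by (simp flip: pcmp_assoc)

lemma L_self_J_chain:
  "u \<in> Obj V \<Longrightarrow> word z \<Longrightarrow> L u (J self_enriched u z) \<bullet> Ep u u z \<bullet> k = Id (u # z) \<bullet> k"
  using L_self_J_Ep by (simp flip: pcmp_assoc)

text \<open>After \<open>Ep_cancel\<close>, composition becomes repeated evaluation and an identity
  becomes nothing, so the axioms reduce to interchange.\<close>

lemma vcategory_self_enriched [simp]: "vcategory self_enriched"
proof (rule vcategoryI)
  have t: "ok (M self_enriched u v w z)" "dm (M self_enriched u v w z) = ihom u v # ihom v w # z"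
    "cd (M self_enriched u v w z) = ihom u w # z"
    if "u \<in> Obj V" "v \<in> Obj V" "w \<in> Obj V" "word z" for u v w z
    using ok_Bi[OF self_VCmp_hom[OF that(1-3)]] that by (simp_all add: M_def)
  have t': "ok (J self_enriched u z)" "dm (J self_enriched u z) = z" "cd (J self_enriched u z) = ihom u u # z"
    if "u \<in> Obj V" "word z" for u z
    using ok_Pt[OF self_VIde_hom[OF that(1)] that(2)] by (simp_all add: J_def)
  note s = t t' L_self_chain L_self_J_chain L_self_M_Ep L_self_J_Ep Ep_move L_pcmp pcmp_assoc
  show "M self_enriched a b c [VHom self_enriched c d] \<bullet> M self_enriched a c d []
      = L (VHom self_enriched a b) (M self_enriched b c d []) \<bullet> M self_enriched a b d []"
    if "a \<in> VObj self_enriched" "b \<in> VObj self_enriched" "c \<in> VObj self_enriched" "d \<in> VObj self_enriched"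
    for a b c d
    by (rule Ep_cancel[where u = a and v = d and z = "[]"]) (use that in \<open>simp_all add: s\<close>)
  show "J self_enriched a [VHom self_enriched a b] \<bullet> M self_enriched a a b [] = Id [VHom self_enriched a b]"
    if "a \<in> VObj self_enriched" "b \<in> VObj self_enriched" for a b
    by (rule Ep_cancel[where u = a and v = b and z = "[]"]) (use that in \<open>simp_all add: s L_Id\<close>)
  show "L (VHom self_enriched a b) (J self_enriched b []) \<bullet> M self_enriched a b b [] = Id [VHom self_enriched a b]"
    if "a \<in> VObj self_enriched" "b \<in> VObj self_enriched" for a b
    by (rule Ep_cancel[where u = a and v = b and z = "[]"]) (use that in \<open>simp_all add: s L_Id\<close>)
qed (simp_all add: self_VCmp_hom self_VIde_hom)

lemma
  assumes "vcategory C" "a \<in> VObj C" "b \<in> VObj C" "c \<in> VObj C"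
  shows representable_FHom_hom: "FHom (representable C a) b c \<in> hom (VHom C b c) (ihom (VHom C a b) (VHom C a c))"
    and L_representable_Ep: "word z \<Longrightarrow> L (VHom C a b) (R (FHom (representable C a) b c) z)
      \<bullet> Ep (VHom C a b) (VHom C a c) z = M C a b c z"
    and L_representable_Ep_chain: "word z \<Longrightarrow> L (VHom C a b) (R (FHom (representable C a) b c) z)
      \<bullet> Ep (VHom C a b) (VHom C a c) z \<bullet> k = M C a b c z \<bullet> k"
  using mate_hom[OF VCmp_hom[OF assms]] L_mate_Ep[OF VCmp_hom[OF assms]] L_mate_Ep_chain[OF VCmp_hom[OF assms]] assms
  by (simp_all add: representable_def M_def)

lemma representable_FObj [simp]: "FObj (representable C a) b = VHom C a b"
  by (simp add: representable_def)

text \<open>Read through \<open>Ep\<close>, preservation of composition is associativity in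
  \<open>C\<close>, and preservation of identities is its right unit law.\<close>

lemma vfunctor_representable:
  assumes C: "vcategory C" and a: "a \<in> VObj C"
  shows "vfunctor C self_enriched (representable C a)"
proof (rule vfunctorI)
  note r = representable_FHom_hom[OF C a] ok_R[OF representable_FHom_hom[OF C a]]
  note e = L_representable_Ep[OF C a] L_representable_Ep_chain[OF C a]
  show "J C b [] \<bullet> R (FHom (representable C a) b b) [] = J self_enriched (FObj (representable C a) b) []"
    if b: "b \<in> VObj C" for b
    by (rule Ep_cancel[where u = "VHom C a b" and v = "VHom C a b" and z = "[]"])
      (use C a b in \<open>simp_all add: r L_pcmp pcmp_assoc e L_J_M L_self_J_Ep\<close>)
  show "M C b c d [] \<bullet> R (FHom (representable C a) b d) [] = L (VHom C b c) (R (FHom (representable C a) c d) [])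
      \<bullet> R (FHom (representable C a) b c) [VHom self_enriched (FObj (representable C a) c) (FObj (representable C a) d)]
      \<bullet> M self_enriched (FObj (representable C a) b) (FObj (representable C a) c) (FObj (representable C a) d) []"
    if o: "b \<in> VObj C" "c \<in> VObj C" "d \<in> VObj C" for b c d
    by (rule Ep_cancel[where u = "VHom C a b" and v = "VHom C a d" and z = "[]"])
      (use C a o in \<open>simp_all add: r L_pcmp pcmp_assoc e M_assoc[symmetric] L_self_M_Ep L_self_chain M_move\<close>)
qed (use C a in \<open>simp_all add: representable_FHom_hom\<close>)

end

section \<open>The completion\<close>

locale rigid_vcategory = rigid_monoidal_category V
  for V :: "('o, 'm, 'z) rigid_scheme" +
  fixes C :: "('c, 'o, 'm) vcat"
  assumes C [simp]: "vcategory C"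
begin

abbreviation K :: "'c \<Rightarrow> 'o \<Rightarrow> 'c \<Rightarrow> 'o \<Rightarrow> 'o" where
  "K a u b v \<equiv> ihom u (VHom C a b \<otimes> v)"

text \<open>The final \<open>Sp\<close> keeps the hom object of \<open>C\<close> and
  \<open>v\<close> as separate letters, so that a further evaluation at \<open>v\<close> and the
  composition \<open>M C\<close> apply to them directly.\<close>

definition E :: "'c \<Rightarrow> 'o \<Rightarrow> 'c \<Rightarrow> 'o \<Rightarrow> 'o list \<Rightarrow> ('o, 'm) cell" where
  "E a u b v z = Ep u (VHom C a b \<otimes> v) z \<bullet> Sp (VHom C a b) v z"

lemma ok_E [simp]:
  assumes "a \<in> VObj C" "b \<in> VObj C" "u \<in> Obj V" "v \<in> Obj V" "word z"
  shows "ok (E a u b v z)" "dm (E a u b v z) = u # K a u b v # z" "cd (E a u b v z) = VHom C a b # v # z"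
  using assms by (simp_all add: E_def)

lemma E_move:
  assumes "a \<in> VObj C" "b \<in> VObj C" "u \<in> Obj V" "v \<in> Obj V" "ok g" "cd g = w"
  shows "L u (L (K a u b v) g) \<bullet> E a u b v w = E a u b v (dm g) \<bullet> L (VHom C a b) (L v g)"
    "L u (L (K a u b v) g) \<bullet> E a u b v w \<bullet> k = E a u b v (dm g) \<bullet> L (VHom C a b) (L v g) \<bullet> k"
  using assms by (simp_all add: E_def pcmp_assoc Ep_move Sp_move)

lemma E_cancel:
  assumes "L u f \<bullet> E a u b v z = L u g \<bullet> E a u b v z"
    "a \<in> VObj C" "b \<in> VObj C" "u \<in> Obj V" "v \<in> Obj V"
    "ok f" "cd f = K a u b v # z" "ok g" "cd g = K a u b v # z"
  shows "f = g"
proof (rule Ep_cancel)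
  have z: "word z" using ok_word(2)[OF assms(6)] assms(7) by simp
  have "(L u f \<bullet> Ep u (VHom C a b \<otimes> v) z) \<bullet> Sp (VHom C a b) v z = (L u g \<bullet> Ep u (VHom C a b \<otimes> v) z) \<bullet> Sp (VHom C a b) v z"
    using assms(1) by (simp add: E_def pcmp_assoc)
  then show "L u f \<bullet> Ep u (VHom C a b \<otimes> v) z = L u g \<bullet> Ep u (VHom C a b \<otimes> v) z"
    using right_cancel[OF Sp_Jn[of "VHom C a b" v z]] assms z by simp
qed (use assms in simp_all)

lemma completion_simps [simp]:
  "VObj (completion C) = VObj C \<times> Obj V" "VHom (completion C) (a, u) (b, v) = K a u b v"
  by (simp_all add: completion_def)

text \<open>The associators in the definition of the composition cancel against splittings and
  joinings. What remains is to evaluate the first factor, evaluate the second beneath the letter C(a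
  -> b), and compose in \<open>C\<close>.\<close>

lemma
  assumes "a \<in> VObj C" "b \<in> VObj C" "c \<in> VObj C" "u \<in> Obj V" "v \<in> Obj V" "w \<in> Obj V"
  shows completion_VCmp_hom:
      "VCmp (completion C) (a, u) (b, v) (c, w) \<in> hom (K a u b v \<otimes> K b v c w) (K a u c w)"
    and L_completion_M_E: "word z \<Longrightarrow> L u (M (completion C) (a, u) (b, v) (c, w) z) \<bullet> E a u c w z
      = E a u b v (K b v c w # z) \<bullet> L (VHom C a b) (E b v c w z) \<bullet> M C a b c (w # z)"
proof -
  define X Y where XY: "X = K a u b v" "Y = K b v c w"
  have ob: "X \<in> Obj V" "Y \<in> Obj V" "VHom C a b \<in> Obj V" "VHom C b c \<in> Obj V" "VHom C a c \<in> Obj V"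
    using assms by (simp_all add: XY)
  have eps1: "eps u (VHom C a b \<otimes> v) \<in> hom (u \<otimes> X) (VHom C a b \<otimes> v)"
    and eps2: "eps v (VHom C b c \<otimes> w) \<in> hom (v \<otimes> Y) (VHom C b c \<otimes> w)"
    using assms by (simp_all add: XY eps_hom)
  have c: "VCmp C a b c \<in> hom (VHom C a b \<otimes> VHom C b c) (VHom C a c)" using assms by simp
  note h = inv_hom[OF asc_iso[OF assms(4) ob(1,2)]] tarr_hom[OF eps1 ide_hom[OF ob(2)]]
    iso_hom[OF asc_iso[OF ob(3) assms(5) ob(2)]] tarr_hom[OF ide_hom[OF ob(3)] eps2]
    inv_hom[OF asc_iso[OF ob(3,4) assms(6)]] tarr_hom[OF c ide_hom[OF assms(6)]]
  define f where "f = inv (asc u X Y) \<cdot> (eps u (VHom C a b \<otimes> v) \<odot> ide Y) \<cdot> asc (VHom C a b) v Y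
         \<cdot> (ide (VHom C a b) \<odot> eps v (VHom C b c \<otimes> w)) \<cdot> inv (asc (VHom C a b) (VHom C b c) w)
         \<cdot> (VCmp C a b c \<odot> ide w)"
  have d: "VCmp (completion C) (a, u) (b, v) (c, w) = mate u (X \<otimes> Y) f"
    by (simp add: completion_def f_def XY Let_def)
  have f: "f \<in> hom (u \<otimes> X \<otimes> Y) (VHom C a c \<otimes> w)"
    unfolding f_def by (rule cmp_hom[OF cmp_hom[OF cmp4_hom[OF h(1-4)] h(5)] h(6)])
  show "VCmp (completion C) (a, u) (b, v) (c, w) \<in> hom (K a u b v \<otimes> K b v c w) (K a u c w)"
    using mate_hom[OF f] assms ob by (simp add: d flip: XY)
  assume z: "word z"
  have e: "R (eps u (VHom C a b \<otimes> v)) z = Sp u X z \<bullet> Ep u (VHom C a b \<otimes> v) z"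
    "R (eps v (VHom C b c \<otimes> w)) z = Sp v Y z \<bullet> Ep v (VHom C b c \<otimes> w) z" if "word z" for z
    using assms ob that by (simp_all add: R_eps XY)
  have ep: "ok (Ep u (VHom C a b \<otimes> v) z)" "dm (Ep u (VHom C a b \<otimes> v) z) = u # X # z"
    "cd (Ep u (VHom C a b \<otimes> v) z) = (VHom C a b \<otimes> v) # z"
    "ok (Ep v (VHom C b c \<otimes> w) z)" "dm (Ep v (VHom C b c \<otimes> w) z) = v # Y # z"
    "cd (Ep v (VHom C b c \<otimes> w) z) = (VHom C b c \<otimes> w) # z" if "word z" for z
    using assms ob that by (simp_all add: XY)
  have "L u (M (completion C) (a, u) (b, v) (c, w) z) \<bullet> Ep u (VHom C a c \<otimes> w) z \<bullet> Sp (VHom C a c) w z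
    = L u (Jn X Y z) \<bullet> Bi u (X \<otimes> Y) f z \<bullet> Sp (VHom C a c) w z"
    using assms ob z L_mate_Ep_chain[OF f, of z "Sp (VHom C a c) w z"]
    by (simp add: M_def Bi_def[of X Y] L_pcmp pcmp_assoc d flip: XY)
  also have "\<dots> = Ep u (VHom C a b \<otimes> v) (Y # z) \<bullet> Sp (VHom C a b) v (Y # z)
    \<bullet> L (VHom C a b) (Ep v (VHom C b c \<otimes> w) z) \<bullet> L (VHom C a b) (Sp (VHom C b c) w z) \<bullet> M C a b c (w # z)"
    unfolding Bi_def f_def
    using assms ob z c
    by (simp add: R_cmp[OF cmp_hom[OF cmp4_hom[OF h(1-4)] h(5)] h(6)] R_cmp[OF cmp4_hom[OF h(1-4)] h(5)]
      R_cmp4[OF h(1-4)] R_inv_asc R_asc R_tarr_ide_right[OF eps1] R_tarr_ide_left[OF eps2] R_tarr_ide_right[OF c]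
      e ep ok_R[OF c] L_pcmp pcmp_assoc M_def Bi_def del: ok_Ep)
  finally show "L u (M (completion C) (a, u) (b, v) (c, w) z) \<bullet> E a u c w z
      = E a u b v (K b v c w # z) \<bullet> L (VHom C a b) (E b v c w z) \<bullet> M C a b c (w # z)"
    by (simp add: E_def XY L_pcmp pcmp_assoc)
qed

lemma
  assumes "a \<in> VObj C" "u \<in> Obj V"
  shows completion_VIde_hom: "VIde (completion C) (a, u) \<in> hom \<one> (K a u a u)"
    and L_completion_J_E: "word z \<Longrightarrow> L u (J (completion C) (a, u) z) \<bullet> E a u a u z = J C a (u # z)"
proof -
  have i: "VIde C a \<in> hom \<one> (VHom C a a)" using assms by simp
  note h = iso_hom[OF run_iso[OF assms(2)]] inv_hom[OF lun_iso[OF assms(2)]] tarr_hom[OF i ide_hom[OF assms(2)]]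
  have d: "VIde (completion C) (a, u) = mate u \<one> (run u \<cdot> inv (lun u) \<cdot> (VIde C a \<odot> ide u))"
    by (simp add: completion_def)
  show "VIde (completion C) (a, u) \<in> hom \<one> (K a u a u)"
    using mate_hom[OF cmp3_hom[OF h]] assms by (simp add: d)
  show "word z \<Longrightarrow> L u (J (completion C) (a, u) z) \<bullet> E a u a u z = J C a (u # z)"
    using assms i unfolding J_def d E_def
    by (simp add: Pt_def L_pcmp pcmp_assoc L_mate_Ep_chain[OF cmp3_hom[OF h]] Bi_def R_cmp3[OF h] R_run
      R_inv_lun R_tarr_ide_right[OF i] ok_R[OF i])
qed

lemma L_completion_chain:
  assumes "a \<in> VObj C" "b \<in> VObj C" "c \<in> VObj C" "u \<in> Obj V" "v \<in> Obj V" "w \<in> Obj V" "word z"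
  shows "L u (M (completion C) (a, u) (b, v) (c, w) z) \<bullet> E a u c w z \<bullet> k
      = E a u b v (K b v c w # z) \<bullet> L (VHom C a b) (E b v c w z) \<bullet> M C a b c (w # z) \<bullet> k"
  using chain[OF L_completion_M_E[OF assms]] by (simp add: pcmp_assoc)

lemma L_completion_J_chain:
  assumes "a \<in> VObj C" "u \<in> Obj V" "word z"
  shows "L u (J (completion C) (a, u) z) \<bullet> E a u a u z \<bullet> k = J C a (u # z) \<bullet> k"
  using chain[OF L_completion_J_E[OF assms]] .

text \<open>\<open>J_move\<close> in the opposite direction, for carrying an identity to the right
  until it meets the composition that cancels it.\<close>

lemma J_back:
  assumes "a \<in> VObj C" "ok g" "dm g = z"
  shows "J C a z \<bullet> L (VHom C a a) g = g \<bullet> J C a (cd g)"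
    "J C a z \<bullet> L (VHom C a a) g \<bullet> k = g \<bullet> J C a (cd g) \<bullet> k"
  using J_move[OF C assms(1,2)] assms(3) by simp_all

text \<open>By \<open>E_cancel\<close> each axiom becomes an equation between iterated evaluations,
  closed by the same axiom of \<open>C\<close> at a nonempty tail, namely the second component of
  the last object.\<close>

lemma vcategory_completion [simp]: "vcategory (completion C)"
proof (rule vcategoryI, goal_cases)
  have t: "ok (M (completion C) (a, u) (b, v) (c, w) z)"
    "dm (M (completion C) (a, u) (b, v) (c, w) z) = K a u b v # K b v c w # z"
    "cd (M (completion C) (a, u) (b, v) (c, w) z) = K a u c w # z"
    if "a \<in> VObj C" "b \<in> VObj C" "c \<in> VObj C" "u \<in> Obj V" "v \<in> Obj V" "w \<in> Obj V" "word z" for a u b v c w z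
    using ok_Bi[OF completion_VCmp_hom[OF that(1-6)]] that by (simp_all add: M_def)
  have t': "ok (J (completion C) (a, u) z)" "dm (J (completion C) (a, u) z) = z"
    "cd (J (completion C) (a, u) z) = K a u a u # z"
    if "a \<in> VObj C" "u \<in> Obj V" "word z" for a u z
    using ok_Pt[OF completion_VIde_hom[OF that(1,2)]] that by (simp_all add: J_def)
  note s = t t' L_completion_chain L_completion_J_chain L_completion_M_E L_completion_J_E L_pcmp pcmp_assoc
  {
    case (4 a b c d)
    obtain a' u b' v c' w d' x where e: "a = (a', u)" "b = (b', v)" "c = (c', w)" "d = (d', x)" by (metis surj_pair)
    show ?case
      unfolding e
    by (rule E_cancel[where a = a' and u = u and b = d' and v = x and z = "[]"])
      (use 4[unfolded e] in \<open>simp_all add: s E_move M_move M_assoc[symmetric] L_move[OF E_move(1)] L_move[OF L_completion_M_E]\<close>)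
  next
    case (5 a b)
    obtain a' u b' v where e: "a = (a', u)" "b = (b', v)" by (metis surj_pair)
    show ?case
      unfolding e
    by (rule E_cancel[where a = a' and u = u and b = b' and v = v and z = "[]"])
      (use 5[unfolded e] in \<open>simp_all add: s L_Id J_back J_M\<close>)
  next
    case (6 a b)
    obtain a' u b' v where e: "a = (a', u)" "b = (b', v)" by (metis surj_pair)
    show ?case
      unfolding e
    by (rule E_cancel[where a = a' and u = u and b = b' and v = v and z = "[]"])
      (use 6[unfolded e] in \<open>simp_all add: s L_Id E_move L_move[OF L_completion_J_E] L_J_M\<close>)
  }
qed (auto simp: completion_VCmp_hom completion_VIde_hom)

section \<open>The tensoring of the completion\<close>

lemma completion_tensoring_FObj [simp]: "FObj (LTens (completion_tensoring C) (a, u)) v = (a, u \<otimes> v)"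
  by (simp add: completion_tensoring_def)

lemma
  assumes "a \<in> VObj C" "u \<in> Obj V" "v \<in> Obj V" "w \<in> Obj V"
  shows completion_LTens_hom:
      "FHom (LTens (completion_tensoring C) (a, u)) v w \<in> hom (ihom v w) (K a (u \<otimes> v) a (u \<otimes> w))"
    and L_completion_LTens_E: "word z \<Longrightarrow>
      L (u \<otimes> v) (R (FHom (LTens (completion_tensoring C) (a, u)) v w) z) \<bullet> E a (u \<otimes> v) a (u \<otimes> w) z
      = Sp u v (ihom v w # z) \<bullet> L u (Ep v w z) \<bullet> Jn u w z \<bullet> J C a ((u \<otimes> w) # z)"
proof -
  have i: "VIde C a \<in> hom \<one> (VHom C a a)" using assms by simp
  have uw: "u \<otimes> w \<in> Obj V" using assms by simp
  note h = iso_hom[OF asc_iso[OF assms(2,3) ihom_Obj[OF assms(3,4)]]]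
    tarr_hom[OF ide_hom[OF assms(2)] eps_hom[OF assms(3,4)]]
    inv_hom[OF lun_iso[OF uw]] tarr_hom[OF i ide_hom[OF uw]]
  define f where "f = asc u v (ihom v w) \<cdot> (ide u \<odot> eps v w) \<cdot> inv (lun (u \<otimes> w)) \<cdot> (VIde C a \<odot> ide (u \<otimes> w))"
  have f: "f \<in> hom ((u \<otimes> v) \<otimes> ihom v w) (VHom C a a \<otimes> u \<otimes> w)"
    unfolding f_def by (rule cmp4_hom[OF h])
  have d: "FHom (LTens (completion_tensoring C) (a, u)) v w = mate (u \<otimes> v) (ihom v w) f"
    by (simp add: completion_tensoring_def f_def)
  show "FHom (LTens (completion_tensoring C) (a, u)) v w \<in> hom (ihom v w) (K a (u \<otimes> v) a (u \<otimes> w))"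
    using mate_hom[OF f] assms by (simp add: d)
  show "word z \<Longrightarrow>
      L (u \<otimes> v) (R (FHom (LTens (completion_tensoring C) (a, u)) v w) z) \<bullet> E a (u \<otimes> v) a (u \<otimes> w) z
      = Sp u v (ihom v w # z) \<bullet> L u (Ep v w z) \<bullet> Jn u w z \<bullet> J C a ((u \<otimes> w) # z)"
    using assms
    by (simp add: d E_def L_mate_Ep_chain[OF f])
      (simp add: f_def Bi_def R_cmp4[OF h] R_asc R_tarr_ide_left[OF eps_hom] R_eps L_pcmp R_inv_lun
        R_tarr_ide_right[OF i] ok_R[OF i] J_def Pt_def pcmp_assoc)
qed

text \<open>The currying isomorphism is the mate of a mate, so it is undone by evaluating at
  \<open>v\<close> beneath \<open>u\<close> and then at \<open>u\<close>; together these amount to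
  one evaluation at \<open>u \<otimes> v\<close>.\<close>

lemma
  assumes "a \<in> VObj C" "b \<in> VObj C" "u \<in> Obj V" "v \<in> Obj V" "w \<in> Obj V"
  shows completion_TIso_hom: "TIso (completion_tensoring C) (a, u) v (b, w)
      \<in> hom (K a (u \<otimes> v) b w) (ihom v (K a u b w))"
    and L_completion_TIso_Ep: "word z \<Longrightarrow>
      L u (L v (R (TIso (completion_tensoring C) (a, u) v (b, w)) z)) \<bullet> L u (Ep v (K a u b w) z)
        \<bullet> E a u b w z = Jn u v (K a (u \<otimes> v) b w # z) \<bullet> E a (u \<otimes> v) b w z"
proof -
  define x where "x = VHom C a b \<otimes> w"
  have x: "x \<in> Obj V" and uv: "u \<otimes> v \<in> Obj V" using assms by (simp_all add: x_def)
  note e = eps_hom[OF uv x] and i = ihom_Obj[OF uv x]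
  define g where "g = inv (asc u v (ihom (u \<otimes> v) x)) \<cdot> eps (u \<otimes> v) x"
  have g: "g \<in> hom (u \<otimes> v \<otimes> ihom (u \<otimes> v) x) x"
    unfolding g_def by (rule Bi_inv_asc(2)[OF e assms(3,4) i])
  have gm: "mate u (v \<otimes> ihom (u \<otimes> v) x) g \<in> hom (v \<otimes> ihom (u \<otimes> v) x) (ihom u x)"
    using mate_hom[OF g] assms x uv by simp
  have d: "TIso (completion_tensoring C) (a, u) v (b, w)
    = mate v (ihom (u \<otimes> v) x) (mate u (v \<otimes> ihom (u \<otimes> v) x) g)"
    by (simp add: completion_tensoring_def g_def x_def Let_def)
  show "TIso (completion_tensoring C) (a, u) v (b, w) \<in> hom (K a (u \<otimes> v) b w) (ihom v (K a u b w))"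
    using mate_hom[OF gm] assms x uv by (simp add: d flip: x_def)
  assume z: "word z"
  have "L u (Jn v (ihom (u \<otimes> v) x) z) \<bullet> Bi u (v \<otimes> ihom (u \<otimes> v) x) g z \<bullet> k
    = Jn u v (ihom (u \<otimes> v) x # z) \<bullet> Ep (u \<otimes> v) x z \<bullet> k" for k
    using chain[OF Bi_inv_asc(1)[OF e assms(3,4) i z]] uv x assms z
    by (simp add: g_def pcmp_assoc R_eps)
  then show "L u (L v (R (TIso (completion_tensoring C) (a, u) v (b, w)) z)) \<bullet> L u (Ep v (K a u b w) z)
        \<bullet> E a u b w z = Jn u v (K a (u \<otimes> v) b w # z) \<bullet> E a (u \<otimes> v) b w z"
    using assms x uv z
    by (simp add: d E_def L_move[OF L_mate_Ep[OF gm]] Bi_def[of v] L_pcmp pcmp_assoc L_mate_Ep_chain[OF g]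
      flip: x_def)
qed

lemma double_cancel:
  assumes "L u (L v f) \<bullet> L u (Ep v (K a u b w) z) \<bullet> E a u b w z
      = L u (L v g) \<bullet> L u (Ep v (K a u b w) z) \<bullet> E a u b w z"
    "a \<in> VObj C" "b \<in> VObj C" "u \<in> Obj V" "v \<in> Obj V" "w \<in> Obj V"
    "ok f" "cd f = ihom v (K a u b w) # z" "ok g" "cd g = ihom v (K a u b w) # z"
  shows "f = g"
proof (rule Ep_cancel)
  have z: "word z" using ok_word(2)[OF assms(7)] assms(8) by simp
  show "L v f \<bullet> Ep v (K a u b w) z = L v g \<bullet> Ep v (K a u b w) z"
    by (rule E_cancel[of u _ a b w z]) (use assms z in \<open>simp_all add: L_pcmp pcmp_assoc\<close>)
qed (use assms in simp_all)

lemma completion_TIso_iso: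
  assumes o: "a \<in> VObj C" "b \<in> VObj C" "u \<in> Obj V" "v \<in> Obj V" "w \<in> Obj V"
  shows "TIso (completion_tensoring C) (a, u) v (b, w) \<in> iso (K a (u \<otimes> v) b w) (ihom v (K a u b w))"
proof (rule isoI_R[OF completion_TIso_hom[OF o]])
  let ?x = "VHom C a b \<otimes> w"
  \<comment> \<open>The inverse uncurries: split \<open>u \<otimes> v\<close>, evaluate at
    \<open>v\<close> beneath \<open>u\<close>, then at \<open>u\<close>. Its mate is
    \<open>?y\<close>.\<close>
  let ?h = "Sp u v [ihom v (K a u b w)] \<bullet> L u (Ep v (K a u b w) []) \<bullet> Ep u ?x []"
  let ?y = "Mt (u \<otimes> v) ?x [] ?h"
  note t = completion_TIso_hom[OF o] ok_R[OF completion_TIso_hom[OF o]]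
  note e = L_completion_TIso_Ep[OF o]
  have h: "ok ?h" "dm ?h = [u \<otimes> v, ihom v (K a u b w)]" "cd ?h = [?x]" using o by simp_all
  have y: "ok ?y" "dm ?y = [ihom v (K a u b w)]" "cd ?y = [K a (u \<otimes> v) b w]"
    using ok_Mt[of "u \<otimes> v" ?x ?h "[ihom v (K a u b w)]" "[]"] h o by simp_all
  have ye: "L (u \<otimes> v) ?y \<bullet> E a (u \<otimes> v) b w [] = Sp u v [ihom v (K a u b w)] \<bullet> L u (Ep v (K a u b w) []) \<bullet> E a u b w []"
    using chain[OF L_Mt_Ep[of "u \<otimes> v" ?x ?h "[ihom v (K a u b w)]" "[]"]] h o by (simp add: E_def pcmp_assoc)
  show "?y \<in> Hom [ihom v (K a u b w)] [K a (u \<otimes> v) b w]"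
    using y by (simp add: Hom_iff)
  have eS: "Sp u v [K a (u \<otimes> v) b w] \<bullet> L u (L v (R (TIso (completion_tensoring C) (a, u) v (b, w)) []))
    \<bullet> L u (Ep v (K a u b w) []) \<bullet> E a u b w [] = E a (u \<otimes> v) b w []"
    using o by (simp add: e)
  show "R (TIso (completion_tensoring C) (a, u) v (b, w)) [] \<bullet> ?y = Id [K a (u \<otimes> v) b w]"
    by (rule E_cancel[of "u \<otimes> v" _ a b w "[]"])
      (use o y t in \<open>simp_all add: L_pcmp pcmp_assoc ye L_Id Sp_move eS\<close>)
  show "?y \<bullet> R (TIso (completion_tensoring C) (a, u) v (b, w)) [] = Id [ihom v (K a u b w)]"
    by (rule double_cancel[of u v _ a b w "[]"])
      (use o y t in \<open>simp_all add: L_pcmp pcmp_assoc e ye L_Id Jn_move\<close>)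
qed

text \<open>Two successive actions insert the identity of \<open>a\<close> twice, and a unit law of
  \<open>C\<close> merges the two insertions.\<close>

lemma vfunctor_completion_LTens:
  assumes a: "a \<in> VObj C" and u: "u \<in> Obj V"
  shows "vfunctor self_enriched (completion C) (LTens (completion_tensoring C) (a, u))"
proof (rule vfunctorI)
  let ?F = "LTens (completion_tensoring C) (a, u)"
  note t = completion_LTens_hom[OF a u] ok_R[OF completion_LTens_hom[OF a u]]
  note e = L_completion_LTens_E[OF a u] chain[OF L_completion_LTens_E[OF a u]]
  note s = L_pcmp pcmp_assoc e L_completion_M_E L_completion_J_E L_completion_chain L_completion_J_chain
    Sp_move
  show "J self_enriched v [] \<bullet> R (FHom ?F v v) [] = J (completion C) (FObj ?F v) []"
    if v: "v \<in> VObj self_enriched" for v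
    by (rule E_cancel[of "u \<otimes> v" _ a a "u \<otimes> v" "[]"])
      (use a u v in \<open>simp_all add: t s L_move[OF L_self_J_Ep] L_Id\<close>)
  show "M self_enriched v w x [] \<bullet> R (FHom ?F v x) [] = L (VHom self_enriched v w) (R (FHom ?F w x) [])
      \<bullet> R (FHom ?F v w) [VHom (completion C) (FObj ?F w) (FObj ?F x)]
      \<bullet> M (completion C) (FObj ?F v) (FObj ?F w) (FObj ?F x) []"
    if o: "v \<in> VObj self_enriched" "w \<in> VObj self_enriched" "x \<in> VObj self_enriched" for v w x
    by (rule E_cancel[of "u \<otimes> v" _ a a "u \<otimes> x" "[]"])
      (use a u o in \<open>simp_all add: t s L_move[OF L_self_M_Ep] L_move[OF Ep_move(1)] J_back J_M Jn_move\<close>)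
qed (use a u in \<open>simp_all add: completion_LTens_hom\<close>)

text \<open>Both naturality laws are tested by evaluating at \<open>v\<close> and at
  \<open>u\<close>. For naturality in \<open>v\<close> the action of the left adjoint has inserted
  an identity of \<open>a\<close>, removed by the unit law; for naturality in the object of the
  completion both sides end with the same composition in \<open>C\<close>.\<close>

lemma vadjunction_completion_tensoring:
  assumes a: "a \<in> VObj C" and u: "u \<in> Obj V"
  shows "vadjunction self_enriched (completion C) (LTens (completion_tensoring C) (a, u))
    (representable (completion C) (a, u)) (TIso (completion_tensoring C) (a, u))"
proof (rule vadjunctionI)
  let ?F = "LTens (completion_tensoring C) (a, u)" and ?G = "representable (completion C) (a, u)"
    and ?p = "TIso (completion_tensoring C) (a, u)"
  show "vfunctor self_enriched (completion C) ?F" by (rule vfunctor_completion_LTens[OF a u])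
  show "vfunctor (completion C) self_enriched ?G" using a u by (intro vfunctor_representable) simp_all
  show "?p v d \<in> iso (VHom (completion C) (FObj ?F v) d) (VHom self_enriched v (FObj ?G d))"
    if "v \<in> VObj self_enriched" "d \<in> VObj (completion C)" for v d
    using that a u by (cases d) (simp add: completion_TIso_iso)
  note t = ok_R[OF completion_LTens_hom[OF a u]] ok_R[OF completion_TIso_hom[OF a _ u]]
  note e = L_completion_LTens_E[OF a u] chain[OF L_completion_LTens_E[OF a u]]
    L_completion_TIso_Ep[OF a _ u] chain3[OF L_completion_TIso_Ep[OF a _ u]]
  note s = L_pcmp pcmp_assoc e L_completion_M_E L_completion_J_E L_completion_chain L_completion_J_chain
  show "R (FHom ?F v w) [VHom (completion C) (FObj ?F w) d] \<bullet> M (completion C) (FObj ?F v) (FObj ?F w) d []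
      \<bullet> R (?p v d) [] = L (VHom self_enriched v w) (R (?p w d) []) \<bullet> M self_enriched v w (FObj ?G d) []"
    if o: "v \<in> VObj self_enriched" "w \<in> VObj self_enriched" "d \<in> VObj (completion C)" for v w d
  proof -
    obtain b x where d: "d = (b, x)" by (cases d)
    show ?thesis unfolding d
      by (rule double_cancel[of u v _ a b x "[]"])
        (use a u o in \<open>simp_all add: d t s Jn_move L_move[OF L_self_M_Ep] L_move[OF L_move(1)[OF L_self_M_Ep]]
          L_move[OF Ep_move(1)] J_back J_M\<close>)
  qed
  show "M (completion C) (FObj ?F v) d e [] \<bullet> R (?p v e) [] = L (VHom (completion C) (FObj ?F v) d) (R (FHom ?G d e) [])
      \<bullet> R (?p v d) [VHom self_enriched (FObj ?G d) (FObj ?G e)] \<bullet> M self_enriched v (FObj ?G d) (FObj ?G e) []"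
    if o: "v \<in> VObj self_enriched" "d \<in> VObj (completion C)" "e \<in> VObj (completion C)" for v d e
  proof -
    obtain b x where d: "d = (b, x)" by (cases d)
    obtain c y where e': "e = (c, y)" by (cases e)
    have au: "(a, u) \<in> VObj (completion C)" using a u by simp
    have rh: "FHom ?G (b, x) (c, y) \<in> hom (K b x c y) (ihom (K a u b x) (K a u c y))"
      using representable_FHom_hom[OF vcategory_completion au, of "(b, x)" "(c, y)"] o d e' by simp
    have re: "L (K a u b x) (R (FHom ?G (b, x) (c, y)) z) \<bullet> Ep (K a u b x) (K a u c y) z
        = M (completion C) (a, u) (b, x) (c, y) z" if "word z" for z
      using L_representable_Ep[OF vcategory_completion au, of "(b, x)" "(c, y)" z] o d e' that by simp
    show ?thesis unfolding d e'
      by (rule double_cancel[of u v _ a c y "[]"])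
        (use a u o in \<open>simp_all add: d e' t ok_R[OF rh] s Jn_move L_move[OF L_self_M_Ep] L_move[OF Ep_move(1)]
          L_move[OF L_move(1)[OF R_move(1)[OF completion_TIso_hom[OF a _ u]]]]
          L_move[OF re]\<close>)
  qed
qed

lemma tensored_completion: "tensored (completion C) (completion_tensoring C)"
  using vadjunction_completion_tensoring by (auto simp: tensored_def)

section \<open>The embedding into the completion\<close>

lemma completion_embedding_FObj [simp]: "FObj (completion_embedding C) a = (a, \<one>)"
  by (simp add: completion_embedding_def)

lemma
  assumes "a \<in> VObj C" "b \<in> VObj C"
  shows completion_embedding_hom: "FHom (completion_embedding C) a b \<in> hom (VHom C a b) (K a \<one> b \<one>)"
    and L_completion_embedding_E: "word z \<Longrightarrow>
      L \<one> (R (FHom (completion_embedding C) a b) z) \<bullet> E a \<one> b \<one> z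
      = Dl (VHom C a b # z) \<bullet> L (VHom C a b) (In z)"
proof -
  have ob: "VHom C a b \<in> Obj V" using assms by simp
  note h = cmp_hom[OF iso_hom[OF lun_iso[OF ob]] inv_hom[OF run_iso[OF ob]]]
  have d: "FHom (completion_embedding C) a b = mate \<one> (VHom C a b) (lun (VHom C a b) \<cdot> inv (run (VHom C a b)))"
    by (simp add: completion_embedding_def)
  show "FHom (completion_embedding C) a b \<in> hom (VHom C a b) (K a \<one> b \<one>)"
    using mate_hom[OF h] ob by (simp add: d)
  show "word z \<Longrightarrow> L \<one> (R (FHom (completion_embedding C) a b) z) \<bullet> E a \<one> b \<one> z
      = Dl (VHom C a b # z) \<bullet> L (VHom C a b) (In z)"
    using ob by (simp add: d E_def L_mate_Ep_chain[OF h])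
      (simp add: Bi_def R_cmp[OF iso_hom[OF lun_iso] inv_hom[OF run_iso]] R_lun R_inv_run pcmp_assoc)
qed

lemma vfunctor_completion_embedding: "vfunctor C (completion C) (completion_embedding C)"
proof (rule vfunctorI)
  let ?F = "completion_embedding C"
  note t = ok_R[OF completion_embedding_hom]
  note e = L_completion_embedding_E chain[OF L_completion_embedding_E]
  note s = L_pcmp pcmp_assoc e L_completion_M_E L_completion_J_E
  show "J C a [] \<bullet> R (FHom ?F a a) [] = J (completion C) (FObj ?F a) []" if a: "a \<in> VObj C" for a
    by (rule E_cancel[of \<one> _ a a \<one> "[]"]) (use a in \<open>simp_all add: t s Dl_move J_back\<close>)
  show "M C a b c [] \<bullet> R (FHom ?F a c) [] = L (VHom C a b) (R (FHom ?F b c) [])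
      \<bullet> R (FHom ?F a b) [VHom (completion C) (FObj ?F b) (FObj ?F c)]
      \<bullet> M (completion C) (FObj ?F a) (FObj ?F b) (FObj ?F c) []"
    if o: "a \<in> VObj C" "b \<in> VObj C" "c \<in> VObj C" for a b c
    by (rule E_cancel[of \<one> _ a c \<one> "[]"])
      (use o in \<open>simp_all add: t s Dl_move L_move[OF In_move(1)] L_move[OF L_completion_embedding_E] M_move\<close>)
qed (use C in \<open>simp_all add: completion_embedding_hom\<close>)

lemma completion_embedding_iso:
  assumes o: "a \<in> VObj C" "b \<in> VObj C"
  shows "FHom (completion_embedding C) a b \<in> iso (VHom C a b) (K a \<one> b \<one>)"
proof (rule isoI_R[OF completion_embedding_hom[OF o]])
  \<comment> \<open>The object is [1 -> C(a -> b) 1]: supply the unit as argument, evaluate, and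
    delete the unit that is left over.\<close>
  let ?y = "In [K a \<one> b \<one>] \<bullet> E a \<one> b \<one> [] \<bullet> L (VHom C a b) (Dl [])"
  note t = ok_R[OF completion_embedding_hom[OF o]]
  note e = L_completion_embedding_E[OF o] chain[OF L_completion_embedding_E[OF o]]
  show "?y \<in> Hom [K a \<one> b \<one>] [VHom C a b]" using o by (simp add: Hom_iff)
  show "R (FHom (completion_embedding C) a b) [] \<bullet> ?y = Id [VHom C a b]"
    using o by (simp add: t pcmp_assoc In_move e)
  show "?y \<bullet> R (FHom (completion_embedding C) a b) [] = Id [K a \<one> b \<one>]"
    by (rule E_cancel[of \<one> _ a b \<one> "[]"])
      (use o in \<open>simp_all add: t pcmp_assoc L_pcmp e Dl_move L_Id\<close>)
qed

section \<open>Tensors\<close>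

text \<open>Evaluation transported along the adjunction isomorphism. It is the universal cell v C(c
  <| v -> b) z -> C(c -> b) z, with the role that \<open>Ep\<close> has for internal homs.\<close>

definition Psi :: "('c, 'o, 'm) tensoring \<Rightarrow> 'c \<Rightarrow> 'o \<Rightarrow> 'c \<Rightarrow> 'o list \<Rightarrow> ('o, 'm) cell" where
  "Psi T c v b z = L v (R (TIso T c v b) z) \<bullet> Ep v (VHom C c b) z"

definition eta :: "('c, 'o, 'm) tensoring \<Rightarrow> 'c \<Rightarrow> 'o \<Rightarrow> 'o list \<Rightarrow> ('o, 'm) cell" where
  "eta T c v z = R (tens_unit C T c v) z"

context
  fixes T :: "('c, 'o, 'm) tensoring"
  assumes T: "tensored C T"
begin

lemma tensored_vadjunction:
  "c \<in> VObj C \<Longrightarrow> vadjunction self_enriched C (LTens T c) (representable C c) (TIso T c)"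
  using T unfolding tensored_def by blast

lemma tens_VObj [simp]: "c \<in> VObj C \<Longrightarrow> v \<in> Obj V \<Longrightarrow> tens T c v \<in> VObj C"
  using FObj_VObj[OF vadjunction_left[OF tensored_vadjunction]] by simp

lemma TIso_iso:
  "c \<in> VObj C \<Longrightarrow> v \<in> Obj V \<Longrightarrow> b \<in> VObj C \<Longrightarrow>
    TIso T c v b \<in> iso (VHom C (tens T c v) b) (ihom v (VHom C c b))"
  using vadjunction_iso[OF tensored_vadjunction] by simp

lemmas TIso_hom = iso_hom[OF TIso_iso]

lemma ok_Psi [simp]:
  assumes "c \<in> VObj C" "v \<in> Obj V" "b \<in> VObj C" "word z"
  shows "ok (Psi T c v b z)" "dm (Psi T c v b z) = v # VHom C (tens T c v) b # z"
    "cd (Psi T c v b z) = VHom C c b # z"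
  using assms by (simp_all add: Psi_def ok_R[OF TIso_hom])

lemma Psi_move:
  assumes "c \<in> VObj C" "v \<in> Obj V" "b \<in> VObj C" "ok g" "cd g = w"
  shows "L v (L (VHom C (tens T c v) b) g) \<bullet> Psi T c v b w = Psi T c v b (dm g) \<bullet> L (VHom C c b) g"
    "L v (L (VHom C (tens T c v) b) g) \<bullet> Psi T c v b w \<bullet> k = Psi T c v b (dm g) \<bullet> L (VHom C c b) g \<bullet> k"
  using assms by (simp_all add: Psi_def pcmp_assoc L_pcmp L_move[OF R_move(1)[OF TIso_hom]] Ep_move)

lemma Psi_cancel:
  assumes "L v f \<bullet> Psi T c v b z = L v g \<bullet> Psi T c v b z"
    "c \<in> VObj C" "v \<in> Obj V" "b \<in> VObj C"
    "ok f" "cd f = VHom C (tens T c v) b # z" "ok g" "cd g = VHom C (tens T c v) b # z"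
  shows "f = g"
proof -
  have z: "word z" using ok_word(2)[OF assms(5)] assms(6) by simp
  note i = TIso_iso[OF assms(2-4)] and t = ok_R[OF TIso_hom[OF assms(2-4)]]
  have "f \<bullet> R (TIso T c v b) z = g \<bullet> R (TIso T c v b) z"
    by (rule Ep_cancel[of v _ "VHom C c b" z])
      (use assms z in \<open>simp_all add: t Psi_def L_pcmp pcmp_assoc\<close>)
  then show ?thesis
    by (rule right_cancel[OF R_inv(1)[OF i z]]) (use assms in simp_all)
qed

lemma Psi_lift:
  assumes "c \<in> VObj C" "v \<in> Obj V" "b \<in> VObj C" "ok h" "dm h = v # p" "cd h = VHom C c b # z"
  obtains f where "ok f" "dm f = p" "cd f = VHom C (tens T c v) b # z" "L v f \<bullet> Psi T c v b z = h"
proof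
  have z: "word z" using ok_word(2)[OF assms(4)] assms(6) by simp
  let ?f = "Mt v (VHom C c b) z h \<bullet> R (inv (TIso T c v b)) z"
  note i = TIso_iso[OF assms(1-3)]
  note m = ok_Mt[of v "VHom C c b" h p z] L_Mt_Ep[of v "VHom C c b" h p z]
  show f: "ok ?f" "dm ?f = p" "cd ?f = VHom C (tens T c v) b # z"
    using assms z m by (simp_all add: ok_R[OF inv_hom[OF i]])
  show "L v ?f \<bullet> Psi T c v b z = h"
    using assms z m by (simp add: Psi_def L_pcmp pcmp_assoc L_move[OF R_inv(2)[OF i z]] L_Id)
qed

text \<open>This is naturality of the adjunction isomorphism in the target object, seen after
  evaluation at \<open>v\<close>.\<close>

lemma L_M_Psi:
  assumes c: "c \<in> VObj C" and v: "v \<in> Obj V" and bd: "b \<in> VObj C" "d \<in> VObj C" and z: "word z"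
  shows "L v (M C (tens T c v) b d z) \<bullet> Psi T c v d z = Psi T c v b (VHom C b d # z) \<bullet> M C c b d z"
proof -
  have "M C (tens T c v) b d z \<bullet> R (TIso T c v d) z
    = L (VHom C (tens T c v) b) (R (FHom (representable C c) b d) z)
      \<bullet> R (TIso T c v b) (ihom (VHom C c b) (VHom C c d) # z) \<bullet> M self_enriched v (VHom C c b) (VHom C c d) z"
    using vadjunction_nat_right[OF tensored_vadjunction[OF c], of v b d z] v bd z by simp
  then have e: "L v (M C (tens T c v) b d z) \<bullet> L v (R (TIso T c v d) z)
    = L v (L (VHom C (tens T c v) b) (R (FHom (representable C c) b d) z)
      \<bullet> R (TIso T c v b) (ihom (VHom C c b) (VHom C c d) # z) \<bullet> M self_enriched v (VHom C c b) (VHom C c d) z)"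
    by (rule L_move)
  note r = representable_FHom_hom[OF C c bd]
  show ?thesis
    using c v bd z
    by (simp add: Psi_def pcmp_assoc chain[OF e])
      (simp add: L_pcmp pcmp_assoc L_self_M_Ep L_self_chain L_move[OF R_move(1)[OF TIso_hom[OF c v]]] ok_R[OF r] Ep_move
        L_representable_Ep)
qed

lemma
  assumes c: "c \<in> VObj C" and v: "v \<in> Obj V"
  shows tens_unit_hom: "tens_unit C T c v \<in> hom v (VHom C c (tens T c v))"
    and eta_eq: "word z \<Longrightarrow> eta T c v z = L v (J C (tens T c v) z) \<bullet> Psi T c v (tens T c v) z"
proof -
  have i: "VIde C (tens T c v) \<in> hom \<one> (VHom C (tens T c v) (tens T c v))" using c v by simp
  note j = TIso_hom[OF c v tens_VObj[OF c v]]
  note h = inv_hom[OF run_iso[OF v]] tarr_hom[OF ide_hom[OF v] cmp_hom[OF i j]]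
    eps_hom[OF v VHom_Obj[OF C c tens_VObj[OF c v]]]
  have d: "tens_unit C T c v = inv (run v) \<cdot> (ide v \<odot> (VIde C (tens T c v) \<cdot> TIso T c v (tens T c v)))
      \<cdot> eps v (VHom C c (tens T c v))"
    by (simp add: tens_unit_def tens_unmate_def)
  show "tens_unit C T c v \<in> hom v (VHom C c (tens T c v))"
    unfolding d by (rule cmp3_hom[OF h])
  show "word z \<Longrightarrow> eta T c v z = L v (J C (tens T c v) z) \<bullet> Psi T c v (tens T c v) z"
    using c v unfolding eta_def d
    by (simp add: R_cmp3[OF h] R_inv_run R_tarr_ide_left[OF cmp_hom[OF i j]] R_cmp[OF i j] R_eps Psi_def
      J_def Pt_def L_pcmp pcmp_assoc ok_R[OF i] ok_R[OF j])
qed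

lemma ok_eta [simp]:
  assumes "c \<in> VObj C" "v \<in> Obj V" "word z"
  shows "ok (eta T c v z)" "dm (eta T c v z) = v # z" "cd (eta T c v z) = VHom C c (tens T c v) # z"
  using assms by (simp_all add: eta_def ok_R[OF tens_unit_hom])

lemma eta_move:
  assumes "c \<in> VObj C" "v \<in> Obj V" "ok g" "cd g = w"
  shows "L v g \<bullet> eta T c v w = eta T c v (dm g) \<bullet> L (VHom C c (tens T c v)) g"
    "L v g \<bullet> eta T c v w \<bullet> k = eta T c v (dm g) \<bullet> L (VHom C c (tens T c v)) g \<bullet> k"
  unfolding eta_def using assms by (simp_all add: R_move[OF tens_unit_hom])

text \<open>A Yoneda argument: by naturality in the target, the universal cell is determined by its
  value at the identity of c <| v, which is the unit \<open>eta\<close>.\<close>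

lemma eta_M:
  assumes "c \<in> VObj C" "v \<in> Obj V" "b \<in> VObj C" "word z"
  shows "eta T c v (VHom C (tens T c v) b # z) \<bullet> M C c (tens T c v) b z = Psi T c v b z"
  using assms by (simp add: eta_eq pcmp_assoc L_M_Psi[symmetric] L_move[OF J_M] L_Id)

text \<open>The inverse of \<open>eta\<close>, as a cell from the empty word. It exists because the universal property of
  \<open>Psi\<close>, unlike that of a tensor, lifts cells into \<open>C(c \<rightarrow> c) v\<close>; this is where duals are needed.\<close>

lemma eta_inverse:
  assumes c: "c \<in> VObj C" and v: "v \<in> Obj V"
  obtains t where "ok t" "dm t = []" "cd t = [VHom C (tens T c v) c, v]"
    "L v t \<bullet> eta T c v [VHom C (tens T c v) c, v] \<bullet> M C c (tens T c v) c [v] = J C c [v]"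
    "t \<bullet> L (VHom C (tens T c v) c) (eta T c v []) \<bullet> M C (tens T c v) c (tens T c v) [] = J C (tens T c v) []"
proof -
  obtain t where t: "ok t" "dm t = []" "cd t = [VHom C (tens T c v) c, v]" "L v t \<bullet> Psi T c v c [v] = J C c [v]"
    using Psi_lift[of c v c "J C c [v]" "[]" "[v]"] c v by auto
  have 1: "L v t \<bullet> eta T c v [VHom C (tens T c v) c, v] \<bullet> M C c (tens T c v) c [v] = J C c [v]"
    using c v t by (simp add: eta_M)
  \<comment> \<open>Under \<open>Psi\<close> both sides become \<open>eta\<close>: on the left, the
    defining equation of \<open>t\<close> yields the identity of \<open>c\<close>, which then slides
    past \<open>eta\<close> and cancels.\<close>
  have "t \<bullet> L (VHom C (tens T c v) c) (eta T c v []) \<bullet> M C (tens T c v) c (tens T c v) [] = J C (tens T c v) []"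
    by (rule Psi_cancel[of v _ c "tens T c v" "[]"])
      (use c v t in \<open>simp_all add: L_pcmp pcmp_assoc L_M_Psi Psi_move chain[OF t(4)] J_back J_M eta_eq[symmetric]\<close>)
  then show thesis using that t 1 by blast
qed

text \<open>The isomorphism \<open>s\<close> leaves room for two uses: the left unitor for the
  comparison morphism, where \<open>u\<close> is \<open>\<one> \<otimes> v\<close>, and the identity
  for essential surjectivity. The hypothesis \<open>fE\<close> says that \<open>f\<close> evaluates
  to \<open>eta\<close> after \<open>s\<close>, with a unit letter appended for the object (c <| v,
  1).\<close>

lemma uiso_completionI:
  assumes c: "c \<in> VObj C" and v: "v \<in> Obj V" and s: "s \<in> iso u v" and f: "f \<in> hom \<one> (K c u (tens T c v) \<one>)"
    and fE: "\<And>z. word z \<Longrightarrow> L u (Pt f z) \<bullet> E c u (tens T c v) \<one> z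
      = R s z \<bullet> eta T c v z \<bullet> L (VHom C c (tens T c v)) (In z)"
  shows "f \<in> uiso (completion C) (c, u) (tens T c v, \<one>)"
proof -
  let ?d = "tens T c v"
  have u: "u \<in> Obj V" using hom_Obj[OF iso_hom[OF s]] by simp
  obtain t0 where t0: "ok t0" "dm t0 = []" "cd t0 = [VHom C ?d c, v]"
    "L v t0 \<bullet> eta T c v [VHom C ?d c, v] \<bullet> M C c ?d c [v] = J C c [v]"
    "t0 \<bullet> L (VHom C ?d c) (eta T c v []) \<bullet> M C ?d c ?d [] = J C ?d []"
    using eta_inverse[OF c v] by blast
  \<comment> \<open>The inverse in evaluated form: delete the unit, which is the second component of
    \<open>(?d, \<one>)\<close>, produce the letters of \<open>t0\<close>, and carry
    \<open>v\<close> back to \<open>u\<close> along \<open>s\<close>. The candidate \<open>t\<close>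
    is its mate.\<close>
  define h where "h = Dl [] \<bullet> t0 \<bullet> L (VHom C ?d c) (R (inv s) []) \<bullet> Jn (VHom C ?d c) u []"
  define t where "t = Mt \<one> (VHom C ?d c \<otimes> u) [] h"
  note i = ok_R[OF inv_hom[OF s]] and si = ok_R[OF iso_hom[OF s]]
  have h: "ok h" "dm h = [\<one>]" "cd h = [VHom C ?d c \<otimes> u]"
    using c v u t0 by (simp_all add: h_def i)
  have t: "ok t" "dm t = []" "cd t = [K ?d \<one> c u]"
    using ok_Mt[of \<one> "VHom C ?d c \<otimes> u" h "[]" "[]"] c v u h by (simp_all add: t_def)
  have tE: "L \<one> t \<bullet> E ?d \<one> c u [] = Dl [] \<bullet> t0 \<bullet> L (VHom C ?d c) (R (inv s) [])"
    using chain[OF L_Mt_Ep[of \<one> "VHom C ?d c \<otimes> u" h "[]" "[]"]] c v u h t0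
    by (simp add: t_def E_def) (simp add: h_def pcmp_assoc i)
  note p = ok_Pt[OF f]
  show ?thesis
  proof (rule uisoI)
    show "f \<in> uhom (completion C) (c, u) (?d, \<one>)" using f by (simp add: uhom_def)
    show "t \<in> Hom [] [VHom (completion C) (?d, \<one>) (c, u)]" using t by (simp add: Hom_iff)
    show "t \<bullet> Pt f [VHom (completion C) (?d, \<one>) (c, u)] \<bullet> M (completion C) (c, u) (?d, \<one>) (c, u) []
      = J (completion C) (c, u) []"
    proof (rule E_cancel[of u _ c c u "[]"])
      have "L u (t \<bullet> Pt f [K ?d \<one> c u] \<bullet> M (completion C) (c, u) (?d, \<one>) (c, u) []) \<bullet> E c u c u []
        = R s [] \<bullet> eta T c v [] \<bullet> L (VHom C c ?d) (t \<bullet> In [K ?d \<one> c u] \<bullet> E ?d \<one> c u []) \<bullet> M C c ?d c [u]"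
        using c u v t
        by (simp add: L_pcmp pcmp_assoc L_completion_M_E chain[OF fE] p si R_move[OF iso_hom[OF s]] eta_move)
      also have "\<dots> = R s [] \<bullet> (eta T c v [] \<bullet> L (VHom C c ?d) t0) \<bullet> M C c ?d c [v] \<bullet> L (VHom C c c) (R (inv s) [])"
        using c u v t t0 by (simp add: In_move tE pcmp_assoc L_pcmp M_move i)
      \<comment> \<open>Since \<open>t0\<close> acts on the tail, it may be produced before
        \<open>eta\<close> instead of after it; this is the form in which its defining equation
        applies.\<close>
      also have "eta T c v [] \<bullet> L (VHom C c ?d) t0 = L v t0 \<bullet> eta T c v [VHom C ?d c, v]"
        using c v t0 by (simp add: eta_move)
      also have "R s [] \<bullet> (L v t0 \<bullet> eta T c v [VHom C ?d c, v]) \<bullet> M C c ?d c [v] \<bullet> L (VHom C c c) (R (inv s) [])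
        = J C c [u]"
        using c u v s by (simp add: pcmp_assoc chain3[OF t0(4)] J_back i)
      finally show "L u (t \<bullet> Pt f [VHom (completion C) (?d, \<one>) (c, u)] \<bullet> M (completion C) (c, u) (?d, \<one>) (c, u) [])
          \<bullet> E c u c u [] = L u (J (completion C) (c, u) []) \<bullet> E c u c u []"
        using c u v by (simp add: L_completion_J_E)
    qed (use c u v t p in simp_all)
    show "t \<bullet> L (VHom (completion C) (?d, \<one>) (c, u)) (Pt f []) \<bullet> M (completion C) (?d, \<one>) (c, u) (?d, \<one>) []
      = J (completion C) (?d, \<one>) []"
    proof (rule E_cancel[of \<one> _ ?d ?d \<one> "[]"])
      have "L \<one> (t \<bullet> L (K ?d \<one> c u) (Pt f []) \<bullet> M (completion C) (?d, \<one>) (c, u) (?d, \<one>) []) \<bullet> E ?d \<one> ?d \<one> []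
        = Dl [] \<bullet> t0 \<bullet> L (VHom C ?d c) (R (inv s) [] \<bullet> R s [] \<bullet> eta T c v []) \<bullet> M C ?d c ?d [] \<bullet> L (VHom C ?d ?d) (In [])"
        using c u v t s
        by (simp add: L_pcmp pcmp_assoc L_completion_M_E E_move chain[OF tE] L_move[OF fE] p M_move del: R_inv)
      also have "\<dots> = J C ?d [\<one>]"
        using c u v s t0 by (simp add: chain3[OF t0(5)] J_back)
      finally show "L \<one> (t \<bullet> L (VHom (completion C) (?d, \<one>) (c, u)) (Pt f []) \<bullet> M (completion C) (?d, \<one>) (c, u) (?d, \<one>) [])
          \<bullet> E ?d \<one> ?d \<one> [] = L \<one> (J (completion C) (?d, \<one>) []) \<bullet> E ?d \<one> ?d \<one> []"
        using c u v by (simp add: L_completion_J_E)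
    qed (use c u v t p in simp_all)
  qed (use c u v in simp_all)
qed

lemma tens_comparison_uiso:
  assumes c: "c \<in> VObj C" and v: "v \<in> Obj V"
  shows "tens_comparison C T (completion_tensoring C) (completion_embedding C) c v
    \<in> uiso (completion C) (c, \<one> \<otimes> v) (tens T c v, \<one>)"
proof (rule uiso_completionI[OF c v lun_iso[OF v]])
  let ?d = "tens T c v"
  let ?g = "run v \<cdot> (tens_unit C T c v \<cdot> FHom (completion_embedding C) c ?d)"
  let ?\<kappa> = "TIso (completion_tensoring C) (c, \<one>) v (?d, \<one>)"
  let ?f = "mate v \<one> ?g \<cdot> inv ?\<kappa>"
  have d: "?d \<in> VObj C" using c v by simp
  note h = tens_unit_hom[OF c v] completion_embedding_hom[OF c d]
  note r = iso_hom[OF run_iso[OF v]]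
  note g = cmp_hom[OF r cmp_hom[OF h]]
  have k: "?\<kappa> \<in> iso (K c (\<one> \<otimes> v) ?d \<one>) (ihom v (K c \<one> ?d \<one>))"
    using completion_TIso_iso[OF c d unt_Obj v unt_Obj] .
  have m: "mate v \<one> ?g \<in> hom \<one> (ihom v (K c \<one> ?d \<one>))" using mate_hom[OF g] c d v by simp
  have f: "?f \<in> hom \<one> (K c (\<one> \<otimes> v) ?d \<one>)" by (rule cmp_hom[OF m inv_hom[OF k]])
  have eq: "tens_comparison C T (completion_tensoring C) (completion_embedding C) c v = ?f"
    by (simp add: tens_comparison_def tens_mate_def)
  show "tens_comparison C T (completion_tensoring C) (completion_embedding C) c v \<in> hom \<one> (K c (\<one> \<otimes> v) ?d \<one>)"
    using f by (simp add: eq)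
  show "L (\<one> \<otimes> v) (Pt (tens_comparison C T (completion_tensoring C) (completion_embedding C) c v) z)
      \<bullet> E c (\<one> \<otimes> v) ?d \<one> z = R (lun v) z \<bullet> eta T c v z \<bullet> L (VHom C c ?d) (In z)" if z: "word z" for z
  proof -
    \<comment> \<open>\<open>?f\<close> ends in the inverse of the currying isomorphism. Composing
      with the isomorphism itself brings in its known evaluation in place of a formula for the
      inverse.\<close>
    have fk: "Pt ?f z \<bullet> R ?\<kappa> z = Pt (mate v \<one> ?g) z"
      using z k m by (simp add: Pt_cmp[OF m inv_hom[OF k]] pcmp_assoc ok_R[OF m] ok_Pt[OF m])
    have "L \<one> (L v (Pt ?f z)) \<bullet> Jn \<one> v (K c (\<one> \<otimes> v) ?d \<one> # z) \<bullet> E c (\<one> \<otimes> v) ?d \<one> z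
      = L \<one> (L v (Pt ?f z \<bullet> R ?\<kappa> z)) \<bullet> L \<one> (Ep v (K c \<one> ?d \<one>) z) \<bullet> E c \<one> ?d \<one> z"
      using c d v z by (simp add: L_pcmp pcmp_assoc L_completion_TIso_Ep)
    also have "\<dots> = L \<one> (eta T c v z \<bullet> R (FHom (completion_embedding C) c ?d) z) \<bullet> E c \<one> ?d \<one> z"
      unfolding fk using c d v z
      by (simp add: Pt_def L_pcmp pcmp_assoc L_move[OF L_mate_Ep[OF g]] Bi_def R_cmp[OF r cmp_hom[OF h]]
        R_cmp[OF h] R_run eta_def[symmetric])
    also have "\<dots> = Dl (v # z) \<bullet> eta T c v z \<bullet> L (VHom C c ?d) (In z)"
      using c d v z by (simp add: L_pcmp pcmp_assoc L_completion_embedding_E Dl_move)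
    \<comment> \<open>Splitting \<open>\<one> \<otimes> v\<close> and then deleting the unit is the
      left unitor, by \<open>R_lun\<close>.\<close>
    finally have "Sp \<one> v z \<bullet> Jn \<one> v z \<bullet> L (\<one> \<otimes> v) (Pt ?f z) \<bullet> E c (\<one> \<otimes> v) ?d \<one> z
      = Sp \<one> v z \<bullet> Dl (v # z) \<bullet> eta T c v z \<bullet> L (VHom C c ?d) (In z)"
      using c d v z f by (simp add: Jn_move ok_Pt[OF f])
    then show ?thesis
      using c d v z f by (simp add: eq R_lun pcmp_assoc ok_Pt[OF f])
  qed
qed

lemma tensored_completion_embedding:
  "tensored_vfunctor C T (completion C) (completion_tensoring C) (completion_embedding C)"
  using T tensored_completion vfunctor_completion_embedding tens_comparison_uiso
  by (simp add: tensored_vfunctor_def)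

lemma completion_embedding_eso:
  assumes c: "c \<in> VObj C" and v: "v \<in> Obj V"
  shows "\<exists>f. f \<in> uiso (completion C) (c, v) (tens T c v, \<one>)"
proof -
  let ?d = "tens T c v"
  \<comment> \<open>The mate of \<open>?g\<close> is the unit of the tensor seen as a point: the
    source is padded with 1 because points start at 1, the target because the second component of
    the object (c <| v, 1) is 1.\<close>
  let ?g = "run v \<cdot> (tens_unit C T c v \<cdot> inv (run (VHom C c ?d)))"
  have d: "?d \<in> VObj C" using c v by simp
  have H: "VHom C c ?d \<in> Obj V" using c d by simp
  note h = tens_unit_hom[OF c v] inv_hom[OF run_iso[OF H]]
  note r = iso_hom[OF run_iso[OF v]]
  note g = cmp_hom[OF r cmp_hom[OF h]]
  have m: "mate v \<one> ?g \<in> hom \<one> (K c v ?d \<one>)" using mate_hom[OF g] c d v H by simp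
  have "L v (Pt (mate v \<one> ?g) z) \<bullet> E c v ?d \<one> z
    = R (ide v) z \<bullet> eta T c v z \<bullet> L (VHom C c ?d) (In z)" if z: "word z" for z
    using c d v z H
    by (simp add: Pt_def E_def L_pcmp pcmp_assoc L_mate_Ep_chain[OF g])
      (simp add: Bi_def R_cmp[OF r cmp_hom[OF h]]
        R_cmp[OF h] R_run R_inv_run pcmp_assoc R_ide eta_def[symmetric])
  then show ?thesis using uiso_completionI[OF c v ide_iso[OF v] m] by blast
qed

end
end

section \<open>Equivalences\<close>

context monoidal_category
begin

text \<open>The inverse in \<open>D\<close> has a preimage under the invertible
  \<open>FHom F b a\<close>, and both inverse laws may be tested after applying the faithful
  \<open>F\<close>.\<close>

lemma uiso_reflect:
  assumes F: "vfunctor C D F" and ab: "a \<in> VObj C" "b \<in> VObj C"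
    and ff: "\<And>a b. a \<in> VObj C \<Longrightarrow> b \<in> VObj C \<Longrightarrow>
      FHom F a b \<in> iso (VHom C a b) (VHom D (FObj F a) (FObj F b))"
    and f: "f \<in> uhom C a b" and fF: "f \<cdot> FHom F a b \<in> uiso D (FObj F a) (FObj F b)"
  shows "f \<in> uiso C a b"
proof -
  note C [simp] = vfunctor_source[OF F] and D [simp] = vfunctor_target[OF F] and FO [simp] = FObj_VObj[OF F]
  note t = ok_R[OF FHom_hom[OF F]] ok_R[OF inv_hom[OF ff]]
  have fh: "f \<in> hom \<one> (VHom C a b)" using f by (simp add: uhom_def)
  obtain g where g: "g \<in> uhom D (FObj F b) (FObj F a)"
    and g1: "\<And>z. word z \<Longrightarrow> Pt g z \<bullet> Pt (f \<cdot> FHom F a b) (VHom D (FObj F b) (FObj F a) # z)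
      \<bullet> M D (FObj F a) (FObj F b) (FObj F a) z = J D (FObj F a) z"
    and g2: "\<And>z. word z \<Longrightarrow> Pt (f \<cdot> FHom F a b) z \<bullet> Pt g (VHom D (FObj F a) (FObj F b) # z)
      \<bullet> M D (FObj F b) (FObj F a) (FObj F b) z = J D (FObj F b) z"
    using uisoE[OF fF D FO[OF ab(1)] FO[OF ab(2)]] by blast
  have gh: "g \<in> hom \<one> (VHom D (FObj F b) (FObj F a))" using g by (simp add: uhom_def)
  note p = ok_Pt[OF fh] ok_Pt[OF gh]
  let ?t = "Pt g [] \<bullet> R (inv (FHom F b a)) []"
  have tF: "?t \<bullet> R (FHom F b a) [] = Pt g []" using ab by (simp add: pcmp_assoc p R_inv[OF ff])
  show ?thesis
  proof (rule uisoI[OF C ab f])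
    show "?t \<in> Hom [] [VHom C b a]" using ab by (simp add: Hom_iff p t)
    show "?t \<bullet> Pt f [VHom C b a] \<bullet> M C a b a [] = J C a []"
    proof (rule right_cancel[OF R_inv(1)[OF ff[OF ab(1,1)], of "[]"]])
      have "(?t \<bullet> Pt f [VHom C b a] \<bullet> M C a b a []) \<bullet> R (FHom F a a) []
        = ?t \<bullet> (Pt f [VHom C b a] \<bullet> L (VHom C a b) (R (FHom F b a) []))
          \<bullet> R (FHom F a b) [VHom D (FObj F b) (FObj F a)] \<bullet> M D (FObj F a) (FObj F b) (FObj F a) []"
        using ab by (simp add: pcmp_assoc R_FHom_M[OF F])
      also have "Pt f [VHom C b a] \<bullet> L (VHom C a b) (R (FHom F b a) [])
        = R (FHom F b a) [] \<bullet> Pt f [VHom D (FObj F b) (FObj F a)]"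
        using ab by (simp add: Pt_move(1)[OF fh] t)
      also have "?t \<bullet> (R (FHom F b a) [] \<bullet> Pt f [VHom D (FObj F b) (FObj F a)])
          \<bullet> R (FHom F a b) [VHom D (FObj F b) (FObj F a)] \<bullet> M D (FObj F a) (FObj F b) (FObj F a) []
        = J D (FObj F a) []"
        using ab g1[of "[]"] by (simp add: pcmp_assoc p R_inv[OF ff] Pt_cmp[OF fh FHom_hom[OF F ab]])
      also have "\<dots> = J C a [] \<bullet> R (FHom F a a) []" using ab by (simp add: R_FHom_J[OF F])
      finally show "(?t \<bullet> Pt f [VHom C b a] \<bullet> M C a b a []) \<bullet> R (FHom F a a) [] = J C a [] \<bullet> R (FHom F a a) []" .
    qed (use ab in \<open>simp_all add: p t\<close>)
    show "?t \<bullet> L (VHom C b a) (Pt f []) \<bullet> M C b a b [] = J C b []"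
    proof (rule right_cancel[OF R_inv(1)[OF ff[OF ab(2,2)], of "[]"]])
      have "(?t \<bullet> L (VHom C b a) (Pt f []) \<bullet> M C b a b []) \<bullet> R (FHom F b b) []
        = ?t \<bullet> L (VHom C b a) (Pt (f \<cdot> FHom F a b) []) \<bullet> R (FHom F b a) [VHom D (FObj F a) (FObj F b)]
          \<bullet> M D (FObj F b) (FObj F a) (FObj F b) []"
        using ab by (simp add: pcmp_assoc R_FHom_M[OF F] Pt_cmp[OF fh FHom_hom[OF F ab]] L_pcmp)
      also have "\<dots> = Pt g [] \<bullet> L (VHom D (FObj F b) (FObj F a)) (Pt (f \<cdot> FHom F a b) [])
          \<bullet> M D (FObj F b) (FObj F a) (FObj F b) []"
        using ab
        by (simp add: pcmp_assoc R_inv[OF ff] R_move[OF FHom_hom[OF F]] p ok_Pt[OF cmp_hom[OF fh FHom_hom[OF F ab]]])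
      also have "\<dots> = Pt (f \<cdot> FHom F a b) [] \<bullet> Pt g [VHom D (FObj F a) (FObj F b)]
          \<bullet> M D (FObj F b) (FObj F a) (FObj F b) []"
        using ab by (simp add: Pt_move[OF gh] ok_Pt[OF cmp_hom[OF fh FHom_hom[OF F ab]]])
      also have "\<dots> = J C b [] \<bullet> R (FHom F b b) []" using ab g2[of "[]"] by (simp add: R_FHom_J[OF F])
      finally show "(?t \<bullet> L (VHom C b a) (Pt f []) \<bullet> M C b a b []) \<bullet> R (FHom F b b) [] = J C b [] \<bullet> R (FHom F b b) []" .
    qed (use ab in \<open>simp_all add: p t\<close>)
  qed
qed

lemma vfunctor_id: "vcategory C \<Longrightarrow> vfunctor C C (vfun_id C)"
  by (rule vfunctorI) (simp_all add: vfun_id_def ide_hom R_ide L_Id)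

lemma vfunctor_cmp:
  assumes F: "vfunctor C D F" and G: "vfunctor D B G"
  shows "vfunctor C B (vfun_cmp F G)"
proof (rule vfunctorI)
  note [simp] = vfunctor_source[OF F] vfunctor_target[OF F] vfunctor_target[OF G] FObj_VObj[OF F] FObj_VObj[OF G]
  note t = ok_R[OF FHom_hom[OF F]] ok_R[OF FHom_hom[OF G]]
  have R: "R (FHom (vfun_cmp F G) a b) z = R (FHom F a b) z \<bullet> R (FHom G (FObj F a) (FObj F b)) z"
    if "a \<in> VObj C" "b \<in> VObj C" "word z" for a b z
    using that by (simp add: vfun_cmp_def R_cmp[OF FHom_hom[OF F] FHom_hom[OF G]])
  have o: "FObj (vfun_cmp F G) a = FObj G (FObj F a)" for a by (simp add: vfun_cmp_def)
  show "vcategory C" "vcategory B" by simp_all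
  show "FObj (vfun_cmp F G) a \<in> VObj B" if "a \<in> VObj C" for a using that by (simp add: o)
  show "FHom (vfun_cmp F G) a b \<in> hom (VHom C a b) (VHom B (FObj (vfun_cmp F G) a) (FObj (vfun_cmp F G) b))"
    if "a \<in> VObj C" "b \<in> VObj C" for a b
    using that cmp_hom[OF FHom_hom[OF F] FHom_hom[OF G]] by (simp add: vfun_cmp_def)
  show "J C a [] \<bullet> R (FHom (vfun_cmp F G) a a) [] = J B (FObj (vfun_cmp F G) a) []" if "a \<in> VObj C" for a
    using that by (simp add: R o R_FHom_J[OF G] chain[OF R_FHom_J[OF F]])
  show "M C a b c [] \<bullet> R (FHom (vfun_cmp F G) a c) [] = L (VHom C a b) (R (FHom (vfun_cmp F G) b c) [])
      \<bullet> R (FHom (vfun_cmp F G) a b) [VHom B (FObj (vfun_cmp F G) b) (FObj (vfun_cmp F G) c)]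
      \<bullet> M B (FObj (vfun_cmp F G) a) (FObj (vfun_cmp F G) b) (FObj (vfun_cmp F G) c) []"
    if "a \<in> VObj C" "b \<in> VObj C" "c \<in> VObj C" for a b c
    using that
    by (simp add: R o chain[OF R_FHom_M[OF F]] pcmp_assoc R_FHom_M[OF G] L_pcmp R_move[OF FHom_hom[OF F]] t)
qed

text \<open>The ordinary argument with choice: choose objects \<open>g d\<close> and isomorphisms
  \<open>s d\<close>, conjugate hom objects by them, and return along the inverses of the
  \<open>FHom\<close>. The inverse points \<open>s'\<close> are chosen as well, since
  \<open>uiso\<close> only asserts that they exist.\<close>

lemma vequivalentI:
  assumes F: "vfunctor C D F"
    and ff: "\<And>a b. a \<in> VObj C \<Longrightarrow> b \<in> VObj C \<Longrightarrow>
      FHom F a b \<in> iso (VHom C a b) (VHom D (FObj F a) (FObj F b))"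
    and eso: "\<And>d. d \<in> VObj D \<Longrightarrow> \<exists>a\<in>VObj C. \<exists>f. f \<in> uiso D (FObj F a) d"
  shows "vequivalent C D"
proof -
  note C [simp] = vfunctor_source[OF F] and D [simp] = vfunctor_target[OF F] and FO [simp] = FObj_VObj[OF F]
  have "\<exists>g. \<forall>d\<in>VObj D. g d \<in> VObj C \<and> (\<exists>f. f \<in> uiso D (FObj F (g d)) d)"
    using eso by (intro bchoice) blast
  then obtain g where g [simp]: "\<And>d. d \<in> VObj D \<Longrightarrow> g d \<in> VObj C"
    and "\<forall>d\<in>VObj D. \<exists>f. f \<in> uiso D (FObj F (g d)) d" by blast
  then obtain s where s: "\<And>d. d \<in> VObj D \<Longrightarrow> s d \<in> uiso D (FObj F (g d)) d" by (metis bchoice)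
  have "\<exists>s'. \<forall>d\<in>VObj D. s' d \<in> uhom D d (FObj F (g d)) \<and>
     (\<forall>z. word z \<longrightarrow> Pt (s' d) z \<bullet> Pt (s d) (VHom D d (FObj F (g d)) # z)
        \<bullet> M D (FObj F (g d)) d (FObj F (g d)) z = J D (FObj F (g d)) z) \<and>
     (\<forall>z. word z \<longrightarrow> Pt (s d) z \<bullet> Pt (s' d) (VHom D (FObj F (g d)) d # z)
        \<bullet> M D d (FObj F (g d)) d z = J D d z)"
  proof (intro bchoice ballI)
    fix d assume d: "d \<in> VObj D"
    show "\<exists>s'. s' \<in> uhom D d (FObj F (g d)) \<and>
     (\<forall>z. word z \<longrightarrow> Pt s' z \<bullet> Pt (s d) (VHom D d (FObj F (g d)) # z)
        \<bullet> M D (FObj F (g d)) d (FObj F (g d)) z = J D (FObj F (g d)) z) \<and>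
     (\<forall>z. word z \<longrightarrow> Pt (s d) z \<bullet> Pt s' (VHom D (FObj F (g d)) d # z)
        \<bullet> M D d (FObj F (g d)) d z = J D d z)"
      by (rule uisoE[OF s[OF d] D]) (use d in auto)
  qed
  then obtain s' where s': "\<And>d. d \<in> VObj D \<Longrightarrow> s' d \<in> uhom D d (FObj F (g d))"
    and a1: "\<And>d z. d \<in> VObj D \<Longrightarrow> word z \<Longrightarrow> Pt (s' d) z \<bullet> Pt (s d) (VHom D d (FObj F (g d)) # z)
        \<bullet> M D (FObj F (g d)) d (FObj F (g d)) z = J D (FObj F (g d)) z"
    and a2: "\<And>d z. d \<in> VObj D \<Longrightarrow> word z \<Longrightarrow> Pt (s d) z \<bullet> Pt (s' d) (VHom D (FObj F (g d)) d # z)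
        \<bullet> M D d (FObj F (g d)) d z = J D d z"
    by metis
  define q where "q d = FObj F (g d)" for d
  have q [simp]: "d \<in> VObj D \<Longrightarrow> q d \<in> VObj D" for d by (simp add: q_def)
  have sh: "s d \<in> hom \<one> (VHom D (q d) d)" and sh': "s' d \<in> hom \<one> (VHom D d (q d))" if "d \<in> VObj D" for d
    using s[OF that] s'[OF that] by (simp_all add: uiso_def uhom_def q_def)
  note p [simp] = ok_Pt[OF sh] ok_Pt[OF sh']
  \<comment> \<open>In \<open>a1\<close> and \<open>a2\<close> the right factor of the composite is
    inserted first; here it is the left one. Both orders occur below.\<close>
  have b1: "Pt (s d) z \<bullet> L (VHom D (q d) d) (Pt (s' d) z) \<bullet> M D (q d) d (q d) z = J D (q d) z"
    and b2: "Pt (s' d) z \<bullet> L (VHom D d (q d)) (Pt (s d) z) \<bullet> M D d (q d) d z = J D d z"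
    if "d \<in> VObj D" "word z" for d z
    using a1[OF that] a2[OF that] that
    by (simp_all add: Pt_move[OF sh] Pt_move[OF sh'] q_def[symmetric])

  have a2': "Pt (s d) z \<bullet> Pt (s' d) (VHom D (q d) d # z) \<bullet> M D d (q d) d z = J D d z"
    if "d \<in> VObj D" "word z" for d z
    using a2[OF that] by (simp add: q_def)
  \<comment> \<open>\<open>X d e\<close> conjugates D(d -> e) by the chosen isomorphisms into D(q d
    -> q e). This is what the inverse functor followed by \<open>F\<close> has to do on hom
    objects.\<close>
  define X where "X d e z = Pt (s d) (VHom D d e # z) \<bullet> M D (q d) d e z
    \<bullet> L (VHom D (q d) e) (Pt (s' e) z) \<bullet> M D (q d) e (q e) z" for d e z
  have X_ok [simp]: "ok (X d e z)" "dm (X d e z) = VHom D d e # z" "cd (X d e z) = VHom D (q d) (q e) # z"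
    if "d \<in> VObj D" "e \<in> VObj D" "word z" for d e z
    using that by (simp_all add: X_def)
  have X_nat: "L (VHom D d e) (Pt (s e) z) \<bullet> X d e (VHom D (q e) e # z) \<bullet> M D (q d) (q e) e z
    = Pt (s d) (VHom D d e # z) \<bullet> M D (q d) d e z" if "d \<in> VObj D" "e \<in> VObj D" "word z" for d e z
    using that
    by (simp add: X_def pcmp_assoc Pt_move[OF sh] M_move M_assoc L_move3[OF a2'] L_J_M)
  have X_J: "J D d z \<bullet> X d d z = J D (q d) z" if "d \<in> VObj D" "word z" for d z
    using that by (simp add: X_def Pt_move[OF sh] chain[OF L_J_M] b1)
  \<comment> \<open>Naturality of \<open>s'\<close>: composing with \<open>s' e\<close> in front
    cancels the factor \<open>s e\<close> of \<open>X\<close>, by \<open>b2\<close>.\<close>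
  have X_s': "X e f z \<bullet> Pt (s' e) (VHom D (q e) (q f) # z) \<bullet> M D e (q e) (q f) z
    = L (VHom D e f) (Pt (s' f) z) \<bullet> M D e f (q f) z"
    if "e \<in> VObj D" "f \<in> VObj D" "word z" for e f z
  proof -
    have "X e f z \<bullet> Pt (s' e) (VHom D (q e) (q f) # z) \<bullet> M D e (q e) (q f) z
      = Pt (s' e) (VHom D e f # z) \<bullet> L (VHom D e (q e)) (X e f z) \<bullet> M D e (q e) (q f) z"
      using that by (simp add: Pt_move[OF sh'])
    also have "\<dots> = L (VHom D e f) (Pt (s' f) z) \<bullet> M D e f (q f) z"
      using that
      by (simp add: X_def pcmp_assoc L_pcmp M_move M_assoc[symmetric] chain3[OF b2] chain[OF M_assoc[symmetric]] chain[OF J_M])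
    finally show ?thesis .
  qed
  have X_M: "M D d e f z \<bullet> X d f z
    = L (VHom D d e) (X e f z) \<bullet> X d e (VHom D (q e) (q f) # z) \<bullet> M D (q d) (q e) (q f) z"
    if "d \<in> VObj D" "e \<in> VObj D" "f \<in> VObj D" "word z" for d e f z
  proof -
    \<comment> \<open>Associativity moves the \<open>s' e\<close> that ends the first factor onto
      the second one, where \<open>X_s'\<close> applies.\<close>
    have "L (VHom D d e) (X e f z) \<bullet> X d e (VHom D (q e) (q f) # z) \<bullet> M D (q d) (q e) (q f) z
      = Pt (s d) (VHom D d e # VHom D e f # z) \<bullet> M D (q d) d e (VHom D e f # z)
        \<bullet> L (VHom D (q d) e) (X e f z \<bullet> Pt (s' e) (VHom D (q e) (q f) # z) \<bullet> M D e (q e) (q f) z)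
        \<bullet> M D (q d) e (q f) z"
      using that
      by (simp add: X_def[of d e] pcmp_assoc L_pcmp Pt_move[OF sh] M_move M_assoc)
    also have "\<dots> = M D d e f z \<bullet> X d f z"
      unfolding X_s'[OF that(2-4)] using that
      by (simp add: X_def pcmp_assoc L_pcmp Pt_move[OF sh] M_move M_assoc[symmetric] chain[OF M_assoc[symmetric]])
    finally show ?thesis by simp
  qed

  \<comment> \<open>\<open>P\<close> composes with \<open>s d\<close> in front and \<open>Q\<close>
    with \<open>s' e\<close> behind, so \<open>P d e \<cdot> Q d e\<close> is the arrow of V whose
    cells are \<open>X d e\<close>. Its preimage under \<open>F\<close> is the action of
    \<open>G\<close>.\<close>
  define P where "P d e = inv (lun (VHom D d e)) \<cdot> (s d \<odot> ide (VHom D d e)) \<cdot> VCmp D (q d) d e" for d e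
  define Q where "Q d e = inv (run (VHom D (q d) e)) \<cdot> (ide (VHom D (q d) e) \<odot> s' e) \<cdot> VCmp D (q d) e (q e)" for d e
  define G where "G = \<lparr> FObj = g, FHom = (\<lambda>d e. P d e \<cdot> Q d e \<cdot> inv (FHom F (g d) (g e))) \<rparr>"
  have GO [simp]: "FObj G d = g d" for d by (simp add: G_def)
  have G_hom: "FHom G d e \<in> hom (VHom D d e) (VHom C (g d) (g e))"
    and GX: "word z \<Longrightarrow> R (FHom G d e) z \<bullet> R (FHom F (g d) (g e)) z = X d e z"
    if de: "d \<in> VObj D" "e \<in> VObj D" for d e z
  proof -
    have w: "VHom D d e \<in> Obj V" "VHom D (q d) e \<in> Obj V" using de by simp_all
    have c: "VCmp D (q d) d e \<in> hom (VHom D (q d) d \<otimes> VHom D d e) (VHom D (q d) e)"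
      "VCmp D (q d) e (q e) \<in> hom (VHom D (q d) e \<otimes> VHom D e (q e)) (VHom D (q d) (q e))"
      using de by simp_all
    have i: "FHom F (g d) (g e) \<in> iso (VHom C (g d) (g e)) (VHom D (q d) (q e))"
      using ff[of "g d" "g e"] de by (simp add: q_def)
    note Ph = pre_hom[OF sh[OF de(1)] ide_hom[OF w(1)] c(1), folded P_def]
      and Qh = post_hom[OF sh'[OF de(2)] ide_hom[OF w(2)] c(2), folded Q_def]
    show "FHom G d e \<in> hom (VHom D d e) (VHom C (g d) (g e))"
      using cmp3_hom[OF Ph Qh inv_hom[OF i]] by (simp add: G_def)
    assume z: "word z"
    have "R (P d e) z = Pt (s d) (VHom D d e # z) \<bullet> M D (q d) d e z"
      using R_pre[OF sh[OF de(1)] ide_hom[OF w(1)] c(1) z, folded P_def] de z w by (simp add: R_ide M_def[symmetric])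
    moreover have "R (Q d e) z = L (VHom D (q d) e) (Pt (s' e) z) \<bullet> M D (q d) e (q e) z"
      using R_post[OF sh'[OF de(2)] ide_hom[OF w(2)] c(2) z, folded Q_def] de z w by (simp add: R_ide M_def[symmetric])
    ultimately show "R (FHom G d e) z \<bullet> R (FHom F (g d) (g e)) z = X d e z"
      using z i de by (simp add: G_def R_cmp3[OF Ph Qh inv_hom[OF i]] pcmp_assoc X_def)
  qed
  note t [simp] = ok_R[OF FHom_hom[OF F]] ok_R[OF G_hom]
  have G: "vfunctor D C G"
  proof (rule vfunctorI)
    \<comment> \<open>\<open>F\<close> is faithful, so the functor laws may be checked after
      applying it; there \<open>G\<close> becomes \<open>X\<close> and they are \<open>X_J\<close>
      and \<open>X_M\<close>.\<close>
    show "J D d [] \<bullet> R (FHom G d d) [] = J C (FObj G d) []" if d: "d \<in> VObj D" for d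
      by (rule right_cancel[OF R_inv(1)[OF ff[OF g[OF d] g[OF d]], of "[]"]])
        (use d in \<open>simp_all add: pcmp_assoc GX X_J R_FHom_J[OF F] q_def\<close>)
    show "M D d e f [] \<bullet> R (FHom G d f) [] = L (VHom D d e) (R (FHom G e f) [])
        \<bullet> R (FHom G d e) [VHom C (FObj G e) (FObj G f)] \<bullet> M C (FObj G d) (FObj G e) (FObj G f) []"
      if def: "d \<in> VObj D" "e \<in> VObj D" "f \<in> VObj D" for d e f
    proof (rule right_cancel[OF R_inv(1)[OF ff[OF g[OF def(1)] g[OF def(3)]], of "[]"]])
      have n: "R (FHom G d e) [VHom C (g e) (g f)] \<bullet> L (VHom C (g d) (g e)) (R (FHom F (g e) (g f)) [])
        = L (VHom D d e) (R (FHom F (g e) (g f)) []) \<bullet> R (FHom G d e) [VHom D (q e) (q f)]"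
        using def by (simp add: R_move[OF G_hom] q_def)
      show "(M D d e f [] \<bullet> R (FHom G d f) []) \<bullet> R (FHom F (g d) (g f)) []
        = (L (VHom D d e) (R (FHom G e f) []) \<bullet> R (FHom G d e) [VHom C (FObj G e) (FObj G f)]
          \<bullet> M C (FObj G d) (FObj G e) (FObj G f) []) \<bullet> R (FHom F (g d) (g f)) []"
        using def
        by (simp add: pcmp_assoc GX X_M R_FHom_M[OF F] chain[OF n] L_move[OF GX] chain[OF GX] flip: q_def)
    qed (use def in simp_all)
  qed (simp_all add: G_hom)
  have GF: "R (FHom (vfun_cmp G F) d e) z = X d e z" if "d \<in> VObj D" "e \<in> VObj D" "word z" for d e z
    using that by (simp add: vfun_cmp_def R_cmp[OF G_hom FHom_hom[OF F]] GX)
  have GFO: "FObj (vfun_cmp G F) d = q d" for d by (simp add: vfun_cmp_def q_def)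
  have "vnat_iso D D (vfun_cmp G F) (vfun_id D) s"
  proof (rule vnat_isoI[OF vfunctor_cmp[OF G F] vfunctor_id[OF D]])
    show "s d \<in> uiso D (FObj (vfun_cmp G F) d) (FObj (vfun_id D) d)" if "d \<in> VObj D" for d
      using s[OF that] by (simp add: vfun_cmp_def vfun_id_def)
    show "R (FHom (vfun_id D) d e) [] \<bullet> Pt (s d) [VHom D (FObj (vfun_id D) d) (FObj (vfun_id D) e)]
        \<bullet> M D (FObj (vfun_cmp G F) d) (FObj (vfun_id D) d) (FObj (vfun_id D) e) []
      = L (VHom D d e) (Pt (s e) []) \<bullet> R (FHom (vfun_cmp G F) d e) [VHom D (FObj (vfun_cmp G F) e) (FObj (vfun_id D) e)]
        \<bullet> M D (FObj (vfun_cmp G F) d) (FObj (vfun_cmp G F) e) (FObj (vfun_id D) e) []"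
      if de: "d \<in> VObj D" "e \<in> VObj D" for d e
      using X_nat[OF de, of "[]"] de
      by (simp add: vfun_id_def R_ide GF GFO)
  qed
  moreover
  \<comment> \<open>The preimage of \<open>s\<close> at \<open>F a\<close> under the fully faithful
    \<open>F\<close>; it is invertible by \<open>uiso_reflect\<close>.\<close>
  define h where "h a = s (FObj F a) \<cdot> inv (FHom F (g (FObj F a)) a)" for a
  have hF: "h a \<in> hom \<one> (VHom C (g (FObj F a)) a)" "h a \<cdot> FHom F (g (FObj F a)) a = s (FObj F a)"
    and hF_Pt: "word z \<Longrightarrow> Pt (h a) z \<bullet> R (FHom F (g (FObj F a)) a) z = Pt (s (FObj F a)) z"
    if a: "a \<in> VObj C" for a z
  proof -
    note s1 = sh[OF FO[OF a], unfolded q_def] and i = ff[OF g[OF FO[OF a]] a]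
    show hh: "h a \<in> hom \<one> (VHom C (g (FObj F a)) a)"
      unfolding h_def by (rule cmp_hom[OF s1 inv_hom[OF i]])
    show e: "h a \<cdot> FHom F (g (FObj F a)) a = s (FObj F a)"
      unfolding h_def using cmp_assoc[OF s1 inv_hom[OF i] iso_hom[OF i]] inv_cmp[OF i] cmp_ide[OF s1] by simp
    show "word z \<Longrightarrow> Pt (h a) z \<bullet> R (FHom F (g (FObj F a)) a) z = Pt (s (FObj F a)) z"
      using Pt_cmp[OF hh iso_hom[OF i]] by (simp add: e)
  qed
  have "vnat_iso C C (vfun_cmp F G) (vfun_id C) h"
  proof (rule vnat_isoI[OF vfunctor_cmp[OF F G] vfunctor_id[OF C]])
    show "h a \<in> uiso C (FObj (vfun_cmp F G) a) (FObj (vfun_id C) a)" if a: "a \<in> VObj C" for a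
      using uiso_reflect[OF F _ a ff, of "g (FObj F a)" "h a"] hF[OF a] s[OF FO[OF a]] a
      by (simp add: vfun_cmp_def vfun_id_def uhom_def)
    show "R (FHom (vfun_id C) a b) [] \<bullet> Pt (h a) [VHom C (FObj (vfun_id C) a) (FObj (vfun_id C) b)]
        \<bullet> M C (FObj (vfun_cmp F G) a) (FObj (vfun_id C) a) (FObj (vfun_id C) b) []
      = L (VHom C a b) (Pt (h b) []) \<bullet> R (FHom (vfun_cmp F G) a b) [VHom C (FObj (vfun_cmp F G) b) (FObj (vfun_id C) b)]
        \<bullet> M C (FObj (vfun_cmp F G) a) (FObj (vfun_cmp F G) b) (FObj (vfun_id C) b) []"
      if ab: "a \<in> VObj C" "b \<in> VObj C" for a b
    proof -
      let ?a = "FObj F a" and ?b = "FObj F b"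
      note h' = ok_Pt[OF hF(1)[OF ab(1)]] ok_Pt[OF hF(1)[OF ab(2)]]
      have n1: "Pt (h a) [VHom C a b] \<bullet> L (VHom C (g ?a) a) (R (FHom F a b) [])
        = R (FHom F a b) [] \<bullet> Pt (h a) [VHom D ?a ?b]"
        using ab by (simp add: Pt_move[OF hF(1)])
      have n2: "R (FHom G ?a ?b) [VHom C (g ?b) b] \<bullet> L (VHom C (g ?a) (g ?b)) (R (FHom F (g ?b) b) [])
        = L (VHom D ?a ?b) (R (FHom F (g ?b) b) []) \<bullet> R (FHom G ?a ?b) [VHom D (q ?b) ?b]"
        using ab by (simp add: R_move[OF G_hom] q_def)
      have n3: "R (FHom F a b) [VHom C (g ?b) b] \<bullet> L (VHom D ?a ?b) (R (FHom F (g ?b) b) [])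
        = L (VHom C a b) (R (FHom F (g ?b) b) []) \<bullet> R (FHom F a b) [VHom D (q ?b) ?b]"
        using ab by (simp add: R_move[OF FHom_hom[OF F]] q_def)
      have n4: "L (VHom C a b) (Pt (s ?b) []) \<bullet> R (FHom F a b) [VHom D (q ?b) ?b]
        = R (FHom F a b) [] \<bullet> L (VHom D ?a ?b) (Pt (s ?b) [])"
        using ab by (simp add: R_move[OF FHom_hom[OF F]])
      let ?l = "Pt (h a) [VHom C a b] \<bullet> M C (g ?a) a b []"
        and ?r = "L (VHom C a b) (Pt (h b) []) \<bullet> (R (FHom F a b) [VHom C (g ?b) b]
          \<bullet> R (FHom G ?a ?b) [VHom C (g ?b) b]) \<bullet> M C (g ?a) (g ?b) b []"
        and ?k = "R (FHom F (g ?a) b) []"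
      \<comment> \<open>After applying \<open>F\<close>, the point \<open>h\<close> becomes
        \<open>s\<close> and \<open>G\<close> becomes \<open>X\<close>, so the square is
        \<open>X_nat\<close> at \<open>?a\<close> and \<open>?b\<close>, preceded by the action of
        \<open>F\<close> on C(a -> b).\<close>
      have "?l \<bullet> ?k = R (FHom F a b) [] \<bullet> Pt (s ?a) [VHom D ?a ?b] \<bullet> M D (q ?a) ?a ?b []"
        using ab by (simp add: pcmp_assoc R_FHom_M[OF F] chain[OF n1] chain[OF hF_Pt] flip: q_def)
      also have "\<dots> = ?r \<bullet> ?k"
        using ab X_nat[of ?a ?b "[]"]
        by (simp add: pcmp_assoc R_FHom_M[OF F] chain[OF n2] chain[OF n3] L_move[OF hF_Pt] chain[OF GX] chain[OF n4]
            flip: q_def)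
      finally have lr: "?l \<bullet> ?k = ?r \<bullet> ?k" .
      have "?l = ?r"
        by (rule right_cancel[OF R_inv(1)[OF ff[OF g[OF FO[OF ab(1)]] ab(2)]] lr]) (use ab h' in simp_all)
      then show ?thesis
        using ab h' by (simp add: vfun_id_def vfun_cmp_def R_ide R_cmp[OF FHom_hom[OF F] G_hom])
    qed
  qed
  ultimately show ?thesis using F G unfolding vequivalent_def by blast
qed

end

theorem corollary5p17:
  fixes V :: "('o, 'm) rigid"
    and C :: "('c, 'o, 'm) vcat"
    and T :: "('c, 'o, 'm) tensoring"
  assumes "rigid_monoidal_category V"
    and "rigid_data.tensored V C T"
  shows "rigid_data.tensored_vfunctor V C T
           (rigid_data.completion V C) (rigid_data.completion_tensoring V C)
           (rigid_data.completion_embedding V C)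
       \<and> monoidal_data.vequivalent V C (rigid_data.completion V C)"
proof -
  interpret rigid_monoidal_category V by fact
  interpret rigid_vcategory V C
    using assms(2) by unfold_locales (simp add: tensored_def)
  have "vequivalent C (completion C)"
  proof (rule vequivalentI[OF vfunctor_completion_embedding])
    show "FHom (completion_embedding C) a b
        \<in> iso (VHom C a b) (VHom (completion C) (FObj (completion_embedding C) a) (FObj (completion_embedding C) b))"
      if "a \<in> VObj C" "b \<in> VObj C" for a b
      using completion_embedding_iso[OF that] by simp
    show "\<exists>a\<in>VObj C. \<exists>f. f \<in> uiso (completion C) (FObj (completion_embedding C) a) d"
      if d: "d \<in> VObj (completion C)" for d
    proof -
      obtain c v where cv: "d = (c, v)" "c \<in> VObj C" "v \<in> Obj V" using d by auto
      obtain f where "f \<in> uiso (completion C) (c, v) (tens T c v, \<one>)"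
        using completion_embedding_eso[OF assms(2) cv(2,3)] by blast
      \<comment> \<open>Essential surjectivity was obtained as an isomorphism out of
        \<open>(c, v)\<close>, while \<open>vequivalentI\<close> asks for one into it.\<close>
      then obtain g where "g \<in> uiso (completion C) (tens T c v, \<one>) (c, v)"
        by (rule uisoE) (use cv tens_VObj[OF assms(2)] in auto)
      then show ?thesis using cv tens_VObj[OF assms(2)] by auto
    qed
  qed
  then show ?thesis using tensored_completion_embedding[OF assms(2)] by simp
qed

end
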